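(* Let $\Gamma$ be a countable discrete group with no non-trivial finite normal subgroups and let $\Gamma\curvearrowright^\sigma(X,\mu)$ be a free, weakly mixing, cocycle superrigid m.p. action on a standard probability space. Let $\theta$ be an arbitrary free ergodic m.p. action of a countable discrete group $\Lambda$ on a standard probability space $(Y,\nu)$ and let $\Delta:\mathcal R_\sigma\simeq\mathcal R_\theta^t$ be an orbit equivalence, for some $t>0$. Then $n=1/t$ is an integer and there exist a subgroup $\Lambda_0\subset\Lambda$ of index $[\Lambda:\Lambda_0]=n$, a subset $Y_0\subset Y$ of measure $\nu(Y_0)=1/n$ fixed by $\theta_{|\Lambda_0}$, an automorphism $\alpha\in[\mathcal R_\theta]$ and a group isomorphism $\delta:\Gamma\simeq\Lambda_0$ such that $\alpha\circ\Delta$ takes $X$ onto $Y_0$ and conjugates the actions $\sigma$ and $\theta_0\circ\delta$, where $\theta_0$ denotes the action of $\Lambda_0$ on $Y_0$ given by $\theta$. Moreover, if $\Gamma$ is a countable ICC (infinite conjugacy class) group and the free m.p. action $\Gamma\curvearrowright^\sigma(X,\mu)$ is merely a quotient of a weakly mixing cocycle superrigid action of $\Gamma$, then $\Gamma\curvearrowright X$ is OE superrigid: if $\Lambda\curvearrowright^\theta Y$ is a free ergodic m.p. action of an arbitrary countable group $\Lambda$ and $\Delta:X\simeq Y$ is an orbit equivalence of $\Gamma\curvearrowright X$, $\Lambda\curvearrowright Y$, then there exist $\alpha\in[\mathcal R_\theta]$ and a group isomorphism $\delta:\Gamma\simeq\Lambda$ such that $\Delta_0=\alpha\circ\Delta$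 conjugates $\sigma$ and $\theta\circ\delta$.
   Context: **Cocycle superrigid.** A (right) measurable cocycle for $\Gamma\curvearrowright(X,\mu)$ with values in a countable discrete group $\mathcal V$ is a measurable map $w:X\times\Gamma\to\mathcal V$ with $w(t,g_1)w(g_1^{-1}t,g_2)=w(t,g_1g_2)$ for a.e. $t$, for all $g_1,g_2$. $w,w'$ are cohomologous if there is a measurable $u:X\to\mathcal V$ with $w'(t,g)=u(t)^{-1}w(t,g)u(g^{-1}t)$ a.e. for each $g$. The action is cocycle superrigid if for every countable discrete group $\mathcal V$, any $\mathcal V$-valued cocycle is cohomologous to a group morphism $\Gamma\to\mathcal V$ (viewed as a cocycle independent of $t$). **Equivalence relations.** $\mathcal R_\theta$ is the orbit equivalence relation of $\theta$; $[\mathcal R_\theta]$ is the group of automorphisms of $(Y,\nu)$ whose graph is a.e. contained in $\mathcal R_\theta$. For $t>0$: choose an integer $m\ge t$, let $\Lambda\times\mathbb Z/m\mathbb Z$ act on the probability space $Y\times\mathbb Z/m\mathbb Z$ by the product of $\theta$ and translations, and let $\mathcal R_\theta^t$ be the restriction of its orbit relation to a subset of product measure $t/m$ (with normalized measure); by ergodicity the isomorphism class depends only on $t$. For $t\le1$ one takes $m=1$, so $\mathcal R_\theta^t$ lives on a subset of $Y$ of measure $t$; the conclusion (where $t\le 1$) is understood in this realization. An orbit equivalence of two relations is an isomorphism of the underlying probability spaces taking one relation onto the other (a.e.). $\Phi$ conjugates $\sigma$ and $\theta_0\circ\delta$ if $\Phi\circ\sigma_g=\theta_0(\delta(g))\circ\Phi$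 a.e. for all $g$. A quotient of a $\Gamma$-action is a m.p. $\Gamma$-action which is its image under a $\Gamma$-equivariant m.p. map. *)

theory Defs
  imports "HOL-Probability.Probability" "HOL-Algebra.Group_Action" "HOL-Algebra.Elementary_Groups"
begin

section \<open>Groups\<close>

definition no_finite_normal_subgroups :: "('g, 'c) monoid_scheme \<Rightarrow> bool" where
  "no_finite_normal_subgroups G \<longleftrightarrow> (\<forall>H. H \<lhd> G \<and> finite H \<longrightarrow> H = {\<one>\<^bsub>G\<^esub>})"

definition icc_group :: "('g, 'c) monoid_scheme \<Rightarrow> bool" where
  "icc_group G \<longleftrightarrow> group G \<and>
     (\<forall>g\<in>carrier G - {\<one>\<^bsub>G\<^esub>}. infinite {h \<otimes>\<^bsub>G\<^esub> g \<otimes>\<^bsub>G\<^esub> inv\<^bsub>G\<^esub> h | h. h \<in> carrier G})"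


section \<open>Probability spaces and their isomorphisms\<close>

definition standard_prob_space :: "'x::polish_space measure \<Rightarrow> bool" where
  "standard_prob_space M \<longleftrightarrow> prob_space M \<and> sets M = sets borel"

text \<open>Isomorphisms are taken modulo null sets. The target is often \<^term>\<open>uniform_measure M A\<close>,
  the measure on all of \<^term>\<open>M\<close> which is concentrated on \<^term>\<open>A\<close> and is there the normalized
  restriction; an isomorphism onto it maps almost all of the source onto almost all of \<^term>\<open>A\<close>.\<close>

definition prob_iso :: "'x measure \<Rightarrow> 'y measure \<Rightarrow> ('x \<Rightarrow> 'y) \<Rightarrow> bool" where
  "prob_iso M N f \<longleftrightarrow> f \<in> measurable M N \<and> distr M N f = N \<and>
     (\<exists>g\<in>measurable N M. distr N M g = M \<and>
        (AE x in M. g (f x) = x) \<and> (AE y in N. f (g y) = y))"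


section \<open>Measure-preserving actions\<close>

definition mp_action ::
    "('g, 'c) monoid_scheme \<Rightarrow> 'x measure \<Rightarrow> ('g \<Rightarrow> 'x \<Rightarrow> 'x) \<Rightarrow> bool" where
  "mp_action G M \<sigma> \<longleftrightarrow> group_action G (space M) \<sigma> \<and> countable (carrier G) \<and>
     (\<forall>g\<in>carrier G. \<sigma> g \<in> measurable M M \<and> distr M M (\<sigma> g) = M)"

definition free_action ::
    "('g, 'c) monoid_scheme \<Rightarrow> 'x measure \<Rightarrow> ('g \<Rightarrow> 'x \<Rightarrow> 'x) \<Rightarrow> bool" where
  "free_action G M \<sigma> \<longleftrightarrow> (\<forall>g\<in>carrier G - {\<one>\<^bsub>G\<^esub>}. AE x in M. \<sigma> g x \<noteq> x)"

definition ergodic_action ::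
    "('g, 'c) monoid_scheme \<Rightarrow> 'x measure \<Rightarrow> ('g \<Rightarrow> 'x \<Rightarrow> 'x) \<Rightarrow> bool" where
  "ergodic_action G M \<sigma> \<longleftrightarrow>
     (\<forall>A\<in>sets M. (\<forall>g\<in>carrier G. AE x in M. \<sigma> g x \<in> A \<longleftrightarrow> x \<in> A) \<longrightarrow>
        (AE x in M. x \<in> A) \<or> (AE x in M. x \<notin> A))"

definition weakly_mixing_action ::
    "('g, 'c) monoid_scheme \<Rightarrow> 'x measure \<Rightarrow> ('g \<Rightarrow> 'x \<Rightarrow> 'x) \<Rightarrow> bool" where
  "weakly_mixing_action G M \<sigma> \<longleftrightarrow>
     ergodic_action G (M \<Otimes>\<^sub>M M) (\<lambda>g (x, y). (\<sigma> g x, \<sigma> g y))"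

definition conjugates ::
    "('g, 'c) monoid_scheme \<Rightarrow> 'x measure \<Rightarrow> ('x \<Rightarrow> 'y) \<Rightarrow>
     ('g \<Rightarrow> 'x \<Rightarrow> 'x) \<Rightarrow> ('g \<Rightarrow> 'y \<Rightarrow> 'y) \<Rightarrow> bool" where
  "conjugates G M \<Phi> \<sigma> \<tau> \<longleftrightarrow> (\<forall>g\<in>carrier G. AE x in M. \<Phi> (\<sigma> g x) = \<tau> g (\<Phi> x))"

definition action_quotient_map ::
    "('g, 'c) monoid_scheme \<Rightarrow> 'z measure \<Rightarrow> ('g \<Rightarrow> 'z \<Rightarrow> 'z) \<Rightarrow>
     'x measure \<Rightarrow> ('g \<Rightarrow> 'x \<Rightarrow> 'x) \<Rightarrow> ('z \<Rightarrow> 'x) \<Rightarrow> bool" where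
  "action_quotient_map G M' \<sigma>' M \<sigma> q \<longleftrightarrow>
     q \<in> measurable M' M \<and> distr M' M q = M \<and> conjugates G M' q \<sigma>' \<sigma>"


section \<open>Cocycles\<close>

definition cocycle ::
    "('g, 'c) monoid_scheme \<Rightarrow> 'x measure \<Rightarrow> ('g \<Rightarrow> 'x \<Rightarrow> 'x) \<Rightarrow>
     ('v, 'd) monoid_scheme \<Rightarrow> ('x \<Rightarrow> 'g \<Rightarrow> 'v) \<Rightarrow> bool" where
  "cocycle G M \<sigma> V w \<longleftrightarrow>
     (\<forall>g\<in>carrier G. (\<lambda>t. w t g) \<in> measurable M (count_space (carrier V))) \<and>
     (\<forall>g1\<in>carrier G. \<forall>g2\<in>carrier G. AE t in M.
        w t g1 \<otimes>\<^bsub>V\<^esub> w (\<sigma> (inv\<^bsub>G\<^esub> g1) t) g2 = w t (g1 \<otimes>\<^bsub>G\<^esub> g2))"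

definition cohomologous ::
    "('g, 'c) monoid_scheme \<Rightarrow> 'x measure \<Rightarrow> ('g \<Rightarrow> 'x \<Rightarrow> 'x) \<Rightarrow>
     ('v, 'd) monoid_scheme \<Rightarrow> ('x \<Rightarrow> 'g \<Rightarrow> 'v) \<Rightarrow> ('x \<Rightarrow> 'g \<Rightarrow> 'v) \<Rightarrow> bool" where
  "cohomologous G M \<sigma> V w w' \<longleftrightarrow>
     (\<exists>u\<in>measurable M (count_space (carrier V)). \<forall>g\<in>carrier G. AE t in M.
        w' t g = inv\<^bsub>V\<^esub> (u t) \<otimes>\<^bsub>V\<^esub> w t g \<otimes>\<^bsub>V\<^esub> u (\<sigma> (inv\<^bsub>G\<^esub> g) t))"

text \<open>Every countable group is isomorphic to one whose carrier is a set of natural numbers, so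
  quantifying over the latter covers all countable discrete target groups.\<close>

definition cocycle_superrigid ::
    "('g, 'c) monoid_scheme \<Rightarrow> 'x measure \<Rightarrow> ('g \<Rightarrow> 'x \<Rightarrow> 'x) \<Rightarrow> bool" where
  "cocycle_superrigid G M \<sigma> \<longleftrightarrow>
     (\<forall>V :: nat monoid. group V \<longrightarrow>
        (\<forall>w. cocycle G M \<sigma> V w \<longrightarrow>
           (\<exists>\<delta>\<in>hom G V. cohomologous G M \<sigma> V w (\<lambda>t g. \<delta> g))))"


section \<open>Orbit equivalence relations\<close>

definition orbit_rel ::
    "('g, 'c) monoid_scheme \<Rightarrow> 'x measure \<Rightarrow> ('g \<Rightarrow> 'x \<Rightarrow> 'x) \<Rightarrow> ('x \<times> 'x) set" where
  "orbit_rel G M \<sigma> = {(x, y). x \<in> space M \<and> y \<in> orbit G \<sigma> x}"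

definition full_group ::
    "('g, 'c) monoid_scheme \<Rightarrow> 'x measure \<Rightarrow> ('g \<Rightarrow> 'x \<Rightarrow> 'x) \<Rightarrow> ('x \<Rightarrow> 'x) set" where
  "full_group G M \<sigma> = {\<alpha>. prob_iso M M \<alpha> \<and> (AE x in M. (x, \<alpha> x) \<in> orbit_rel G M \<sigma>)}"

definition orbit_equivalence ::
    "'x measure \<Rightarrow> ('x \<times> 'x) set \<Rightarrow> 'y measure \<Rightarrow> ('y \<times> 'y) set \<Rightarrow> ('x \<Rightarrow> 'y) \<Rightarrow> bool" where
  "orbit_equivalence M R N S \<Delta> \<longleftrightarrow> prob_iso M N \<Delta> \<and>
     (\<exists>Z\<in>null_sets M. \<forall>x\<in>space M - Z. \<forall>x'\<in>space M - Z.
        (x, x') \<in> R \<longleftrightarrow> (\<Delta> x, \<Delta> x') \<in> S)"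


section \<open>Amplifications\<close>

definition amp_space :: "'y measure \<Rightarrow> nat \<Rightarrow> ('y \<times> int) measure" where
  "amp_space N m = N \<Otimes>\<^sub>M uniform_count_measure (carrier (integer_mod_group m))"

definition amp_action ::
    "('h \<Rightarrow> 'y \<Rightarrow> 'y) \<Rightarrow> nat \<Rightarrow> 'h \<times> int \<Rightarrow> 'y \<times> int \<Rightarrow> 'y \<times> int" where
  "amp_action \<theta> m = (\<lambda>(h, k) (y, i). (\<theta> h y, k \<otimes>\<^bsub>integer_mod_group m\<^esub> i))"

text \<open>The set \<^term>\<open>E\<close> on which the amplification by \<^term>\<open>t\<close> is realized. When \<^term>\<open>t \<le> 1\<close>
  the realization uses \<^term>\<open>m = 1\<close>, so that \<^term>\<open>E\<close> is a subset of measure \<^term>\<open>t\<close> of the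
  original space, up to the trivial second coordinate.\<close>

definition amp_domain :: "'y measure \<Rightarrow> real \<Rightarrow> nat \<Rightarrow> ('y \<times> int) set \<Rightarrow> bool" where
  "amp_domain N t m E \<longleftrightarrow> t \<le> real m \<and> (t \<le> 1 \<longrightarrow> m = 1) \<and>
     E \<in> sets (amp_space N m) \<and> measure (amp_space N m) E = t / real m"

definition amp_rel ::
    "('h, 'c) monoid_scheme \<Rightarrow> 'y measure \<Rightarrow> ('h \<Rightarrow> 'y \<Rightarrow> 'y) \<Rightarrow> nat \<Rightarrow> ('y \<times> int) set \<Rightarrow>
     (('y \<times> int) \<times> ('y \<times> int)) set" where
  "amp_rel H N \<theta> m E =
     orbit_rel (H \<times>\<times> integer_mod_group m) (amp_space N m) (amp_action \<theta> m) \<inter> E \<times> E"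

end

theory Submission
  imports Defs
begin

text \<open>Composing the orbit equivalence with the projection gives \<open>p : X \<rightarrow> Y\<close>, whose Zimmer cocycle takes
  values in \<open>\<Lambda>\<close>. Superrigidity untwists it (after lifting to \<open>X'\<close>): there are \<open>u\<close> and a homomorphism
  \<open>\<delta>\<close> such that \<open>\<Phi> = u\<inverse> p\<close> satisfies \<open>\<Phi> (g x) = \<delta> g (\<Phi> x)\<close>. Since \<open>\<Phi>\<close> is injective on countably many
  pieces, \<open>\<delta>\<close> has finite, hence trivial, kernel, and then \<open>\<Phi>\<close> is injective and scales the measure by
  \<open>t\<close>. Its image \<open>Y0\<close> has measure \<open>t\<close> (so \<open>t \<le> 1\<close>), is invariant under \<open>\<delta> \<Gamma>\<close> and disjoint from its
  other translates, which cover \<open>Y\<close> by ergodicity; so \<open>t\<close> times the index of \<open>\<delta> \<Gamma>\<close> is 1. The partial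
  isomorphism \<open>p x \<mapsto> \<Phi> x\<close> extends to the full group by exhaustion.

  For a quotient \<open>q : X' \<rightarrow> X\<close> one has to show that \<open>u\<close> factors through \<open>q\<close>. Two independent samples
  \<open>h, h k\<close> of \<open>u\<close> over the same point give a distribution of \<open>k\<close> that is invariant under conjugation
  by \<open>\<delta> \<Gamma>\<close>, so by the ICC property it does not charge \<open>\<delta> g\<close> for \<open>g \<noteq> 1\<close>. Hence the maps
  \<open>x \<mapsto> h\<inverse> p x\<close>, for the values \<open>h\<close> that \<open>u\<close> takes over \<open>x\<close> with positive probability, are jointly
  injective, and comparing measures leaves just one such \<open>h\<close> over almost every \<open>x\<close>.\<close>

section \<open>Measure-preserving systems\<close>

locale mp_system =
  fixes G :: "('g, 'c) monoid_scheme" and M :: "'x::polish_space measure" and \<sigma> :: "'g \<Rightarrow> 'x \<Rightarrow> 'x"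
  assumes standard: "standard_prob_space M" and action: "mp_action G M \<sigma>"
begin

sublocale prob_space M
  using standard by (simp add: standard_prob_space_def)

lemma sets_eq [measurable_cong]: "sets M = sets borel"
  using standard by (simp add: standard_prob_space_def)

lemma space_UNIV [simp]: "space M = UNIV"
  using sets_eq_imp_space_eq[OF sets_eq] by simp

sublocale group_action G UNIV \<sigma>
  using action by (simp add: mp_action_def)

sublocale group G
  using group_hom by (simp add: group_hom_def)

lemma countable_group: "countable (carrier G)"
  using action by (simp add: mp_action_def)

lemma measurable_action [measurable]: "g \<in> carrier G \<Longrightarrow> \<sigma> g \<in> measurable M M"
  using action by (simp add: mp_action_def)

lemma distr_action: "g \<in> carrier G \<Longrightarrow> distr M M (\<sigma> g) = M"
  using action by (simp add: mp_action_def)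

lemma act_one [simp]: "\<sigma> \<one>\<^bsub>G\<^esub> x = x"
  using id_eq_one by (metis UNIV_I restrict_apply')

lemma act_mult: "g \<in> carrier G \<Longrightarrow> h \<in> carrier G \<Longrightarrow> \<sigma> (g \<otimes>\<^bsub>G\<^esub> h) x = \<sigma> g (\<sigma> h x)"
  by (simp add: composition_rule)

lemma act_inv [simp]:
  assumes "g \<in> carrier G"
  shows "\<sigma> (inv\<^bsub>G\<^esub> g) (\<sigma> g x) = x" "\<sigma> g (\<sigma> (inv\<^bsub>G\<^esub> g) x) = x"
  using assms by (simp_all flip: act_mult)

lemma act_eq_iff: "g \<in> carrier G \<Longrightarrow> \<sigma> g x = \<sigma> g y \<longleftrightarrow> x = y"
  by (metis act_inv(1))

lemma act_image_eq:
  assumes "g \<in> carrier G" shows "\<sigma> g ` A = \<sigma> (inv\<^bsub>G\<^esub> g) -` A"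
proof (intro equalityI subsetI)
  fix x assume "x \<in> \<sigma> (inv\<^bsub>G\<^esub> g) -` A"
  then show "x \<in> \<sigma> g ` A"
    using assms by (intro image_eqI[where x = "\<sigma> (inv\<^bsub>G\<^esub> g) x"]) simp_all
qed (use assms in auto)

lemma emeasure_act_vimage:
  assumes "g \<in> carrier G" and "A \<in> sets M"
  shows "emeasure M (\<sigma> g -` A) = emeasure M A"
  using emeasure_distr[OF measurable_action[OF assms(1)] assms(2)] distr_action[OF assms(1)] by simp

lemma sets_act_vimage:
  assumes "g \<in> carrier G" and "A \<in> sets M"
  shows "\<sigma> g -` A \<in> sets M"
  using measurable_sets[OF measurable_action[OF assms(1)] assms(2)] by simp

lemma sets_act_image:
  assumes "g \<in> carrier G" and "A \<in> sets M"
  shows "\<sigma> g ` A \<in> sets M"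
  using assms by (simp add: act_image_eq sets_act_vimage)

lemma emeasure_act_image:
  assumes "g \<in> carrier G" and "A \<in> sets M"
  shows "emeasure M (\<sigma> g ` A) = emeasure M A"
  using assms by (simp add: act_image_eq emeasure_act_vimage)

lemma AE_act:
  assumes "g \<in> carrier G" and "AE x in M. P x"
  shows "AE x in M. P (\<sigma> g x)"
  using AE_distrD[OF measurable_action[OF assms(1)], of P] assms by (simp only: distr_action)

text \<open>The set \<open>A\<close> consists of the points whose whole orbit avoids a null set
  containing the failures of \<open>P\<close>; countability of \<open>G\<close> keeps it conull.
  This turns almost everywhere identities into pointwise ones on an invariant set.\<close>

lemma AE_invariant_core:
  assumes "AE x in M. P x"
  obtains A where "A \<in> sets M" "AE x in M. x \<in> A" "\<And>x. x \<in> A \<Longrightarrow> P x"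
    "\<And>g x. g \<in> carrier G \<Longrightarrow> x \<in> A \<Longrightarrow> \<sigma> g x \<in> A"
proof -
  from AE_E[OF assms] obtain Z where Z: "{x \<in> space M. \<not> P x} \<subseteq> Z" "emeasure M Z = 0" "Z \<in> sets M"
    by blast
  let ?A = "{x \<in> space M. \<forall>g\<in>carrier G. x \<in> \<sigma> g -` (space M - Z)}"
  have "{x \<in> space M. x \<in> \<sigma> g -` (space M - Z)} \<in> sets M" if "g \<in> carrier G" for g
    using sets_act_vimage[OF that sets.compl_sets[OF Z(3)]]
    by (simp only: space_UNIV UNIV_I simp_thms Collect_mem_eq)
  then have "?A \<in> sets M"
    by (rule sets.sets_Collect_countable_All'[OF _ countable_group])
  moreover have "AE x in M. x \<in> ?A"
  proof -
    have "AE x in M. x \<notin> Z" using Z by (intro AE_not_in) auto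
    then have "AE x in M. \<forall>g\<in>carrier G. \<sigma> g x \<notin> Z"
      by (subst AE_ball_countable[OF countable_group]) (intro ballI AE_act)
    then show ?thesis by simp
  qed
  moreover have "P x" if "x \<in> ?A" for x
    using that Z(1) one_closed by (fastforce dest: bspec[of _ _ "\<one>\<^bsub>G\<^esub>"])
  moreover have "\<sigma> g x \<in> ?A" if "g \<in> carrier G" "x \<in> ?A" for g x
    using that by (simp flip: act_mult)
  ultimately show ?thesis using that by blast
qed

section \<open>Points with trivial stabilizer\<close>

definition free_part :: "'x set" where
  "free_part = {x. \<forall>g\<in>carrier G - {\<one>\<^bsub>G\<^esub>}. \<sigma> g x \<noteq> x}"

lemma sets_free_part [measurable]: "free_part \<in> sets M"
proof -
  have *: "{x \<in> space M. \<sigma> g x \<noteq> x} \<in> sets M" if "g \<in> carrier G" for g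
  proof (rule sets.sets_Collect_neg, rule measurable_equality_set)
    show "\<sigma> g \<in> borel_measurable M" "(\<lambda>x. x) \<in> borel_measurable M"
      using measurable_action[OF that] measurable_ident_sets[OF sets_eq]
      by (auto simp: measurable_cong_sets[OF refl sets_eq])
  qed
  then have "{x \<in> space M. \<forall>g\<in>carrier G - {\<one>\<^bsub>G\<^esub>}. \<sigma> g x \<noteq> x} \<in> sets M"
    by (intro sets.sets_Collect_countable_All' countable_Diff countable_group) auto
  then show ?thesis by (simp add: free_part_def)
qed

lemma AE_free_part:
  assumes "free_action G M \<sigma>"
  shows "AE x in M. x \<in> free_part"
proof -
  have "countable (carrier G - {\<one>\<^bsub>G\<^esub>})" using countable_group by (rule countable_Diff)
  then have "AE x in M. \<forall>g\<in>carrier G - {\<one>\<^bsub>G\<^esub>}. \<sigma> g x \<noteq> x"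
    using assms by (subst AE_ball_countable) (auto simp: free_action_def)
  then show ?thesis by (simp add: free_part_def)
qed

text \<open>Used throughout to turn an equality of points in one orbit into an equality of group
  elements, in particular for the cocycle identity.\<close>

lemma free_part_inj:
  assumes "x \<in> free_part" "g \<in> carrier G" "h \<in> carrier G" "\<sigma> g x = \<sigma> h x"
  shows "g = h"
proof -
  have "\<sigma> (inv\<^bsub>G\<^esub> h \<otimes>\<^bsub>G\<^esub> g) x = x"
    using assms by (simp add: act_mult)
  then have "inv\<^bsub>G\<^esub> h \<otimes>\<^bsub>G\<^esub> g = \<one>\<^bsub>G\<^esub>"
    using assms unfolding free_part_def by blast
  then show ?thesis
    using assms by (metis inv_closed inv_equality inv_inv)
qed

lemma free_part_act:
  assumes "x \<in> free_part" "g \<in> carrier G"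
  shows "\<sigma> g x \<in> free_part"
  unfolding free_part_def mem_Collect_eq
proof (intro ballI notI)
  fix h assume h: "h \<in> carrier G - {\<one>\<^bsub>G\<^esub>}" and "\<sigma> h (\<sigma> g x) = \<sigma> g x"
  then have "h \<otimes>\<^bsub>G\<^esub> g = g"
    using assms h by (intro free_part_inj[OF assms(1)]) (simp_all add: act_mult)
  then have "h \<otimes>\<^bsub>G\<^esub> g = \<one>\<^bsub>G\<^esub> \<otimes>\<^bsub>G\<^esub> g" using assms(2) by simp
  then show False using h assms(2) right_cancel[of g h "\<one>\<^bsub>G\<^esub>"] by simp
qed

lemma mem_orbit_iff: "y \<in> orbit G \<sigma> x \<longleftrightarrow> (\<exists>g\<in>carrier G. y = \<sigma> g x)"
  by (auto simp: orbit_def)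

text \<open>The saturation of \<open>A\<close> is measurable and invariant, and it contains
  \<open>A\<close> through the unit of the group, so ergodicity leaves only the conull
  alternative.\<close>

lemma ergodic_sweep:
  assumes "ergodic_action G M \<sigma>" and [measurable]: "A \<in> sets M" and pos: "emeasure M A \<noteq> 0"
  shows "AE x in M. x \<in> (\<Union>g\<in>carrier G. \<sigma> g ` A)"
proof -
  let ?S = "\<Union>g\<in>carrier G. \<sigma> g ` A"
  have S: "?S \<in> sets M"
    by (rule sets.countable_UN''[OF countable_group]) (simp add: sets_act_image)
  have inv: "\<sigma> h x \<in> ?S \<longleftrightarrow> x \<in> ?S" if h: "h \<in> carrier G" for h x
  proof
    assume "\<sigma> h x \<in> ?S"
    then obtain g a where g: "g \<in> carrier G" "a \<in> A" "\<sigma> h x = \<sigma> g a" by blast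
    then have "x = \<sigma> (inv\<^bsub>G\<^esub> h \<otimes>\<^bsub>G\<^esub> g) a"
      using h by (simp add: act_mult flip: g(3))
    then show "x \<in> ?S" using g h by blast
  next
    assume "x \<in> ?S"
    then obtain g a where g: "g \<in> carrier G" "a \<in> A" "x = \<sigma> g a" by blast
    then have "\<sigma> h x = \<sigma> (h \<otimes>\<^bsub>G\<^esub> g) a" using h by (simp add: act_mult)
    then show "\<sigma> h x \<in> ?S" using g h by blast
  qed
  have "(AE x in M. x \<in> ?S) \<or> (AE x in M. x \<notin> ?S)"
    using assms(1)[unfolded ergodic_action_def, rule_format, OF S] inv by simp
  moreover have "\<not> (AE x in M. x \<notin> ?S)"
  proof
    assume "AE x in M. x \<notin> ?S"
    then have "AE x in M. x \<notin> A"
    proof (rule AE_mp, intro AE_I2 impI)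
      fix x assume "x \<notin> ?S"
      then have "x \<notin> \<sigma> \<one>\<^bsub>G\<^esub> ` A" by blast
      moreover have "\<sigma> \<one>\<^bsub>G\<^esub> ` A = A" by simp
      ultimately show "x \<notin> A" by blast
    qed
    then show False using pos by (simp add: AE_iff_measurable[OF _ refl])
  qed
  ultimately show ?thesis by blast
qed

end

section \<open>Embeddings that scale the measure\<close>

text \<open>Phrased by forward images, with their measurability built in, so that images of
  measurable sets can be measured directly. The factor \<open>t\<close> allows for
  amplifications.\<close>

definition scaled_embedding :: "ennreal \<Rightarrow> 'x measure \<Rightarrow> 'y measure \<Rightarrow> 'x set \<Rightarrow> ('x \<Rightarrow> 'y) \<Rightarrow> bool" where
  "scaled_embedding t M N A f \<longleftrightarrow> inj_on f A \<and>
     (\<forall>C\<in>sets M. C \<subseteq> A \<longrightarrow> f ` C \<in> sets N \<and> emeasure N (f ` C) = t * emeasure M C)"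

lemma scaled_embeddingD:
  assumes "scaled_embedding t M N A f"
  shows "inj_on f A"
    and "\<And>C. C \<in> sets M \<Longrightarrow> C \<subseteq> A \<Longrightarrow> f ` C \<in> sets N"
    and "\<And>C. C \<in> sets M \<Longrightarrow> C \<subseteq> A \<Longrightarrow> emeasure N (f ` C) = t * emeasure M C"
  using assms by (auto simp: scaled_embedding_def)

lemma scaled_embedding_subset:
  "scaled_embedding t M N A f \<Longrightarrow> B \<subseteq> A \<Longrightarrow> scaled_embedding t M N B f"
  by (auto simp: scaled_embedding_def intro: inj_on_subset)

lemma scaled_embedding_cong:
  assumes "\<And>x. x \<in> A \<Longrightarrow> f x = g x"
  shows "scaled_embedding t M N A f \<longleftrightarrow> scaled_embedding t M N A g"
proof -
  have "f ` C = g ` C" if "C \<subseteq> A" for C using assms that by (intro image_cong) auto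
  moreover have "inj_on f A \<longleftrightarrow> inj_on g A" using assms by (rule inj_on_cong)
  ultimately show ?thesis unfolding scaled_embedding_def by auto
qed

text \<open>Countable additivity over the values of \<open>\<kappa>\<close>. It applies to the
  images as well because injectivity on all of \<open>A\<close>, and not only on the pieces, makes
  them disjoint.\<close>

lemma scaled_embedding_pieces:
  assumes I: "countable I" and \<kappa>: "\<kappa> \<in> measurable M (count_space I)" and inj: "inj_on f A"
    and emb: "\<And>i. i \<in> I \<Longrightarrow> scaled_embedding t M N {x\<in>A. \<kappa> x = i} f"
  shows "scaled_embedding t M N A f"
  unfolding scaled_embedding_def
proof (intro conjI ballI impI)
  fix C assume C: "C \<in> sets M" "C \<subseteq> A"
  define P where "P i = {x\<in>C. \<kappa> x = i}" for i
  have P: "P i \<in> sets M" if "i \<in> I" for i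
  proof -
    have "\<kappa> -` {i} \<inter> space M \<in> sets M" using \<kappa> that by (intro measurable_sets[OF \<kappa>]) auto
    moreover have "P i = C \<inter> (\<kappa> -` {i} \<inter> space M)"
      using sets.sets_into_space[OF C(1)] by (auto simp: P_def)
    ultimately show ?thesis using C by simp
  qed
  have PA: "P i \<subseteq> {x\<in>A. \<kappa> x = i}" for i using C by (auto simp: P_def)
  have CP: "C = (\<Union>i\<in>I. P i)"
    using sets.sets_into_space[OF C(1)] measurable_space[OF \<kappa>] by (auto simp: P_def)
  have fP: "f ` P i \<in> sets N" "emeasure N (f ` P i) = t * emeasure M (P i)" if "i \<in> I" for i
    using scaled_embeddingD[OF emb[OF that]] P[OF that] PA by auto
  have fC: "f ` C = (\<Union>i\<in>I. f ` P i)" by (subst CP) auto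
  show "f ` C \<in> sets N"
    unfolding fC using I fP by (intro sets.countable_UN'') auto
  have disj: "disjoint_family_on P I" by (auto simp: disjoint_family_on_def P_def)
  have disjf: "disjoint_family_on (\<lambda>i. f ` P i) I"
    unfolding disjoint_family_on_def
  proof (intro ballI impI)
    fix i j assume "i \<in> I" "j \<in> I" "i \<noteq> j"
    have "f ` P i \<inter> f ` P j = f ` (P i \<inter> P j)"
      using PA by (intro inj_on_image_Int[OF inj, symmetric]) auto
    also have "P i \<inter> P j = {}" using \<open>i \<noteq> j\<close> by (auto simp: P_def)
    finally show "f ` P i \<inter> f ` P j = {}" by simp
  qed
  have "emeasure N (f ` C) = (\<integral>\<^sup>+i. emeasure N (f ` P i) \<partial>count_space I)"
    unfolding fC using fP I disjf by (intro emeasure_UN_countable) auto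
  also have "\<dots> = (\<integral>\<^sup>+i. t * emeasure M (P i) \<partial>count_space I)"
    using fP by (intro nn_integral_cong) auto
  also have "\<dots> = t * (\<integral>\<^sup>+i. emeasure M (P i) \<partial>count_space I)"
    by (rule nn_integral_cmult) simp
  also have "(\<integral>\<^sup>+i. emeasure M (P i) \<partial>count_space I) = emeasure M C"
    unfolding CP using P I disj by (intro emeasure_UN_countable[symmetric]) auto
  finally show "emeasure N (f ` C) = t * emeasure M C" .
qed (rule inj)

text \<open>On the image, the preimage of \<open>C\<close> is the forward image of
  \<open>C \<inter> A\<close>, measurable by the embedding property. Off the image the map is the
  constant \<open>x0\<close>, which contributes all of the complement or nothing.\<close>

lemma measurable_inverse_scaled_embedding:
  assumes A: "A \<in> sets M" and emb: "scaled_embedding t M N A f" and x0: "x0 \<in> space M"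
  shows "(\<lambda>y. if y \<in> f ` A then the_inv_into A f y else x0) \<in> measurable N M" (is "?g \<in> _")
proof (rule measurableI)
  note inj = scaled_embeddingD(1)[OF emb]
  have AM: "A \<subseteq> space M" using A by (rule sets.sets_into_space)
  fix y assume "y \<in> space N"
  show "?g y \<in> space M"
    using x0 AM the_inv_into_into[OF inj, of y A] by auto
next
  fix C assume C: "C \<in> sets M"
  have fA: "f ` A \<in> sets N" using scaled_embeddingD(2)[OF emb A] by simp
  have "?g -` C \<inter> space N = (?g -` C \<inter> f ` A) \<union> (?g -` C \<inter> (space N - f ` A))"
    using sets.sets_into_space[OF fA] by blast
  also have "?g -` C \<inter> f ` A = f ` (C \<inter> A)"
    using scaled_embeddingD(1)[OF emb] by (auto simp: the_inv_into_f_f)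
  also have "?g -` C \<inter> (space N - f ` A) = (if x0 \<in> C then space N - f ` A else {})"
    by auto
  also have "f ` (C \<inter> A) \<union> \<dots> \<in> sets N"
    using fA scaled_embeddingD(2)[OF emb, of "C \<inter> A"] C A by auto
  finally show "?g -` C \<inter> space N \<in> sets N" .
qed

text \<open>With factor 1 the conull set \<open>A\<close> has an image of measure 1, so the inverse
  of \<open>f\<close> on that image, extended by a constant, inverts \<open>f\<close> almost
  everywhere. Both push-forward identities reduce to measures of forward images.\<close>

lemma prob_iso_if_scaled_embedding:
  assumes M: "prob_space M" and N: "prob_space N" and f: "f \<in> measurable M N"
    and A: "A \<in> sets M" "AE x in M. x \<in> A" and emb: "scaled_embedding 1 M N A f"
  shows "prob_iso M N f"
proof -
  interpret M: prob_space M by fact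
  interpret N: prob_space N by fact
  obtain x0 where x0: "x0 \<in> space M" using M.not_empty by blast
  define g where "g y = (if y \<in> f ` A then the_inv_into A f y else x0)" for y
  note inj = scaled_embeddingD(1)[OF emb]
  have AM: "A \<subseteq> space M" using A(1) by (rule sets.sets_into_space)
  have gf: "g (f x) = x" if "x \<in> A" for x
    using that inj by (simp add: g_def the_inv_into_f_f)
  have fA: "f ` A \<in> sets N" using scaled_embeddingD(2)[OF emb A(1)] by simp
  have "emeasure N (f ` A) = 1"
    using scaled_embeddingD(3)[OF emb A(1)] M.emeasure_eq_1_AE[OF A] by simp
  then have AEfA: "AE y in N. y \<in> f ` A"
    using fA by (simp add: N.AE_in_set_eq_1 N.emeasure_eq_measure)
  have fim: "f ` (f -` B \<inter> A) = B \<inter> f ` A" for B by auto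
  have gvim: "g -` C \<inter> f ` A = f ` (C \<inter> A)" for C using gf by auto
  have g: "g \<in> measurable N M"
    unfolding g_def using A(1) emb x0 by (rule measurable_inverse_scaled_embedding)
  have "distr M N f = N"
  proof (rule measure_eqI)
    fix B assume "B \<in> sets (distr M N f)"
    then have B: "B \<in> sets N" by simp
    have fB: "f -` B \<inter> space M \<in> sets M" using measurable_sets[OF f B] .
    have fBA: "f -` B \<inter> A \<in> sets M"
      using sets.Int[OF fB A(1)] AM by (simp add: Int_assoc Int_absorb1)
    have "emeasure (distr M N f) B = emeasure M (f -` B \<inter> space M)"
      using f B by (rule emeasure_distr)
    also have "\<dots> = emeasure M (f -` B \<inter> A)"
      using A(2) fB fBA AM by (intro emeasure_eq_AE) auto
    also have "\<dots> = emeasure N (B \<inter> f ` A)"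
      using scaled_embeddingD(3)[OF emb fBA] by (simp add: fim)
    also have "\<dots> = emeasure N B"
      using AEfA B fA by (intro emeasure_eq_AE) auto
    finally show "emeasure (distr M N f) B = emeasure N B" .
  qed simp
  moreover have "distr N M g = M"
  proof (rule measure_eqI)
    fix C assume "C \<in> sets (distr N M g)"
    then have C: "C \<in> sets M" by simp
    have "emeasure (distr N M g) C = emeasure N (g -` C \<inter> space N)"
      using g C by (rule emeasure_distr)
    also have "\<dots> = emeasure N (g -` C \<inter> f ` A)"
    proof (rule emeasure_eq_AE)
      show "AE y in N. y \<in> g -` C \<inter> space N \<longleftrightarrow> y \<in> g -` C \<inter> f ` A"
        using AEfA AE_space by eventually_elim auto
    qed (use measurable_sets[OF g C] scaled_embeddingD(2)[OF emb, of "C \<inter> A"] C A(1) gvim in auto)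
    also have "\<dots> = emeasure M (C \<inter> A)"
      using scaled_embeddingD(3)[OF emb, of "C \<inter> A"] C A(1) by (simp add: gvim)
    also have "\<dots> = emeasure M C"
      using A C by (intro emeasure_eq_AE) auto
    finally show "emeasure (distr N M g) C = emeasure M C" .
  qed simp
  moreover have "AE x in M. g (f x) = x" using A(2) by eventually_elim (rule gf)
  moreover have "AE y in N. f (g y) = y"
    using AEfA by eventually_elim (auto simp: gf)
  ultimately show ?thesis using f g unfolding prob_iso_def by blast
qed

text \<open>The set \<open>A\<close> omits the null set where \<open>g\<close> fails to undo
  \<open>f\<close> and the points sent into the null set \<open>W\<close> containing the failures of
  \<open>f\<close> to undo \<open>g\<close>. On subsets of \<open>A\<close>, a forward image is then
  a preimage under \<open>g\<close> minus \<open>W\<close>, hence measurable.\<close>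

lemma scaled_embedding_if_prob_iso:
  assumes "prob_iso M N f"
  obtains A where "A \<in> sets M" "AE x in M. x \<in> A" "scaled_embedding 1 M N A f"
proof -
  from assms obtain g where f: "f \<in> measurable M N" and df: "distr M N f = N"
    and g: "g \<in> measurable N M" and gf: "AE x in M. g (f x) = x" and fg: "AE y in N. f (g y) = y"
    unfolding prob_iso_def by blast
  from AE_E[OF gf] obtain Z where Z: "{x \<in> space M. g (f x) \<noteq> x} \<subseteq> Z" "emeasure M Z = 0" "Z \<in> sets M"
    by blast
  from AE_E[OF fg] obtain W where W: "{y \<in> space N. f (g y) \<noteq> y} \<subseteq> W" "emeasure N W = 0" "W \<in> sets N"
    by blast
  define A where "A = (space M - Z) - (f -` W \<inter> space M)"
  have fW: "f -` W \<inter> space M \<in> sets M" using measurable_sets[OF f W(3)] .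
  have A: "A \<in> sets M" unfolding A_def using Z fW by auto
  have "emeasure M (f -` W \<inter> space M) = 0"
    using emeasure_distr[OF f W(3)] W(2) by (simp add: df)
  then have AEA: "AE x in M. x \<in> A"
    using AE_not_in[of Z M] AE_not_in[of "f -` W \<inter> space M" M] Z fW AE_space[of M]
    by (auto simp: null_sets_def A_def elim!: AE_mp)
  have gfA: "g (f x) = x" if "x \<in> A" for x using that Z by (auto simp: A_def)
  have fA: "f x \<in> space N - W" if "x \<in> A" for x
    using that measurable_space[OF f] by (auto simp: A_def)
  have "scaled_embedding 1 M N A f"
    unfolding scaled_embedding_def
  proof (intro conjI ballI impI)
    show "inj_on f A" using gfA by (rule inj_on_inverseI)
    fix C assume C: "C \<in> sets M" "C \<subseteq> A"
    have "f ` C = (g -` C \<inter> space N) - W"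
    proof (intro equalityI subsetI)
      fix y assume "y \<in> f ` C"
      then show "y \<in> (g -` C \<inter> space N) - W" using C gfA fA by auto
    next
      fix y assume "y \<in> (g -` C \<inter> space N) - W"
      then have "y = f (g y)" "g y \<in> C" using W by auto
      then show "y \<in> f ` C" by blast
    qed
    then show fC: "f ` C \<in> sets N" using measurable_sets[OF g C(1)] W(3) by auto
    have "emeasure N (f ` C) = emeasure M (f -` (f ` C) \<inter> space M)"
      using emeasure_distr[OF f fC] by (simp add: df)
    also have "\<dots> = emeasure M C"
    proof (rule emeasure_eq_AE)
      show "AE x in M. x \<in> f -` (f ` C) \<inter> space M \<longleftrightarrow> x \<in> C"
        using AEA
      proof eventually_elim
        case (elim x)
        then have "x \<in> C" if "f x = f c" "c \<in> C" for c
          using that gfA[of x] gfA[of c] C by auto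
        then show ?case using elim sets.sets_into_space[OF A] by auto
      qed
    qed (use C measurable_sets[OF f fC] in auto)
    finally show "emeasure N (f ` C) = 1 * emeasure M C" by simp
  qed
  with A AEA show ?thesis using that by blast
qed

section \<open>Embeddings modified piecewise by group elements\<close>

context mp_system
begin

lemma scaled_embedding_act:
  assumes "scaled_embedding t L M A p" and "g \<in> carrier G"
  shows "scaled_embedding t L M A (\<lambda>x. \<sigma> g (p x))"
  unfolding scaled_embedding_def
proof (intro conjI ballI impI)
  show "inj_on (\<lambda>x. \<sigma> g (p x)) A"
    using scaled_embeddingD(1)[OF assms(1)] assms(2) by (auto simp: inj_on_def act_eq_iff)
  fix C assume C: "C \<in> sets L" "C \<subseteq> A"
  have eq: "(\<lambda>x. \<sigma> g (p x)) ` C = \<sigma> g ` (p ` C)" by auto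
  show "(\<lambda>x. \<sigma> g (p x)) ` C \<in> sets M"
    unfolding eq using scaled_embeddingD(2)[OF assms(1) C] assms(2) by (intro sets_act_image)
  show "emeasure M ((\<lambda>x. \<sigma> g (p x)) ` C) = t * emeasure L C"
    unfolding eq using scaled_embeddingD(2,3)[OF assms(1) C] assms(2) by (simp add: emeasure_act_image)
qed

text \<open>Splitting first by \<open>idx\<close> and then by the value of \<open>\<kappa>\<close>
  leaves pieces on which the map is a translate of \<open>p\<close> by one fixed group
  element.\<close>

lemma scaled_embedding_piecewise_act:
  assumes J: "countable J" and idx: "idx \<in> measurable L (count_space J)"
    and \<kappa>: "\<kappa> \<in> measurable L (count_space (carrier G))"
    and emb: "\<And>j. j \<in> J \<Longrightarrow> scaled_embedding t L M {x\<in>A. idx x = j} p"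
    and inj: "inj_on (\<lambda>x. \<sigma> (\<kappa> x) (p x)) A"
  shows "scaled_embedding t L M A (\<lambda>x. \<sigma> (\<kappa> x) (p x))"
proof (rule scaled_embedding_pieces[OF J idx inj])
  fix j assume j: "j \<in> J"
  show "scaled_embedding t L M {x\<in>A. idx x = j} (\<lambda>x. \<sigma> (\<kappa> x) (p x))"
  proof (rule scaled_embedding_pieces[OF countable_group \<kappa>])
    fix g assume g: "g \<in> carrier G"
    have "scaled_embedding t L M {x \<in> {x\<in>A. idx x = j}. \<kappa> x = g} (\<lambda>x. \<sigma> g (p x))"
      by (rule scaled_embedding_act[OF scaled_embedding_subset[OF emb[OF j]] g]) auto
    then show "scaled_embedding t L M {x \<in> {x\<in>A. idx x = j}. \<kappa> x = g} (\<lambda>x. \<sigma> (\<kappa> x) (p x))"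
      by (subst scaled_embedding_cong[where g = "\<lambda>x. \<sigma> g (p x)"]) auto
  qed (rule inj_on_subset[OF inj], auto)
qed

lemma measurable_piecewise_act:
  assumes "\<kappa> \<in> measurable L (count_space (carrier G))" "p \<in> measurable L M"
  shows "(\<lambda>x. \<sigma> (\<kappa> x) (p x)) \<in> measurable L M"
  by (rule measurable_compose_countable'[OF _ assms(1) countable_group])
    (rule measurable_compose[OF assms(2) measurable_action])

lemma scaled_embedding_piecewise_self:
  assumes "\<kappa> \<in> measurable M (count_space (carrier G))" and "inj_on (\<lambda>x. \<sigma> (\<kappa> x) x) A"
  shows "scaled_embedding 1 M M A (\<lambda>x. \<sigma> (\<kappa> x) x)"
  by (rule scaled_embedding_piecewise_act[where J = "{()}" and idx = "\<lambda>_. ()"])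
    (use assms in \<open>auto simp: scaled_embedding_def\<close>)

end

section \<open>Extending partial isomorphisms to the full group\<close>

context mp_system
begin

text \<open>A greedy matching along an enumeration of the group. The leftovers \<open>A - D\<close>
  and \<open>E\<close> have equal measure, and no group element carries a point of the first into
  the second, since the point would have been matched when that element was processed. By ergodicity
  the leftovers are null.\<close>

lemma exhaustion:
  assumes erg: "ergodic_action G M \<sigma>" and A: "A \<in> sets M" and B: "B \<in> sets M"
    and AB: "emeasure M A = emeasure M B"
  obtains D \<kappa> where "D \<in> sets M" "D \<subseteq> A" "emeasure M (A - D) = 0"
    "\<kappa> \<in> measurable M (count_space (carrier G))"
    "inj_on (\<lambda>x. \<sigma> (\<kappa> x) x) D" "(\<lambda>x. \<sigma> (\<kappa> x) x) ` D \<subseteq> B"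
proof -
  define h where "h = from_nat_into (carrier G)"
  have ne: "carrier G \<noteq> {}" using one_closed by blast
  have h: "h n \<in> carrier G" for n unfolding h_def using ne by (rule from_nat_into)
  have h_surj: "\<exists>n. h n = g" if "g \<in> carrier G" for g
    unfolding h_def using from_nat_into_surj[OF countable_group that] .
  \<comment> \<open>Step \<open>n\<close> moves by \<open>h n\<close> whatever part of the remainder of \<open>A\<close> it carries into the
    remainder of \<open>B\<close>.\<close>
  define R where "R = rec_nat (A, B) (\<lambda>n (A', B'). (A' - \<sigma> (h n) -` B', B' - \<sigma> (h n) ` A'))"
  define A' where "A' n = fst (R n)" for n
  define B' where "B' n = snd (R n)" for n
  have A0: "A' 0 = A" and AS: "A' (Suc n) = A' n - \<sigma> (h n) -` B' n"
    and B0: "B' 0 = B" and BS: "B' (Suc n) = B' n - \<sigma> (h n) ` A' n" for n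
    by (simp_all add: A'_def B'_def R_def split: prod.splits)
  have sets: "A' n \<in> sets M \<and> B' n \<in> sets M" for n
    by (induction n) (auto simp: A0 AS B0 BS A B h sets_act_image sets_act_vimage)
  have decA: "decseq A'" and decB: "decseq B'"
    by (auto simp: decseq_Suc_iff AS BS)
  define D where "D = A - (\<Inter>n. A' n)"
  define E where "E = (\<Inter>n. B' n)"
  \<comment> \<open>\<open>nu x\<close> is the step at which \<open>x\<close> is matched; a point
    matched at step \<open>n\<close> first leaves at \<open>A' (Suc n)\<close>.\<close>
  define nu where "nu x = (LEAST n. x \<notin> A' (Suc n))" for x
  define \<kappa> where "\<kappa> x = h (nu x)" for x
  define f where "f x = \<sigma> (\<kappa> x) x" for x
  have D: "D \<in> sets M" and E: "E \<in> sets M"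
    unfolding D_def E_def using A sets by auto
  have nu: "x \<in> A' (nu x)" "x \<notin> A' (Suc (nu x))" if xD: "x \<in> D" for x
  proof -
    obtain n where n: "x \<notin> A' n" using xD by (auto simp: D_def)
    moreover have "x \<in> A' 0" using xD by (simp add: D_def A0)
    ultimately obtain k where "n = Suc k" by (cases n) auto
    with n have ex: "x \<notin> A' (Suc k)" by simp
    then show "x \<notin> A' (Suc (nu x))" unfolding nu_def by (rule LeastI)
    show "x \<in> A' (nu x)"
    proof (cases "nu x")
      case 0 then show ?thesis using \<open>x \<in> A' 0\<close> by simp
    next
      case (Suc m)
      then have "m < (LEAST n. x \<notin> A' (Suc n))" by (simp flip: nu_def)
      then show ?thesis using Suc not_less_Least[of m "\<lambda>n. x \<notin> A' (Suc n)"] by auto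
    qed
  qed
  have f_nu: "f x \<in> B' (nu x)" "f x \<notin> B' (Suc (nu x))" if "x \<in> D" for x
    using nu[OF that] by (auto simp: f_def \<kappa>_def AS BS)
  have inj: "inj_on f D"
  proof (rule inj_onI)
    fix x y assume xy: "x \<in> D" "y \<in> D" "f x = f y"
    \<comment> \<open>An image used at step \<open>nu x\<close> is removed from every later
      \<open>B'\<close>, so points matched at different steps have different images.\<close>
    have "\<not> nu x < nu y" if "x \<in> D" "y \<in> D" "f x = f y" for x y
      using f_nu(2)[OF that(1)] f_nu(1)[OF that(2)] that(3) decseqD[OF decB, of "Suc (nu x)" "nu y"] by auto
    from this[OF xy] this[OF xy(2,1)] xy have "nu x = nu y" by auto
    then show "x = y" using xy h by (simp add: f_def \<kappa>_def act_eq_iff)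
  qed
  have fD: "f ` D = B - E"
  proof (intro equalityI subsetI)
    fix y assume "y \<in> f ` D"
    then obtain x where x: "x \<in> D" "y = f x" by blast
    then show "y \<in> B - E"
      using f_nu[OF x(1)] decseqD[OF decB, of 0 "nu x"] by (auto simp: E_def B0)
  next
    fix y assume y: "y \<in> B - E"
    then obtain m where m: "y \<notin> B' m" by (auto simp: E_def)
    define n where "n = (LEAST n. y \<notin> B' n)"
    have n: "y \<notin> B' n" unfolding n_def using m by (rule LeastI)
    moreover have "y \<in> B' 0" using y by (simp add: B0)
    ultimately obtain k where k: "n = Suc k" by (cases n) auto
    have yk: "y \<in> B' k" using not_less_Least[of k "\<lambda>n. y \<notin> B' n"] k by (auto simp flip: n_def)
    with n k obtain x where x: "x \<in> A' k" "y = \<sigma> (h k) x" by (auto simp: BS)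
    then have xk: "x \<notin> A' (Suc k)" using yk by (simp add: AS)
    have "x \<in> D" using x xk decseqD[OF decA, of 0 k] by (auto simp: D_def A0)
    moreover have "nu x = k"
      unfolding nu_def
    proof (rule Least_equality)
      show "k \<le> m" if "x \<notin> A' (Suc m)" for m
        using that x(1) decseqD[OF decA, of "Suc m" k] by (metis not_less_eq_eq subsetD)
    qed (rule xk)
    ultimately show "y \<in> f ` D" using x(2) by (auto simp: f_def \<kappa>_def)
  qed
  have "{x \<in> space M. x \<notin> A' (Suc n)} \<in> sets M" for n
    using sets by (intro sets.sets_Collect_neg) auto
  then have "nu \<in> measurable M (count_space UNIV)"
    unfolding nu_def by (intro measurable_Least) (auto simp: pred_def)
  then have \<kappa>: "\<kappa> \<in> measurable M (count_space (carrier G))"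
    unfolding \<kappa>_def by (rule measurable_compose) (auto simp: h)
  have DA: "D \<subseteq> A" by (auto simp: D_def)
  have E_B: "E \<subseteq> B" using B0 by (auto simp: E_def)
  have "scaled_embedding 1 M M D f"
    using \<kappa> inj unfolding f_def by (rule scaled_embedding_piecewise_self)
  from scaled_embeddingD(3)[OF this D] have "emeasure M (B - E) = emeasure M D" by (simp add: fD)
  \<comment> \<open>Real-valued measures are used here because the equality of the leftovers comes
    from a subtraction.\<close>
  then have "prob (B - E) = prob D" "prob A = prob B" using AB by (simp_all add: measure_def)
  then have "prob (A - D) = prob E"
    using finite_measure_Diff[OF A D DA] finite_measure_Diff[OF B E E_B] by linarith
  then have AE_eq: "emeasure M (A - D) = emeasure M E"
    by (simp add: emeasure_eq_measure)
  have "emeasure M (A - D) = 0"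
  proof (rule ccontr)
    assume nz: "emeasure M (A - D) \<noteq> 0"
    have "AE x in M. x \<in> (\<Union>g\<in>carrier G. \<sigma> g ` (A - D))"
      using erg nz A D by (intro ergodic_sweep) auto
    moreover have "(\<Union>g\<in>carrier G. \<sigma> g ` (A - D)) \<inter> E = {}"
    proof -
      have "\<sigma> g x \<notin> E" if gx: "g \<in> carrier G" "x \<in> A" "x \<notin> D" for g x
      proof
        assume "\<sigma> g x \<in> E"
        obtain n where n: "h n = g" using h_surj[OF gx(1)] by blast
        have "x \<in> A' n" "x \<in> A' (Suc n)" using gx by (auto simp: D_def)
        moreover have "\<sigma> g x \<in> B' n" using \<open>\<sigma> g x \<in> E\<close> by (auto simp: E_def)
        ultimately show False by (simp add: AS n)
      qed
      then show ?thesis by auto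
    qed
    ultimately have "AE x in M. x \<notin> E" by (elim AE_mp) (intro AE_I2, blast)
    then have "emeasure M E = 0"
      using E by (simp add: AE_iff_measurable[OF _ refl])
    then show False using nz AE_eq by simp
  qed
  moreover have "f ` D \<subseteq> B" using fD by auto
  ultimately show ?thesis
    using that[of D \<kappa>] D DA \<kappa> inj unfolding f_def by blast
qed

text \<open>As the measure is finite, the complements of \<open>A\<close> and of its image have
  equal measure, so the exhaustion embeds almost all of the first into the second by group elements.
  The glued map remains injective off a null set and moves every point within its orbit.\<close>

lemma full_group_extension:
  assumes erg: "ergodic_action G M \<sigma>" and A: "A \<in> sets M"
    and \<kappa>0: "\<kappa>0 \<in> measurable M (count_space (carrier G))" and inj: "inj_on (\<lambda>x. \<sigma> (\<kappa>0 x) x) A"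
  obtains \<alpha> where "\<alpha> \<in> full_group G M \<sigma>" "\<And>x. x \<in> A \<Longrightarrow> \<alpha> x = \<sigma> (\<kappa>0 x) x"
proof -
  define f0 where "f0 x = \<sigma> (\<kappa>0 x) x" for x
  have emb0: "scaled_embedding 1 M M A f0"
    unfolding f0_def using \<kappa>0 inj by (rule scaled_embedding_piecewise_self)
  have f0A: "f0 ` A \<in> sets M" "emeasure M (f0 ` A) = emeasure M A"
    using scaled_embeddingD(2,3)[OF emb0 A] by auto
  have "emeasure M (- A) = emeasure M (- (f0 ` A))"
    using emeasure_compl[OF A] emeasure_compl[OF f0A(1)] f0A(2) emeasure_finite
    by (simp add: Compl_eq_Diff_UNIV)
  moreover have "- A \<in> sets M" "- (f0 ` A) \<in> sets M"
    using sets.compl_sets[OF A] sets.compl_sets[OF f0A(1)] by (simp_all add: Compl_eq_Diff_UNIV)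
  moreover note exhaustion[OF erg, of "- A" "- (f0 ` A)"]
  ultimately obtain D \<kappa>1 where D: "D \<in> sets M" "D \<subseteq> - A" "emeasure M (- A - D) = 0"
    and \<kappa>1: "\<kappa>1 \<in> measurable M (count_space (carrier G))"
    and inj1: "inj_on (\<lambda>x. \<sigma> (\<kappa>1 x) x) D" "(\<lambda>x. \<sigma> (\<kappa>1 x) x) ` D \<subseteq> - (f0 ` A)"
    by blast
  define \<kappa> where "\<kappa> x = (if x \<in> A then \<kappa>0 x else \<kappa>1 x)" for x
  define \<alpha> where "\<alpha> x = \<sigma> (\<kappa> x) x" for x
  have \<kappa>: "\<kappa> \<in> measurable M (count_space (carrier G))"
    unfolding \<kappa>_def using A by (intro measurable_If_set \<kappa>0 \<kappa>1) auto
  have \<alpha>A: "\<alpha> x = f0 x" if "x \<in> A" for x using that by (simp add: \<alpha>_def \<kappa>_def f0_def)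
  have \<alpha>D: "\<alpha> x = \<sigma> (\<kappa>1 x) x" if "x \<in> D" for x using that D(2) by (auto simp: \<alpha>_def \<kappa>_def)
  have "inj_on \<alpha> (A \<union> D)"
  proof (subst inj_on_Un, intro conjI)
    show "inj_on \<alpha> A" using scaled_embeddingD(1)[OF emb0] by (subst inj_on_cong[OF \<alpha>A])
    show "inj_on \<alpha> D" using inj1(1) by (subst inj_on_cong[OF \<alpha>D])
    show "\<alpha> ` (A - D) \<inter> \<alpha> ` (D - A) = {}"
      using inj1(2) \<alpha>A \<alpha>D by (auto simp: image_iff subset_iff)
  qed
  then have emb: "scaled_embedding 1 M M (A \<union> D) \<alpha>"
    unfolding \<alpha>_def using \<kappa> by (intro scaled_embedding_piecewise_self)
  have "AE x in M. x \<notin> - A - D"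
    using D(1,3) A sets.compl_sets[OF A] by (intro AE_not_in) (auto simp: null_sets_def Compl_eq_Diff_UNIV)
  then have AD: "AE x in M. x \<in> A \<union> D" by eventually_elim auto
  have "\<alpha> \<in> measurable M M"
    unfolding \<alpha>_def using \<kappa> by (rule measurable_piecewise_act) simp
  with emb AD A D(1) have "prob_iso M M \<alpha>"
    by (intro prob_iso_if_scaled_embedding[where A = "A \<union> D"] prob_space_axioms) auto
  moreover have "(x, \<alpha> x) \<in> orbit_rel G M \<sigma>" for x
    using measurable_space[OF \<kappa>, of x] by (auto simp: orbit_rel_def mem_orbit_iff \<alpha>_def)
  ultimately have "\<alpha> \<in> full_group G M \<sigma>" by (simp add: full_group_def)
  then show ?thesis using that \<alpha>A by (simp add: f0_def)
qed

end

section \<open>Untwisting the Zimmer cocycle\<close>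

lemma hom_imp_group_hom: "h \<in> hom G H \<Longrightarrow> group G \<Longrightarrow> group H \<Longrightarrow> group_hom G H h"
  by (simp add: group_hom_def group_hom_axioms_def)

text \<open>Transport of structure: \<open>cocycle_superrigid\<close> speaks of groups of natural
  numbers, so \<open>V\<close> is copied along an injection of its carrier, and the morphism and the
  coboundary are carried back.\<close>

lemma (in mp_system) cocycle_superrigid_countable:
  fixes V :: "('v, 'd) monoid_scheme"
  assumes sr: "cocycle_superrigid G M \<sigma>" and V: "group V" "countable (carrier V)"
    and w: "cocycle G M \<sigma> V w"
  obtains \<delta> where "\<delta> \<in> hom G V" "cohomologous G M \<sigma> V w (\<lambda>t g. \<delta> g)"
proof -
  interpret V: group V by fact
  define e where "e = to_nat_on (carrier V)"
  \<comment> \<open>\<open>d\<close> takes values in \<open>carrier V\<close> on every natural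
    number, so no membership in \<open>carrier W\<close> has to be checked before decoding.\<close>
  define d where "d = from_nat_into (carrier V)"
  have de [simp]: "d (e v) = v" if "v \<in> carrier V" for v
    unfolding d_def e_def using V(2) that by (rule from_nat_into_to_nat_on)
  have dV [simp]: "d n \<in> carrier V" for n
    unfolding d_def by (rule from_nat_into) (use V.one_closed in blast)
  define W :: "nat monoid" where
    "W = \<lparr>carrier = e ` carrier V, monoid.mult = (\<lambda>a b. e (d a \<otimes>\<^bsub>V\<^esub> d b)), one = e \<one>\<^bsub>V\<^esub>\<rparr>"
  have carrier_W: "carrier W = e ` carrier V" and mult_W: "a \<otimes>\<^bsub>W\<^esub> b = e (d a \<otimes>\<^bsub>V\<^esub> d b)"
    and one_W: "\<one>\<^bsub>W\<^esub> = e \<one>\<^bsub>V\<^esub>" for a b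
    by (simp_all add: W_def)
  interpret W: group W
  proof (rule groupI)
    fix x assume "x \<in> carrier W"
    then obtain v where v: "v \<in> carrier V" "x = e v" by (auto simp: carrier_W)
    then show "\<exists>y\<in>carrier W. y \<otimes>\<^bsub>W\<^esub> x = \<one>\<^bsub>W\<^esub>"
      by (intro bexI[of _ "e (inv\<^bsub>V\<^esub> v)"]) (auto simp: carrier_W mult_W one_W)
  qed (auto simp: carrier_W mult_W one_W V.m_assoc)
  have inv_W: "inv\<^bsub>W\<^esub> (e v) = e (inv\<^bsub>V\<^esub> v)" if "v \<in> carrier V" for v
    using that by (intro W.inv_equality) (auto simp: carrier_W mult_W one_W)
  have e_meas: "e \<in> measurable (count_space (carrier V)) (count_space (carrier W))"
    by (auto simp: carrier_W)
  have d_meas: "d \<in> measurable (count_space (carrier W)) (count_space (carrier V))"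
    by (auto simp: carrier_W)
  have wV: "w t g \<in> carrier V" if "g \<in> carrier G" for t g
    using w that measurable_space[of "\<lambda>t. w t g" M "count_space (carrier V)" t]
    by (auto simp: cocycle_def)
  have "cocycle G M \<sigma> W (\<lambda>t g. e (w t g))"
    unfolding cocycle_def
  proof (intro conjI ballI)
    fix g assume "g \<in> carrier G"
    then show "(\<lambda>t. e (w t g)) \<in> measurable M (count_space (carrier W))"
      using w measurable_compose[OF _ e_meas] by (auto simp: cocycle_def)
  next
    fix g1 g2 assume g: "g1 \<in> carrier G" "g2 \<in> carrier G"
    then have "AE t in M. w t g1 \<otimes>\<^bsub>V\<^esub> w (\<sigma> (inv\<^bsub>G\<^esub> g1) t) g2 = w t (g1 \<otimes>\<^bsub>G\<^esub> g2)"
      using w by (auto simp: cocycle_def)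
    then show "AE t in M. e (w t g1) \<otimes>\<^bsub>W\<^esub> e (w (\<sigma> (inv\<^bsub>G\<^esub> g1) t) g2) = e (w t (g1 \<otimes>\<^bsub>G\<^esub> g2))"
      by eventually_elim (simp add: mult_W wV g)
  qed
  then obtain \<delta> u where \<delta>: "\<delta> \<in> hom G W" and u: "u \<in> measurable M (count_space (carrier W))"
    and \<delta>u: "\<And>g. g \<in> carrier G \<Longrightarrow> AE t in M.
        \<delta> g = inv\<^bsub>W\<^esub> (u t) \<otimes>\<^bsub>W\<^esub> e (w t g) \<otimes>\<^bsub>W\<^esub> u (\<sigma> (inv\<^bsub>G\<^esub> g) t)"
    using sr W.group_axioms unfolding cocycle_superrigid_def cohomologous_def by blast
  have "(\<lambda>g. d (\<delta> g)) \<in> hom G V"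
  proof (rule homI)
    fix x y assume "x \<in> carrier G" "y \<in> carrier G"
    then show "d (\<delta> (x \<otimes>\<^bsub>G\<^esub> y)) = d (\<delta> x) \<otimes>\<^bsub>V\<^esub> d (\<delta> y)"
      by (simp add: hom_mult[OF \<delta>] mult_W)
  qed simp
  moreover have "cohomologous G M \<sigma> V w (\<lambda>t g. d (\<delta> g))"
    unfolding cohomologous_def
  proof (intro bexI ballI)
    show "(\<lambda>t. d (u t)) \<in> measurable M (count_space (carrier V))"
      using u d_meas by (rule measurable_compose)
    fix g assume g: "g \<in> carrier G"
    have uW: "\<exists>v\<in>carrier V. u t = e v" for t
      using measurable_space[OF u, of t] by (auto simp: carrier_W)
    show "AE t in M. d (\<delta> g) = inv\<^bsub>V\<^esub> d (u t) \<otimes>\<^bsub>V\<^esub> w t g \<otimes>\<^bsub>V\<^esub> d (u (\<sigma> (inv\<^bsub>G\<^esub> g) t))"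
      using \<delta>u[OF g]
    proof eventually_elim
      case (elim t)
      obtain v v' where v: "v \<in> carrier V" "u t = e v" "v' \<in> carrier V" "u (\<sigma> (inv\<^bsub>G\<^esub> g) t) = e v'"
        using uW by metis
      then show ?case using elim g by (simp add: inv_W mult_W wV)
    qed
  qed
  ultimately show ?thesis using that by blast
qed

section \<open>Orbit maps and their Zimmer cocycles\<close>

text \<open>\<open>p\<close> stands for the orbit equivalence followed by the projection to the
  original space. An amplification has several levels, so \<open>p\<close> is only assumed to be
  injective where the level \<open>idx\<close> is constant. There it scales the measure by
  \<open>t\<close>, and on \<open>X1\<close> it preserves orbits in both directions.\<close>

locale orbit_map = X: mp_system \<Gamma> M \<sigma> + Y: mp_system \<Lambda> N \<theta>
  for \<Gamma> :: "('g, 'c) monoid_scheme" and M :: "'x::polish_space measure" and \<sigma> :: "'g \<Rightarrow> 'x \<Rightarrow> 'x"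
    and \<Lambda> :: "('h, 'd) monoid_scheme" and N :: "'y::polish_space measure" and \<theta> :: "'h \<Rightarrow> 'y \<Rightarrow> 'y" +
  fixes p :: "'x \<Rightarrow> 'y" and t :: ennreal and J :: "'j set" and idx :: "'x \<Rightarrow> 'j" and X1 :: "'x set"
  assumes free_X: "free_action \<Gamma> M \<sigma>" and free_Y: "free_action \<Lambda> N \<theta>"
    and measurable_p [measurable]: "p \<in> measurable M N" and t_nonzero: "t \<noteq> 0"
    and countable_J: "countable J" and measurable_idx: "idx \<in> measurable M (count_space J)"
    and sets_X1: "X1 \<in> sets M" and AE_X1: "AE x in M. x \<in> X1"
    and pieces: "\<And>j. j \<in> J \<Longrightarrow> scaled_embedding t M N {x\<in>X1. idx x = j} p"
    and orbits: "\<And>x x'. x \<in> X1 \<Longrightarrow> x' \<in> X1 \<Longrightarrow>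
      (\<exists>g\<in>carrier \<Gamma>. x' = \<sigma> g x) \<longleftrightarrow> (\<exists>h\<in>carrier \<Lambda>. p x' = \<theta> h (p x))"
begin

text \<open>Nonsingularity of \<open>p\<close>: within a piece, the preimage of a null set has a
  null image, and that image has \<open>t\<close> times its measure with
  \<open>t \<noteq> 0\<close>.\<close>

lemma AE_p:
  assumes "AE y in N. P y"
  shows "AE x in M. P (p x)"
proof -
  from AE_E[OF assms] obtain B where B: "{y \<in> space N. \<not> P y} \<subseteq> B" "emeasure N B = 0" "B \<in> sets N"
    by blast
  have "AE x in M. \<forall>j\<in>J. \<not> (x \<in> X1 \<and> idx x = j \<and> p x \<in> B)"
  proof (subst AE_ball_countable[OF countable_J], intro ballI)
    fix j assume j: "j \<in> J"
    define C where "C = X1 \<inter> (idx -` {j} \<inter> space M) \<inter> (p -` B \<inter> space M)"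
    have C: "C \<in> sets M"
      unfolding C_def using j sets_X1 B(3)
      by (intro sets.Int measurable_sets[OF measurable_idx] measurable_sets[OF measurable_p]) auto
    have pC: "p ` C \<in> sets N" "emeasure N (p ` C) = t * emeasure M C"
      using scaled_embeddingD(2,3)[OF pieces[OF j] C] by (auto simp: C_def)
    have "emeasure N (p ` C) \<le> emeasure N B"
      using B(3) by (intro emeasure_mono) (auto simp: C_def)
    then have "emeasure M C = 0" using pC(2) B(2) t_nonzero by simp
    then have "AE x in M. x \<notin> C" using C by (intro AE_not_in) auto
    then show "AE x in M. \<not> (x \<in> X1 \<and> idx x = j \<and> p x \<in> B)"
      by eventually_elim (auto simp: C_def)
  qed
  with AE_X1 show ?thesis
  proof eventually_elim
    case (elim x)
    have "idx x \<in> J" using measurable_space[OF measurable_idx, of x] by simp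
    with elim have "p x \<notin> B" by blast
    then show ?case using B(1) by auto
  qed
qed

text \<open>Imposing the conditions along the whole orbit makes the set invariant, so later
  arguments can move within an orbit without new null sets.\<close>

definition X0 :: "'x set" where
  "X0 = {x. \<forall>g\<in>carrier \<Gamma>. \<sigma> g x \<in> X1 \<and> \<sigma> g x \<in> X.free_part \<and> p (\<sigma> g x) \<in> Y.free_part}"

lemma AE_X0: "AE x in M. x \<in> X0"
proof -
  have "AE x in M. x \<in> X1 \<and> x \<in> X.free_part \<and> p x \<in> Y.free_part"
    using AE_X1 X.AE_free_part[OF free_X] AE_p[OF Y.AE_free_part[OF free_Y]] by eventually_elim simp
  then show ?thesis
    unfolding X0_def mem_Collect_eq
    by (subst AE_ball_countable[OF X.countable_group]) (intro ballI X.AE_act)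
qed

lemma X0_act: "x \<in> X0 \<Longrightarrow> g \<in> carrier \<Gamma> \<Longrightarrow> \<sigma> g x \<in> X0"
  by (simp add: X0_def flip: X.act_mult)

lemma X0D:
  assumes "x \<in> X0" shows "x \<in> X1" "x \<in> X.free_part" "p x \<in> Y.free_part"
  using assms X.one_closed by (force simp: X0_def dest: bspec[of _ _ "\<one>\<^bsub>\<Gamma>\<^esub>"])+

lemma orbit_forth:
  assumes "x \<in> X0" "g \<in> carrier \<Gamma>"
  obtains h where "h \<in> carrier \<Lambda>" "p (\<sigma> g x) = \<theta> h (p x)"
  using orbits[of x "\<sigma> g x"] assms X0D(1) X0_act by blast

lemma orbit_back:
  assumes "x \<in> X0" "x' \<in> X0" "h \<in> carrier \<Lambda>" "p x' = \<theta> h (p x)"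
  obtains g where "g \<in> carrier \<Gamma>" "x' = \<sigma> g x"
  using orbits[of x x'] assms X0D(1) by blast

lemma idx_in_J: "idx x \<in> J"
  using measurable_space[OF measurable_idx, of x] by simp

lemma inj_pieces: "x \<in> X0 \<Longrightarrow> x' \<in> X0 \<Longrightarrow> idx x = idx x' \<Longrightarrow> p x = p x' \<Longrightarrow> x = x'"
  using scaled_embeddingD(1)[OF pieces[OF idx_in_J[of x]]] X0D(1) by (auto simp: inj_on_def)

text \<open>The cocycle value is the first element, in an enumeration of \<open>\<Lambda>\<close>,
  that carries \<open>p (g\<inverse> x)\<close> to \<open>p x\<close>; the least index is what makes
  the choice measurable. On \<open>X0\<close> such an element exists because \<open>p\<close>
  preserves orbits.\<close>

lemma measurable_zimmer:
  obtains W where "\<And>g. g \<in> carrier \<Gamma> \<Longrightarrow> (\<lambda>x. W x g) \<in> measurable M (count_space (carrier \<Lambda>))"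
    and "\<And>x g. x \<in> X0 \<Longrightarrow> g \<in> carrier \<Gamma> \<Longrightarrow> p x = \<theta> (W x g) (p (\<sigma> (inv\<^bsub>\<Gamma>\<^esub> g) x))"
proof -
  define c where "c = from_nat_into (carrier \<Lambda>)"
  have c: "c n \<in> carrier \<Lambda>" for n
    unfolding c_def by (rule from_nat_into) (use Y.one_closed in blast)
  have c_surj: "\<exists>n. c n = h" if "h \<in> carrier \<Lambda>" for h
    unfolding c_def using from_nat_into_surj[OF Y.countable_group that] .
  define k where "k x g = (LEAST n. p x = \<theta> (c n) (p (\<sigma> (inv\<^bsub>\<Gamma>\<^esub> g) x)))" for x g
  show ?thesis
  proof (rule that[of "\<lambda>x g. c (k x g)"])
    fix g assume g: "g \<in> carrier \<Gamma>"
    have "Measurable.pred M (\<lambda>x. p x = \<theta> (c n) (p (\<sigma> (inv\<^bsub>\<Gamma>\<^esub> g) x)))" for n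
      unfolding pred_def
    proof (rule measurable_equality_set)
      show "p \<in> borel_measurable M" using measurable_p by (simp add: measurable_cong_sets[OF refl Y.sets_eq])
      have "(\<lambda>x. \<theta> (c n) (p (\<sigma> (inv\<^bsub>\<Gamma>\<^esub> g) x))) \<in> measurable M N"
        using g by (intro measurable_compose[OF X.measurable_action]
            measurable_compose[OF measurable_p] Y.measurable_action c) auto
      then show "(\<lambda>x. \<theta> (c n) (p (\<sigma> (inv\<^bsub>\<Gamma>\<^esub> g) x))) \<in> borel_measurable M"
        by (simp only: measurable_cong_sets[OF refl Y.sets_eq])
    qed
    then have "(\<lambda>x. k x g) \<in> measurable M (count_space UNIV)"
      unfolding k_def by (rule measurable_Least)
    then show "(\<lambda>x. c (k x g)) \<in> measurable M (count_space (carrier \<Lambda>))"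
      by (rule measurable_compose) (auto simp: c)
  next
    fix x g assume x: "x \<in> X0" and g: "g \<in> carrier \<Gamma>"
    have "\<sigma> (inv\<^bsub>\<Gamma>\<^esub> g) x \<in> X0" using x g by (simp add: X0_act)
    then obtain h where h: "h \<in> carrier \<Lambda>" "p (\<sigma> g (\<sigma> (inv\<^bsub>\<Gamma>\<^esub> g) x)) = \<theta> h (p (\<sigma> (inv\<^bsub>\<Gamma>\<^esub> g) x))"
      using orbit_forth g by blast
    then obtain n where "c n = h" using c_surj by blast
    with h g have "p x = \<theta> (c n) (p (\<sigma> (inv\<^bsub>\<Gamma>\<^esub> g) x))" by simp
    then show "p x = \<theta> (c (k x g)) (p (\<sigma> (inv\<^bsub>\<Gamma>\<^esub> g) x))"
      unfolding k_def by (rule LeastI)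
  qed
qed

end

text \<open>The map \<open>q\<close> lets one development serve both statements: it is the identity
  if the action itself is superrigid, and the given quotient map otherwise.\<close>

locale lifted_orbit_map = orbit_map \<Gamma> M \<sigma> \<Lambda> N \<theta> p t J idx X1 + Z: mp_system \<Gamma> M' \<sigma>'
  for \<Gamma> :: "('g, 'c) monoid_scheme" and M :: "'x::polish_space measure" and \<sigma> :: "'g \<Rightarrow> 'x \<Rightarrow> 'x"
    and \<Lambda> :: "('h, 'd) monoid_scheme" and N :: "'y::polish_space measure" and \<theta> :: "'h \<Rightarrow> 'y \<Rightarrow> 'y"
    and p t and J :: "'j set" and idx X1
    and M' :: "'z::polish_space measure" and \<sigma>' +
  fixes q :: "'z \<Rightarrow> 'x"
  assumes quotient: "action_quotient_map \<Gamma> M' \<sigma>' M \<sigma> q"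
begin

lemma measurable_q: "q \<in> measurable M' M" and distr_q: "distr M' M q = M"
  and q_act: "g \<in> carrier \<Gamma> \<Longrightarrow> AE z in M'. q (\<sigma>' g z) = \<sigma> g (q z)"
  using quotient by (auto simp: action_quotient_map_def conjugates_def)

lemma AE_q: "AE x in M. P x \<Longrightarrow> AE z in M'. P (q z)"
  using AE_distrD[OF measurable_q, of P] by (simp only: distr_q)

text \<open>The Zimmer cocycle is pulled back along \<open>q\<close> to the superrigid action. The
  coboundary relation, read on points, says that \<open>p \<circ> q\<close> corrected by the inverse
  of \<open>u\<close> intertwines \<open>\<sigma>'\<close> with
  \<open>\<theta> \<circ> \<delta>\<close>.\<close>

lemma untwist:
  assumes "cocycle_superrigid \<Gamma> M' \<sigma>'"
  obtains \<delta> u where "\<delta> \<in> hom \<Gamma> \<Lambda>" "u \<in> measurable M' (count_space (carrier \<Lambda>))"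
    and "\<And>g. g \<in> carrier \<Gamma> \<Longrightarrow> AE z in M'.
      \<theta> (inv\<^bsub>\<Lambda>\<^esub> (u (\<sigma>' g z))) (p (q (\<sigma>' g z))) = \<theta> (\<delta> g) (\<theta> (inv\<^bsub>\<Lambda>\<^esub> (u z)) (p (q z)))"
proof -
  obtain W where W_meas: "\<And>g. g \<in> carrier \<Gamma> \<Longrightarrow> (\<lambda>x. W x g) \<in> measurable M (count_space (carrier \<Lambda>))"
    and W: "\<And>x g. x \<in> X0 \<Longrightarrow> g \<in> carrier \<Gamma> \<Longrightarrow> p x = \<theta> (W x g) (p (\<sigma> (inv\<^bsub>\<Gamma>\<^esub> g) x))"
    using measurable_zimmer by blast
  have W_closed: "W x g \<in> carrier \<Lambda>" if "g \<in> carrier \<Gamma>" for x g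
    using measurable_space[OF W_meas[OF that], of x] by simp
  have "cocycle \<Gamma> M' \<sigma>' \<Lambda> (\<lambda>z g. W (q z) g)"
    unfolding cocycle_def
  proof (intro conjI ballI)
    fix g assume "g \<in> carrier \<Gamma>"
    from measurable_compose[OF measurable_q W_meas[OF this]]
    show "(\<lambda>z. W (q z) g) \<in> measurable M' (count_space (carrier \<Lambda>))" .
  next
    fix g1 g2 assume g: "g1 \<in> carrier \<Gamma>" "g2 \<in> carrier \<Gamma>"
    then have "AE z in M'. q (\<sigma>' (inv\<^bsub>\<Gamma>\<^esub> g1) z) = \<sigma> (inv\<^bsub>\<Gamma>\<^esub> g1) (q z)" by (intro q_act) simp
    then show "AE z in M'. W (q z) g1 \<otimes>\<^bsub>\<Lambda>\<^esub> W (q (\<sigma>' (inv\<^bsub>\<Gamma>\<^esub> g1) z)) g2 = W (q z) (g1 \<otimes>\<^bsub>\<Gamma>\<^esub> g2)"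
      using AE_q[OF AE_X0]
    proof eventually_elim
      case (elim z)
      define x where "x = q z"
      \<comment> \<open>Both sides of the cocycle identity carry this point to \<open>p x\<close>,
        so freeness at \<open>y\<close> yields the identity.\<close>
      define y where "y = p (\<sigma> (inv\<^bsub>\<Gamma>\<^esub> (g1 \<otimes>\<^bsub>\<Gamma>\<^esub> g2)) x)"
      have x: "x \<in> X0" and x1: "\<sigma> (inv\<^bsub>\<Gamma>\<^esub> g1) x \<in> X0" using elim g by (auto simp: x_def X0_act)
      have y: "y \<in> Y.free_part" unfolding y_def using x g by (intro X0D(3) X0_act) auto
      have eq: "\<sigma> (inv\<^bsub>\<Gamma>\<^esub> g2) (\<sigma> (inv\<^bsub>\<Gamma>\<^esub> g1) x) = \<sigma> (inv\<^bsub>\<Gamma>\<^esub> (g1 \<otimes>\<^bsub>\<Gamma>\<^esub> g2)) x"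
        using g by (simp add: X.inv_mult_group X.act_mult)
      have "\<theta> (W x g1 \<otimes>\<^bsub>\<Lambda>\<^esub> W (\<sigma> (inv\<^bsub>\<Gamma>\<^esub> g1) x) g2) y = \<theta> (W x g1) (p (\<sigma> (inv\<^bsub>\<Gamma>\<^esub> g1) x))"
        using W[OF x1 g(2)] g W_closed by (simp add: Y.act_mult y_def eq)
      also have "\<dots> = p x" using W[OF x g(1)] by simp
      also have "\<dots> = \<theta> (W x (g1 \<otimes>\<^bsub>\<Gamma>\<^esub> g2)) y" unfolding y_def using x g by (intro W) auto
      finally have "W x g1 \<otimes>\<^bsub>\<Lambda>\<^esub> W (\<sigma> (inv\<^bsub>\<Gamma>\<^esub> g1) x) g2 = W x (g1 \<otimes>\<^bsub>\<Gamma>\<^esub> g2)"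
        using g W_closed by (intro Y.free_part_inj[OF y]) auto
      then show ?case using elim by (simp add: x_def)
    qed
  qed
  from Z.cocycle_superrigid_countable[OF assms Y.group_axioms Y.countable_group this]
  obtain \<delta> where \<delta>: "\<delta> \<in> hom \<Gamma> \<Lambda>" and coh: "cohomologous \<Gamma> M' \<sigma>' \<Lambda> (\<lambda>z. W (q z)) (\<lambda>t. \<delta>)"
    by blast
  from coh obtain u where u: "u \<in> measurable M' (count_space (carrier \<Lambda>))"
    and \<delta>u: "\<And>g. g \<in> carrier \<Gamma> \<Longrightarrow>
      AE z in M'. \<delta> g = inv\<^bsub>\<Lambda>\<^esub> (u z) \<otimes>\<^bsub>\<Lambda>\<^esub> W (q z) g \<otimes>\<^bsub>\<Lambda>\<^esub> u (\<sigma>' (inv\<^bsub>\<Gamma>\<^esub> g) z)"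
    unfolding cohomologous_def by blast
  have u_closed: "u z \<in> carrier \<Lambda>" for z using measurable_space[OF u, of z] by simp
  show ?thesis
  proof (rule that[OF \<delta> u])
    fix g assume g: "g \<in> carrier \<Gamma>"
    \<comment> \<open>The coboundary relation is used at \<open>\<sigma>' g z\<close>, where its
      last factor becomes \<open>u z\<close>.\<close>
    show "AE z in M'. \<theta> (inv\<^bsub>\<Lambda>\<^esub> (u (\<sigma>' g z))) (p (q (\<sigma>' g z))) = \<theta> (\<delta> g) (\<theta> (inv\<^bsub>\<Lambda>\<^esub> (u z)) (p (q z)))"
      using Z.AE_act[OF g \<delta>u[OF g]] q_act[OF g] AE_q[OF AE_X0]
    proof eventually_elim
      case (elim z)
      define w where "w = W (q (\<sigma>' g z)) g"
      have w: "w \<in> carrier \<Lambda>" unfolding w_def using g by (rule W_closed)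
      have \<delta>g: "\<delta> g = inv\<^bsub>\<Lambda>\<^esub> (u (\<sigma>' g z)) \<otimes>\<^bsub>\<Lambda>\<^esub> w \<otimes>\<^bsub>\<Lambda>\<^esub> u z"
        using elim(1) g by (simp add: w_def)
      have "p (q (\<sigma>' g z)) = \<theta> w (p (q z))"
        using W[OF X0_act[OF elim(3) g] g] g by (simp add: w_def elim(2))
      moreover have "\<delta> g \<otimes>\<^bsub>\<Lambda>\<^esub> inv\<^bsub>\<Lambda>\<^esub> (u z) = inv\<^bsub>\<Lambda>\<^esub> (u (\<sigma>' g z)) \<otimes>\<^bsub>\<Lambda>\<^esub> w"
        using w u_closed by (simp add: \<delta>g Y.m_assoc)
      moreover have "\<delta> g \<in> carrier \<Lambda>" using \<delta> g by (auto simp: hom_def)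
      ultimately show ?case using w u_closed by (simp flip: Y.act_mult)
    qed
  qed
qed

end

section \<open>The index of the image subgroup and the conjugacy onto its domain\<close>

text \<open>The sets that the various cosets carry into \<open>A\<close> are disjoint by
  \<open>sep\<close>, have the same measure as \<open>A\<close>, and cover almost everything by
  ergodicity, so their measures add up to 1.\<close>

lemma (in mp_system) subgroup_transversal:
  assumes erg: "ergodic_action G M \<sigma>" and H: "subgroup H G" and A: "A \<in> sets M"
    and pos: "emeasure M A \<noteq> 0"
    and inv: "\<And>h. h \<in> H \<Longrightarrow> \<sigma> h ` A = A"
    and sep: "\<And>g x. g \<in> carrier G \<Longrightarrow> x \<in> A \<Longrightarrow> \<sigma> g x \<in> A \<Longrightarrow> g \<in> H"
  shows "emeasure M A * of_nat (card (rcosets\<^bsub>G\<^esub> H)) = 1"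
proof -
  interpret H: subgroup H G by fact
  let ?R = "rcosets\<^bsub>G\<^esub> H"
  \<comment> \<open>For the right coset of \<open>a\<close> this is the preimage of \<open>A\<close>
    under \<open>\<sigma> a\<close>, independently of the representative, because \<open>H\<close>
    acts last and preserves \<open>A\<close>.\<close>
  define D where "D C = {x. \<exists>k\<in>C. \<sigma> k x \<in> A}" for C
  have R: "?R = (\<lambda>a. H #>\<^bsub>G\<^esub> a) ` carrier G" by (auto simp: RCOSETS_def)
  have D_coset: "D (H #>\<^bsub>G\<^esub> a) = \<sigma> a -` A" if a: "a \<in> carrier G" for a
  proof (intro equalityI subsetI)
    fix x assume "x \<in> D (H #>\<^bsub>G\<^esub> a)"
    then obtain h where h: "h \<in> H" "\<sigma> (h \<otimes>\<^bsub>G\<^esub> a) x \<in> A" by (auto simp: D_def r_coset_def)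
    then have "\<sigma> h (\<sigma> a x) \<in> \<sigma> h ` A" using a by (simp add: inv act_mult H.mem_carrier)
    then show "x \<in> \<sigma> a -` A" using h(1) by (auto simp: act_eq_iff H.mem_carrier)
  next
    fix x assume "x \<in> \<sigma> a -` A"
    moreover have "a \<in> H #>\<^bsub>G\<^esub> a" using a H by (rule rcos_self)
    ultimately show "x \<in> D (H #>\<^bsub>G\<^esub> a)" by (auto simp: D_def)
  qed
  have countable_R: "countable ?R" unfolding R using countable_group by simp
  have D: "D C \<in> sets M" "emeasure M (D C) = emeasure M A" if "C \<in> ?R" for C
    using that A by (auto simp: R D_coset sets_act_vimage emeasure_act_vimage)
  have disj: "disjoint_family_on D ?R"
    unfolding disjoint_family_on_def
  proof (intro ballI impI)
    fix C C' assume C: "C \<in> ?R" "C' \<in> ?R" "C \<noteq> C'"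
    then obtain a b where ab: "a \<in> carrier G" "C = H #>\<^bsub>G\<^esub> a" "b \<in> carrier G" "C' = H #>\<^bsub>G\<^esub> b"
      by (auto simp: R)
    have False if "\<sigma> a x \<in> A" "\<sigma> b x \<in> A" for x
    proof -
      have "\<sigma> (b \<otimes>\<^bsub>G\<^esub> inv\<^bsub>G\<^esub> a) (\<sigma> a x) = \<sigma> b x" using ab by (simp add: act_mult)
      then have "b \<otimes>\<^bsub>G\<^esub> inv\<^bsub>G\<^esub> a \<in> H" using that ab by (intro sep[of _ "\<sigma> a x"]) auto
      then have "b \<in> H #>\<^bsub>G\<^esub> a"
        using ab by (auto simp: r_coset_def m_assoc intro!: bexI[of _ "b \<otimes>\<^bsub>G\<^esub> inv\<^bsub>G\<^esub> a"])
      then have "C = C'" using ab repr_independence[OF _ ab(1) H] by simp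
      then show False using C(3) by simp
    qed
    then show "D C \<inter> D C' = {}" using ab by (auto simp: D_coset)
  qed
  have "AE x in M. x \<in> (\<Union>C\<in>?R. D C)"
    using ergodic_sweep[OF erg A pos]
  proof (rule AE_mp, intro AE_I2 impI)
    fix x assume "x \<in> (\<Union>g\<in>carrier G. \<sigma> g ` A)"
    then obtain g a where g: "g \<in> carrier G" "a \<in> A" "x = \<sigma> g a" by blast
    then have "x \<in> D (H #>\<^bsub>G\<^esub> inv\<^bsub>G\<^esub> g)" by (simp add: D_coset)
    then show "x \<in> (\<Union>C\<in>?R. D C)" using g(1) by (auto simp: R)
  qed
  moreover have "(\<Union>C\<in>?R. D C) \<in> sets M"
    using countable_R D by (intro sets.countable_UN'') auto
  ultimately have "1 = emeasure M (\<Union>C\<in>?R. D C)"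
    by (intro emeasure_eq_1_AE[symmetric])
  also have "\<dots> = (\<integral>\<^sup>+C. emeasure M (D C) \<partial>count_space ?R)"
    using countable_R D disj by (intro emeasure_UN_countable) auto
  also have "\<dots> = (\<integral>\<^sup>+C. emeasure M A \<partial>count_space ?R)"
    using D by (intro nn_integral_cong) auto
  also have "\<dots> = emeasure M A * emeasure (count_space ?R) ?R" by simp
  finally have eq: "emeasure M A * emeasure (count_space ?R) ?R = 1" by simp
  \<comment> \<open>Finiteness has to precede the use of \<open>card\<close>, which is 0 on infinite
    sets. Infinitely many cosets would make the product infinite.\<close>
  have fin: "finite ?R"
  proof (rule ccontr)
    assume "infinite ?R"
    then show False using eq pos by (simp add: ennreal_mult_top)
  qed
  show "emeasure M A * of_nat (card ?R) = 1"
    using eq fin by (simp add: emeasure_count_space_finite)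
qed

context orbit_map
begin

text \<open>If \<open>h\<close> relates two values of \<open>\<Phi>\<close>, the underlying points
  lie in one \<open>\<Gamma>\<close>-orbit and freeness forces \<open>h\<close> into the image of
  \<open>\<delta>\<close>. For \<open>h\<close> the unit, injectivity of \<open>\<delta>\<close>
  then shows that \<open>\<Phi>\<close> is injective, even where \<open>p\<close> is not.\<close>

lemma untwisted_embedding:
  assumes \<delta>: "\<delta> \<in> hom \<Gamma> \<Lambda>" "inj_on \<delta> (carrier \<Gamma>)"
    and u: "u \<in> measurable M (count_space (carrier \<Lambda>))"
    and \<Phi>_def: "\<And>x. \<Phi> x = \<theta> (inv\<^bsub>\<Lambda>\<^esub> (u x)) (p x)"
    and equiv: "conjugates \<Gamma> M \<Phi> \<sigma> (\<lambda>g. \<theta> (\<delta> g))"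
  obtains X2 where "X2 \<in> sets M" "AE x in M. x \<in> X2" "X2 \<subseteq> X0"
    "\<And>g x. g \<in> carrier \<Gamma> \<Longrightarrow> x \<in> X2 \<Longrightarrow> \<sigma> g x \<in> X2"
    "\<And>g x. g \<in> carrier \<Gamma> \<Longrightarrow> x \<in> X2 \<Longrightarrow> \<Phi> (\<sigma> g x) = \<theta> (\<delta> g) (\<Phi> x)"
    "scaled_embedding t M N X2 \<Phi>"
    "\<And>h x x'. h \<in> carrier \<Lambda> \<Longrightarrow> x \<in> X2 \<Longrightarrow> x' \<in> X2 \<Longrightarrow> \<Phi> x' = \<theta> h (\<Phi> x) \<Longrightarrow> h \<in> \<delta> ` carrier \<Gamma>"
proof -
  interpret \<delta>: group_hom \<Gamma> \<Lambda> \<delta>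
    using \<delta>(1) X.group_axioms Y.group_axioms by (rule hom_imp_group_hom)
  have u_closed: "u x \<in> carrier \<Lambda>" for x using measurable_space[OF u, of x] by simp
  have "AE x in M. x \<in> X0 \<and> (\<forall>g\<in>carrier \<Gamma>. \<Phi> (\<sigma> g x) = \<theta> (\<delta> g) (\<Phi> x))"
    using AE_X0 equiv by (simp add: AE_ball_countable[OF X.countable_group] conjugates_def)
  then obtain X2 where X2: "X2 \<in> sets M" "AE x in M. x \<in> X2"
    and good: "\<And>x. x \<in> X2 \<Longrightarrow> x \<in> X0 \<and> (\<forall>g\<in>carrier \<Gamma>. \<Phi> (\<sigma> g x) = \<theta> (\<delta> g) (\<Phi> x))"
    and X2_act: "\<And>g x. g \<in> carrier \<Gamma> \<Longrightarrow> x \<in> X2 \<Longrightarrow> \<sigma> g x \<in> X2"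
    by (rule X.AE_invariant_core) blast
  have \<Phi>_act: "\<Phi> (\<sigma> g x) = \<theta> (\<delta> g) (\<Phi> x)" if "g \<in> carrier \<Gamma>" "x \<in> X2" for g x
    using good that by blast
  have sep: "\<exists>g\<in>carrier \<Gamma>. h = \<delta> g \<and> x' = \<sigma> g x"
    if h: "h \<in> carrier \<Lambda>" and x: "x \<in> X2" "x' \<in> X2" and eq: "\<Phi> x' = \<theta> h (\<Phi> x)" for h x x'
  proof -
    have "p x' = \<theta> (u x') (\<Phi> x')" by (simp add: \<Phi>_def u_closed)
    also have "\<dots> = \<theta> (u x' \<otimes>\<^bsub>\<Lambda>\<^esub> h \<otimes>\<^bsub>\<Lambda>\<^esub> inv\<^bsub>\<Lambda>\<^esub> (u x)) (p x)"
      unfolding eq using h u_closed by (simp add: \<Phi>_def Y.act_mult)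
    finally obtain g where g: "g \<in> carrier \<Gamma>" "x' = \<sigma> g x"
      using orbit_back[of x x' "u x' \<otimes>\<^bsub>\<Lambda>\<^esub> h \<otimes>\<^bsub>\<Lambda>\<^esub> inv\<^bsub>\<Lambda>\<^esub> (u x)"] good x h u_closed by auto
    have "\<Phi> x \<in> Y.free_part"
      using X0D(3)[of x] good[OF x(1)] u_closed by (auto simp: \<Phi>_def intro: Y.free_part_act)
    moreover have "\<theta> h (\<Phi> x) = \<theta> (\<delta> g) (\<Phi> x)" using \<Phi>_act[OF g(1) x(1)] g(2) eq by simp
    ultimately have "h = \<delta> g" using h g(1) by (intro Y.free_part_inj[of "\<Phi> x"]) auto
    with g show ?thesis by blast
  qed
  have inj: "inj_on \<Phi> X2"
  proof (rule inj_onI)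
    fix x x' assume x: "x \<in> X2" "x' \<in> X2" "\<Phi> x = \<Phi> x'"
    then obtain g where g: "g \<in> carrier \<Gamma>" "\<one>\<^bsub>\<Lambda>\<^esub> = \<delta> g" "x' = \<sigma> g x"
      using sep[of "\<one>\<^bsub>\<Lambda>\<^esub>" x x'] by auto
    have "g = \<one>\<^bsub>\<Gamma>\<^esub>"
      using inj_onD[OF \<delta>(2), of g "\<one>\<^bsub>\<Gamma>\<^esub>"] g by simp
    then show "x = x'" using g by simp
  qed
  have emb: "scaled_embedding t M N X2 \<Phi>"
  proof -
    have "(\<lambda>x. inv\<^bsub>\<Lambda>\<^esub> (u x)) \<in> measurable M (count_space (carrier \<Lambda>))"
      using u by (rule measurable_compose) auto
    moreover have "scaled_embedding t M N {x\<in>X2. idx x = j} p" if "j \<in> J" for j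
      using good X0D(1) by (intro scaled_embedding_subset[OF pieces[OF that]]) auto
    ultimately have "scaled_embedding t M N X2 (\<lambda>x. \<theta> (inv\<^bsub>\<Lambda>\<^esub> (u x)) (p x))"
      using countable_J measurable_idx inj
      by (intro Y.scaled_embedding_piecewise_act[where J = J and idx = idx]) (simp_all add: \<Phi>_def[abs_def])
    then show ?thesis by (simp add: \<Phi>_def[abs_def])
  qed
  have "h \<in> \<delta> ` carrier \<Gamma>"
    if "h \<in> carrier \<Lambda>" "x \<in> X2" "x' \<in> X2" "\<Phi> x' = \<theta> h (\<Phi> x)" for h x x'
    using sep[OF that] by blast
  with good show ?thesis
    by (intro that[OF X2 _ X2_act \<Phi>_act emb]) auto
qed

text \<open>\<open>Y0\<close> is the image of a conull invariant set under \<open>\<Phi>\<close>: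
  equivariance makes it invariant under the image of \<open>\<delta>\<close>, and \<open>sep\<close>
  keeps it disjoint from its other translates. The last claim is conditional because it inverts
  \<open>p\<close>.\<close>

lemma untwisted_conjugacy:
  assumes erg: "ergodic_action \<Lambda> N \<theta>"
    and \<delta>: "\<delta> \<in> hom \<Gamma> \<Lambda>" "inj_on \<delta> (carrier \<Gamma>)"
    and u: "u \<in> measurable M (count_space (carrier \<Lambda>))"
    and \<Phi>_def: "\<And>x. \<Phi> x = \<theta> (inv\<^bsub>\<Lambda>\<^esub> (u x)) (p x)"
    and equiv: "conjugates \<Gamma> M \<Phi> \<sigma> (\<lambda>g. \<theta> (\<delta> g))"
  shows "\<exists>Y0\<in>sets N. emeasure N Y0 = t \<and> (\<forall>h\<in>\<delta> ` carrier \<Gamma>. \<theta> h ` Y0 = Y0) \<and>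
    t * of_nat (card (rcosets\<^bsub>\<Lambda>\<^esub> (\<delta> ` carrier \<Gamma>))) = 1 \<and>
    prob_iso M (uniform_measure N Y0) \<Phi> \<and> (AE x in M. \<Phi> x \<in> Y0) \<and>
    (scaled_embedding t M N X1 p \<longrightarrow> (\<exists>\<alpha>\<in>full_group \<Lambda> N \<theta>. AE x in M. \<alpha> (p x) = \<Phi> x))"
proof -
  interpret \<delta>: group_hom \<Gamma> \<Lambda> \<delta>
    using \<delta>(1) X.group_axioms Y.group_axioms by (rule hom_imp_group_hom)
  have u_closed: "u x \<in> carrier \<Lambda>" for x using measurable_space[OF u, of x] by simp
  have inv_u: "(\<lambda>x. inv\<^bsub>\<Lambda>\<^esub> (u x)) \<in> measurable M (count_space (carrier \<Lambda>))"
    using u by (rule measurable_compose) auto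
  obtain X2 where X2: "X2 \<in> sets M" "AE x in M. x \<in> X2" "X2 \<subseteq> X0"
    and X2_act: "\<And>g x. g \<in> carrier \<Gamma> \<Longrightarrow> x \<in> X2 \<Longrightarrow> \<sigma> g x \<in> X2"
    and \<Phi>_act: "\<And>g x. g \<in> carrier \<Gamma> \<Longrightarrow> x \<in> X2 \<Longrightarrow> \<Phi> (\<sigma> g x) = \<theta> (\<delta> g) (\<Phi> x)"
    and emb: "scaled_embedding t M N X2 \<Phi>"
    and sep: "\<And>h x x'. h \<in> carrier \<Lambda> \<Longrightarrow> x \<in> X2 \<Longrightarrow> x' \<in> X2 \<Longrightarrow> \<Phi> x' = \<theta> h (\<Phi> x) \<Longrightarrow> h \<in> \<delta> ` carrier \<Gamma>"
    using untwisted_embedding[OF \<delta> u \<Phi>_def equiv] by blast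
  define Y0 where "Y0 = \<Phi> ` X2"
  have Y0: "Y0 \<in> sets N" "emeasure N Y0 = t"
    unfolding Y0_def using scaled_embeddingD(2,3)[OF emb X2(1)] X.emeasure_eq_1_AE[OF X2(1,2)] by auto
  have t_finite: "t \<noteq> \<infinity>" using Y.emeasure_finite[of Y0] Y0(2) by simp
  have fwd: "\<theta> (\<delta> g) ` Y0 \<subseteq> Y0" if "g \<in> carrier \<Gamma>" for g
  proof
    fix y assume "y \<in> \<theta> (\<delta> g) ` Y0"
    then obtain x where x: "x \<in> X2" "y = \<theta> (\<delta> g) (\<Phi> x)" by (auto simp: Y0_def)
    then have "y = \<Phi> (\<sigma> g x)" using \<Phi>_act[OF that x(1)] by simp
    then show "y \<in> Y0" unfolding Y0_def using X2_act[OF that x(1)] by blast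
  qed
  have inv: "\<theta> h ` Y0 = Y0" if h: "h \<in> \<delta> ` carrier \<Gamma>" for h
  proof
    obtain g where g: "g \<in> carrier \<Gamma>" "h = \<delta> g" using h by blast
    show "\<theta> h ` Y0 \<subseteq> Y0" using fwd g by simp
    show "Y0 \<subseteq> \<theta> h ` Y0"
    proof
      fix y assume "y \<in> Y0"
      then have "\<theta> (inv\<^bsub>\<Lambda>\<^esub> h) y \<in> Y0" using fwd[of "inv\<^bsub>\<Gamma>\<^esub> g"] g by auto
      moreover have "y = \<theta> h (\<theta> (inv\<^bsub>\<Lambda>\<^esub> h) y)" using g by simp
      ultimately show "y \<in> \<theta> h ` Y0" by blast
    qed
  qed
  have sub: "subgroup (\<delta> ` carrier \<Gamma>) \<Lambda>" by (rule \<delta>.img_is_subgroup)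
  have nonnull: "emeasure N Y0 \<noteq> 0" using Y0(2) t_nonzero by simp
  have sep0: "h \<in> \<delta> ` carrier \<Gamma>" if "h \<in> carrier \<Lambda>" "y \<in> Y0" "\<theta> h y \<in> Y0" for h y
    using that(2,3) sep[OF that(1)] unfolding Y0_def by fastforce
    have index: "emeasure N Y0 * of_nat (card (rcosets\<^bsub>\<Lambda>\<^esub> (\<delta> ` carrier \<Gamma>))) = 1"
    by (rule Y.subgroup_transversal[OF erg sub Y0(1) nonnull]; (rule inv | rule sep0); assumption)
  have \<Phi>Y0: "AE x in M. \<Phi> x \<in> Y0" using X2(2) by eventually_elim (simp add: Y0_def)
  have \<Phi>_meas: "\<Phi> \<in> measurable M N"
    using Y.measurable_piecewise_act[OF inv_u measurable_p] by (simp add: \<Phi>_def[abs_def])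
  have iso: "prob_iso M (uniform_measure N Y0) \<Phi>"
  proof (rule prob_iso_if_scaled_embedding[OF X.prob_space_axioms _ _ X2(1,2)])
    show "prob_space (uniform_measure N Y0)"
      using Y0(2) t_nonzero t_finite by (intro prob_space_uniform_measure) auto
    show "\<Phi> \<in> measurable M (uniform_measure N Y0)"
      using \<Phi>_meas by (simp add: measurable_cong_sets[OF refl sets_uniform_measure])
    \<comment> \<open>Normalizing by \<open>t\<close>, the measure of \<open>Y0\<close>, cancels the
      scaling factor of \<open>\<Phi>\<close>.\<close>
    show "scaled_embedding 1 M (uniform_measure N Y0) X2 \<Phi>"
      unfolding scaled_embedding_def
    proof (intro conjI ballI impI)
      show "inj_on \<Phi> X2" using emb by (rule scaled_embeddingD)
      fix C assume C: "C \<in> sets M" "C \<subseteq> X2"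
      note C' = scaled_embeddingD(2,3)[OF emb C]
      show "\<Phi> ` C \<in> sets (uniform_measure N Y0)" using C' by simp
      have "Y0 \<inter> \<Phi> ` C = \<Phi> ` C" using C by (auto simp: Y0_def)
      then have "emeasure (uniform_measure N Y0) (\<Phi> ` C) = (t * emeasure M C) / t"
        using C' Y0 by (simp add: emeasure_uniform_measure)
      also have "\<dots> = emeasure M C"
        using t_nonzero t_finite by (metis ennreal_mult_divide_eq mult.commute infinity_ennreal_def)
      finally show "emeasure (uniform_measure N Y0) (\<Phi> ` C) = 1 * emeasure M C" by simp
    qed
  qed
  have ext: "\<exists>\<alpha>\<in>full_group \<Lambda> N \<theta>. AE x in M. \<alpha> (p x) = \<Phi> x" if "scaled_embedding t M N X1 p"
  proof -
    have embp: "scaled_embedding t M N X2 p"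
      using X2(3) X0D(1) by (intro scaled_embedding_subset[OF that]) auto
    \<comment> \<open>\<open>\<psi>\<close> inverts \<open>p\<close>, so that the correction by
      \<open>u\<close> becomes a function of the point \<open>p x\<close>, as the extension to the
      full group requires. The default only has to lie in \<open>space M\<close>, which is the whole
      type.\<close>
    define \<psi> where "\<psi> y = (if y \<in> p ` X2 then the_inv_into X2 p y else undefined)" for y
    have "\<psi> \<in> measurable N M"
      unfolding \<psi>_def using X2(1) embp by (rule measurable_inverse_scaled_embedding) simp
    then have \<kappa>: "(\<lambda>y. inv\<^bsub>\<Lambda>\<^esub> (u (\<psi> y))) \<in> measurable N (count_space (carrier \<Lambda>))"
      using inv_u by (rule measurable_compose)
    have \<psi>: "\<psi> (p x) = x" if "x \<in> X2" for x
      using that scaled_embeddingD(1)[OF embp] by (simp add: \<psi>_def the_inv_into_f_f)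
    have "inj_on (\<lambda>y. \<theta> (inv\<^bsub>\<Lambda>\<^esub> (u (\<psi> y))) y) (p ` X2)"
      using scaled_embeddingD(1)[OF emb] by (auto simp: inj_on_def \<psi> \<Phi>_def)
    from Y.full_group_extension[OF erg scaled_embeddingD(2)[OF embp X2(1) order_refl] \<kappa> this]
    obtain \<alpha> where \<alpha>: "\<alpha> \<in> full_group \<Lambda> N \<theta>"
      and \<alpha>p: "\<And>y. y \<in> p ` X2 \<Longrightarrow> \<alpha> y = \<theta> (inv\<^bsub>\<Lambda>\<^esub> (u (\<psi> y))) y"
      by blast
    have "AE x in M. \<alpha> (p x) = \<Phi> x"
      using X2(2) by eventually_elim (simp add: \<alpha>p \<psi> \<Phi>_def)
    with \<alpha> show ?thesis by blast
  qed
  show ?thesis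
    using inv by (intro bexI[OF _ Y0(1)] conjI ballI impI Y0(2) index[unfolded Y0(2)] iso \<Phi>Y0 ext)
qed

end

section \<open>The kernel of the untwisting homomorphism\<close>

text \<open>A normal subgroup contains the whole conjugacy class of each of its elements.\<close>

lemma icc_no_finite_normal_subgroups:
  assumes "icc_group G" shows "no_finite_normal_subgroups G"
  unfolding no_finite_normal_subgroups_def
proof (intro allI impI)
  fix H assume H: "H \<lhd> G \<and> finite H"
  interpret normal H G using H by simp
  have "g = \<one>\<^bsub>G\<^esub>" if g: "g \<in> H" for g
  proof (rule ccontr)
    assume "g \<noteq> \<one>\<^bsub>G\<^esub>"
    then have "infinite {h \<otimes>\<^bsub>G\<^esub> g \<otimes>\<^bsub>G\<^esub> inv\<^bsub>G\<^esub> h | h. h \<in> carrier G}"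
      using assms g by (auto simp: icc_group_def)
    moreover have "{h \<otimes>\<^bsub>G\<^esub> g \<otimes>\<^bsub>G\<^esub> inv\<^bsub>G\<^esub> h | h. h \<in> carrier G} \<subseteq> H"
      using g by (auto intro: inv_op_closed2)
    ultimately show False using H finite_subset by blast
  qed
  then show "H = {\<one>\<^bsub>G\<^esub>}" using one_closed by auto
qed

locale untwisted_lift = lifted_orbit_map \<Gamma> M \<sigma> \<Lambda> N \<theta> p t J idx X1 M' \<sigma>' q
  for \<Gamma> :: "('g, 'c) monoid_scheme" and M :: "'x::polish_space measure" and \<sigma> :: "'g \<Rightarrow> 'x \<Rightarrow> 'x"
    and \<Lambda> :: "('h, 'd) monoid_scheme" and N :: "'y::polish_space measure" and \<theta> :: "'h \<Rightarrow> 'y \<Rightarrow> 'y"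
    and p t and J :: "'j set" and idx X1
    and M' :: "'z::polish_space measure" and \<sigma>' and q +
  fixes \<delta> :: "'g \<Rightarrow> 'h" and u :: "'z \<Rightarrow> 'h"
  assumes \<delta>: "\<delta> \<in> hom \<Gamma> \<Lambda>" and u: "u \<in> measurable M' (count_space (carrier \<Lambda>))"
    and twist: "\<And>g. g \<in> carrier \<Gamma> \<Longrightarrow> AE z in M'.
      \<theta> (inv\<^bsub>\<Lambda>\<^esub> (u (\<sigma>' g z))) (p (q (\<sigma>' g z))) = \<theta> (\<delta> g) (\<theta> (inv\<^bsub>\<Lambda>\<^esub> (u z)) (p (q z)))"
begin

sublocale \<delta>: group_hom \<Gamma> \<Lambda> \<delta>
  using \<delta> X.group_axioms Y.group_axioms by (rule hom_imp_group_hom)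

lemma u_closed [simp]: "u z \<in> carrier \<Lambda>"
  using measurable_space[OF u, of z] by simp

lemma sets_level: "h \<in> carrier \<Lambda> \<Longrightarrow> {z. u z = h} \<in> sets M'"
  using measurable_sets[OF u, of "{h}"] by (simp add: vimage_def)

lemma AE_twist:
  "AE z in M'. q z \<in> X0 \<and> (\<forall>g\<in>carrier \<Gamma>. q (\<sigma>' g z) = \<sigma> g (q z) \<and>
     \<theta> (inv\<^bsub>\<Lambda>\<^esub> (u (\<sigma>' g z))) (p (\<sigma> g (q z))) = \<theta> (\<delta> g) (\<theta> (inv\<^bsub>\<Lambda>\<^esub> (u z)) (p (q z))))"
proof -
  have "AE z in M'. \<forall>g\<in>carrier \<Gamma>. q (\<sigma>' g z) = \<sigma> g (q z) \<and>
     \<theta> (inv\<^bsub>\<Lambda>\<^esub> (u (\<sigma>' g z))) (p (\<sigma> g (q z))) = \<theta> (\<delta> g) (\<theta> (inv\<^bsub>\<Lambda>\<^esub> (u z)) (p (q z)))"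
    unfolding AE_ball_countable[OF X.countable_group]
  proof
    fix g assume "g \<in> carrier \<Gamma>"
    from q_act[OF this] twist[OF this]
    show "AE z in M'. q (\<sigma>' g z) = \<sigma> g (q z) \<and>
      \<theta> (inv\<^bsub>\<Lambda>\<^esub> (u (\<sigma>' g z))) (p (\<sigma> g (q z))) = \<theta> (\<delta> g) (\<theta> (inv\<^bsub>\<Lambda>\<^esub> (u z)) (p (q z)))"
      by eventually_elim simp
  qed
  with AE_q[OF AE_X0] show ?thesis by eventually_elim simp
qed

text \<open>Countably many such pieces cover the space, so they cannot all be null.\<close>

lemma nonnull_piece:
  obtains h j where "h \<in> carrier \<Lambda>" "j \<in> J" "{z. u z = h \<and> idx (q z) = j} \<in> sets M'"
    "Z.prob {z. u z = h \<and> idx (q z) = j} > 0"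
proof -
  let ?A = "\<lambda>h j. {z. u z = h \<and> idx (q z) = j}"
  have A: "?A h j \<in> sets M'" if "h \<in> carrier \<Lambda>" "j \<in> J" for h j
  proof -
    have "(\<lambda>z. idx (q z)) -` {j} \<inter> space M' \<in> sets M'"
      using that by (intro measurable_sets[OF measurable_compose[OF measurable_q measurable_idx]]) auto
    from sets.Int[OF sets_level[OF that(1)] this] show ?thesis
      by (rule back_subst[where P = "\<lambda>A. A \<in> sets M'"]) auto
  qed
  have "\<exists>h\<in>carrier \<Lambda>. \<exists>j\<in>J. Z.prob (?A h j) \<noteq> 0"
  proof (rule ccontr)
    assume *: "\<not> ?thesis"
    have "AE z in M'. \<forall>h\<in>carrier \<Lambda>. \<forall>j\<in>J. z \<notin> ?A h j"
      unfolding AE_ball_countable[OF Y.countable_group] AE_ball_countable[OF countable_J]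
      using * A by (intro ballI AE_not_in) (auto simp: null_sets_def Z.emeasure_eq_measure)
    then have "AE z in M'. False" by eventually_elim (use idx_in_J in auto)
    then show False by simp
  qed
  then obtain h j where "h \<in> carrier \<Lambda>" "j \<in> J" "Z.prob (?A h j) \<noteq> 0" by blast
  then show ?thesis
    by (intro that[of h j] A) (simp_all add: zero_less_measure_iff)
qed

text \<open>On a piece where both \<open>u\<close> and the index are constant the untwisted map is injective modulo the
  quotient map, and it is invariant under the kernel. So the kernel moves a nonnull piece to
  pairwise disjoint sets of the same measure.\<close>

lemma finite_kernel: "finite (kernel \<Gamma> \<Lambda> \<delta>)"
proof -
  obtain h j where hj: "h \<in> carrier \<Lambda>" "j \<in> J"
    and A: "{z. u z = h \<and> idx (q z) = j} \<in> sets M'" and pos: "Z.prob {z. u z = h \<and> idx (q z) = j} > 0"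
    by (rule nonnull_piece)
  let ?A = "{z. u z = h \<and> idx (q z) = j}"
  \<comment> \<open>The number of elements of \<open>F\<close> that carry \<open>z\<close> into the
    piece is almost everywhere at most 1, while its integral is \<open>card F\<close> times the
    measure of the piece.\<close>
  have bound: "real (card F) * Z.prob ?A \<le> 1" if F: "finite F" "F \<subseteq> kernel \<Gamma> \<Lambda> \<delta>" for F
  proof -
    have FG: "g \<in> carrier \<Gamma>" "\<delta> g = \<one>\<^bsub>\<Lambda>\<^esub>" if "g \<in> F" for g
      using F(2) that by (auto simp: kernel_def)
    have ind: "(\<lambda>z. indicator ?A (\<sigma>' g z) :: ennreal) \<in> borel_measurable M'"
      and int: "(\<integral>\<^sup>+z. indicator ?A (\<sigma>' g z) \<partial>M') = emeasure M' ?A" if "g \<in> F" for g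
    proof -
      have eq: "(\<lambda>z. indicator ?A (\<sigma>' g z) :: ennreal) = indicator (\<sigma>' g -` ?A)"
        by (auto simp: indicator_def)
      note * = Z.sets_act_vimage[OF FG(1)[OF that] A]
      show "(\<lambda>z. indicator ?A (\<sigma>' g z) :: ennreal) \<in> borel_measurable M'"
        unfolding eq using * by (rule borel_measurable_indicator)
      show "(\<integral>\<^sup>+z. indicator ?A (\<sigma>' g z) \<partial>M') = emeasure M' ?A"
        unfolding eq nn_integral_indicator[OF *] by (rule Z.emeasure_act_vimage[OF FG(1)[OF that] A])
    qed
    have "AE z in M'. (\<Sum>g\<in>F. indicator ?A (\<sigma>' g z)) \<le> (1::ennreal)"
      using AE_twist
    proof eventually_elim
      case (elim z)
      \<comment> \<open>Kernel elements do not change the untwisted value, so the two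
        \<open>p\<close>-values agree; the indices agree too, hence so do the points of the
        quotient, and freeness identifies the group elements.\<close>
      have eq: "g = g'" if g: "g \<in> F" "g' \<in> F" and z: "\<sigma>' g z \<in> ?A" "\<sigma>' g' z \<in> ?A" for g g'
      proof -
        have x: "\<sigma> g (q z) \<in> X0" "\<sigma> g' (q z) \<in> X0" using elim g FG X0_act by blast+
        have "\<theta> (inv\<^bsub>\<Lambda>\<^esub> h) (p (\<sigma> k (q z))) = \<theta> (inv\<^bsub>\<Lambda>\<^esub> (u z)) (p (q z))"
          if "k \<in> F" "\<sigma>' k z \<in> ?A" for k
        proof -
          have "u (\<sigma>' k z) = h" using that(2) by simp
          then show ?thesis
            using elim FG[OF that(1)] by (metis Y.act_one)
        qed
        then have "\<theta> (inv\<^bsub>\<Lambda>\<^esub> h) (p (\<sigma> g (q z))) = \<theta> (inv\<^bsub>\<Lambda>\<^esub> h) (p (\<sigma> g' (q z)))"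
          using g z by presburger
        then have "p (\<sigma> g (q z)) = p (\<sigma> g' (q z))" using hj(1) by (simp add: Y.act_eq_iff)
        moreover have "idx (\<sigma> g (q z)) = idx (\<sigma> g' (q z))" using elim g z FG by auto
        ultimately have "\<sigma> g (q z) = \<sigma> g' (q z)" using inj_pieces[OF x] by simp
        then show "g = g'" using X.free_part_inj[OF X0D(2)] elim g FG by blast
      qed
      have "(\<Sum>g\<in>F. indicator ?A (\<sigma>' g z)) = (of_nat (card {g\<in>F. \<sigma>' g z \<in> ?A}) :: ennreal)"
        using F(1) by (simp add: indicator_def sum.If_cases Int_def)
      also have "(\<dots> :: ennreal) \<le> of_nat 1"
      proof (rule of_nat_mono)
        show "card {g\<in>F. \<sigma>' g z \<in> ?A} \<le> 1"
          using eq F(1) by (subst card_le_Suc0_iff_eq[unfolded One_nat_def[symmetric]]) auto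
      qed
      finally show ?case by (simp only: of_nat_1)
    qed
    then have "(\<integral>\<^sup>+z. (\<Sum>g\<in>F. indicator ?A (\<sigma>' g z)) \<partial>M') \<le> (\<integral>\<^sup>+z. 1 \<partial>M')"
      by (rule nn_integral_mono_AE)
    also have "(\<integral>\<^sup>+z. (\<Sum>g\<in>F. indicator ?A (\<sigma>' g z)) \<partial>M') = (\<Sum>g\<in>F. emeasure M' ?A)"
      using ind int by (simp add: nn_integral_sum)
    also have "\<dots> = ennreal (real (card F) * Z.prob ?A)"
      by (simp add: Z.emeasure_eq_measure ennreal_mult ennreal_of_nat_eq_real_of_nat)
    finally show ?thesis by (simp add: Z.emeasure_space_1[simplified])
  qed
  show ?thesis
  proof (rule ccontr)
    assume inf: "infinite (kernel \<Gamma> \<Lambda> \<delta>)"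
    obtain n :: nat where n: "real n * Z.prob ?A > 1" using reals_Archimedean3[OF pos] by blast
    obtain F where "finite F" "card F = n" "F \<subseteq> kernel \<Gamma> \<Lambda> \<delta>"
      using infinite_arbitrarily_large[OF inf] by blast
    then show False using bound[of F] n by simp
  qed
qed

lemma inj_\<delta>:
  assumes "no_finite_normal_subgroups \<Gamma>"
  shows "inj_on \<delta> (carrier \<Gamma>)"
  using assms finite_kernel \<delta>.normal_kernel \<delta>.inj_iff_trivial_ker
  by (simp add: no_finite_normal_subgroups_def)

end

section \<open>Descending the untwisting to the quotient\<close>

text \<open>Countability of \<open>I\<close> gives joint measurability on the product and
  sigma-finiteness of the counting measure, so partial integrals are measurable.\<close>

lemma borel_measurable_nn_integral_count_space:
  fixes f :: "'i \<Rightarrow> 'a \<Rightarrow> ennreal"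
  assumes I: "countable I" and f: "\<And>i. i \<in> I \<Longrightarrow> f i \<in> borel_measurable M"
  shows "(\<lambda>x. \<integral>\<^sup>+i. f i x \<partial>count_space I) \<in> borel_measurable M"
proof -
  interpret sigma_finite_measure "count_space I"
    using I by (rule sigma_finite_measure_count_space_countable)
  have "(\<lambda>x. f (snd x) (fst x)) \<in> borel_measurable (M \<Otimes>\<^sub>M count_space I)"
    by (rule measurable_compose_countable'[where f = "\<lambda>i x. f i (fst x)" and g = snd, OF _ measurable_snd I])
      (rule measurable_compose[OF measurable_fst f])
  then show ?thesis
    by (intro borel_measurable_nn_integral) (simp add: case_prod_beta')
qed

context untwisted_lift
begin

text \<open>The law by which \<open>u\<close> changes under \<open>g\<close> if \<open>k\<close>
  carries \<open>p x\<close> to \<open>p (\<sigma> g x)\<close>. With \<open>k = \<delta> g\<close>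
  it is conjugation by \<open>\<delta> g\<close>, the form in which it acts on overlaps.\<close>

abbreviation base_change :: "'h \<Rightarrow> 'g \<Rightarrow> 'h \<Rightarrow> 'h" where
  "base_change k g h \<equiv> k \<otimes>\<^bsub>\<Lambda>\<^esub> h \<otimes>\<^bsub>\<Lambda>\<^esub> inv\<^bsub>\<Lambda>\<^esub> (\<delta> g)"

lemma bij_base_change:
  assumes "k \<in> carrier \<Lambda>" "g \<in> carrier \<Gamma>"
  shows "bij_betw (base_change k g) (carrier \<Lambda>) (carrier \<Lambda>)"
  by (rule bij_betwI[where g = "\<lambda>h. inv\<^bsub>\<Lambda>\<^esub> k \<otimes>\<^bsub>\<Lambda>\<^esub> h \<otimes>\<^bsub>\<Lambda>\<^esub> \<delta> g"])
    (use assms in \<open>auto simp: Y.m_assoc simp flip: Y.m_assoc[of k "inv\<^bsub>\<Lambda>\<^esub> k"] Y.m_assoc[of "inv\<^bsub>\<Lambda>\<^esub> k" k]\<close>)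

text \<open>Both sides of the twisting relation act on the single point \<open>p (q z)\<close>,
  which freeness allows to cancel.\<close>

lemma u_act:
  assumes "q z \<in> X0" "g \<in> carrier \<Gamma>" "k \<in> carrier \<Lambda>" "p (\<sigma> g (q z)) = \<theta> k (p (q z))"
    and "\<theta> (inv\<^bsub>\<Lambda>\<^esub> (u (\<sigma>' g z))) (p (\<sigma> g (q z))) = \<theta> (\<delta> g) (\<theta> (inv\<^bsub>\<Lambda>\<^esub> (u z)) (p (q z)))"
  shows "u (\<sigma>' g z) = base_change k g (u z)"
proof -
  have "\<theta> (inv\<^bsub>\<Lambda>\<^esub> (u (\<sigma>' g z)) \<otimes>\<^bsub>\<Lambda>\<^esub> k) (p (q z)) = \<theta> (\<delta> g \<otimes>\<^bsub>\<Lambda>\<^esub> inv\<^bsub>\<Lambda>\<^esub> (u z)) (p (q z))"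
    using assms by (simp add: Y.act_mult)
  then have "inv\<^bsub>\<Lambda>\<^esub> (u (\<sigma>' g z)) \<otimes>\<^bsub>\<Lambda>\<^esub> k = \<delta> g \<otimes>\<^bsub>\<Lambda>\<^esub> inv\<^bsub>\<Lambda>\<^esub> (u z)"
    using assms by (intro Y.free_part_inj[OF X0D(3)]) auto
  then have "k = u (\<sigma>' g z) \<otimes>\<^bsub>\<Lambda>\<^esub> (\<delta> g \<otimes>\<^bsub>\<Lambda>\<^esub> inv\<^bsub>\<Lambda>\<^esub> (u z))"
    using assms by (metis Y.inv_solve_left Y.m_closed Y.inv_closed \<delta>.hom_closed u_closed)
  then show ?thesis
    using assms by (simp add: Y.m_assoc)
qed

text \<open>For fixed \<open>h\<close>, the density of the image of the level set \<open>u = h\<close> is the conditional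
  probability of \<open>u = h\<close> over a point of the quotient.\<close>

definition fibre_dist :: "('h \<Rightarrow> 'x \<Rightarrow> ennreal) \<Rightarrow> bool" where
  "fibre_dist c \<longleftrightarrow> (\<forall>h\<in>carrier \<Lambda>. c h \<in> borel_measurable M \<and>
     (\<forall>B\<in>sets M. (\<integral>\<^sup>+x. c h x * indicator B x \<partial>M) = emeasure M' (q -` B \<inter> {z. u z = h})))"

text \<open>Radon-Nikodym for the push-forward under \<open>q\<close> of the measure restricted to a
  level set of \<open>u\<close>, which is absolutely continuous because \<open>q\<close> preserves
  measure. Choosing a density for each \<open>h\<close> takes the place of a disintegration.\<close>

lemma fibre_dist_exists: obtains c where "fibre_dist c"
proof -
  have "\<exists>f\<in>borel_measurable M. \<forall>B\<in>sets M.
      (\<integral>\<^sup>+x. f x * indicator B x \<partial>M) = emeasure M' (q -` B \<inter> {z. u z = h})"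
    if h: "h \<in> carrier \<Lambda>" for h
  proof -
    define L where "L = distr (density M' (indicator {z. u z = h})) M q"
    have q: "q \<in> measurable (density M' (indicator {z. u z = h})) M"
      using measurable_q by simp
    have L: "emeasure L B = emeasure M' (q -` B \<inter> {z. u z = h})" if B: "B \<in> sets M" for B
    proof -
      have qB: "q -` B \<in> sets M'" using measurable_sets[OF measurable_q B] by simp
      have "emeasure L B = (\<integral>\<^sup>+z. indicator {z. u z = h} z * indicator (q -` B) z \<partial>M')"
        unfolding L_def using q B qB sets_level[OF h]
        by (simp add: emeasure_distr emeasure_density)
      also have "\<dots> = (\<integral>\<^sup>+z. indicator (q -` B \<inter> {z. u z = h}) z \<partial>M')"
        by (intro nn_integral_cong) (auto simp: indicator_def)
      also have "\<dots> = emeasure M' (q -` B \<inter> {z. u z = h})"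
        using qB sets_level[OF h] by (intro nn_integral_indicator) auto
      finally show ?thesis .
    qed
    have "absolutely_continuous M L"
      unfolding absolutely_continuous_def
    proof
      fix B assume B: "B \<in> null_sets M"
      then have "emeasure M' (q -` B) = 0"
        using emeasure_distr[OF measurable_q, of B] by (simp add: distr_q null_sets_def)
      moreover have "q -` B \<in> sets M'" using B measurable_sets[OF measurable_q, of B] by auto
      ultimately have "emeasure M' (q -` B \<inter> {z. u z = h}) = 0"
        using emeasure_mono[of "q -` B \<inter> {z. u z = h}" "q -` B" M'] by simp
      then show "B \<in> null_sets L" using B L[of B] by (auto simp: null_sets_def L_def)
    qed
    moreover have "sets L = sets M" by (simp add: L_def)
    ultimately obtain f where f: "f \<in> borel_measurable M" "density M f = L"
      using X.Radon_Nikodym by blast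
    have "(\<integral>\<^sup>+x. f x * indicator B x \<partial>M) = emeasure M' (q -` B \<inter> {z. u z = h})"
      if "B \<in> sets M" for B
      using emeasure_density[OF f(1) that] L[OF that] by (simp add: f(2))
    with f(1) show ?thesis by blast
  qed
  then obtain c where "\<forall>h\<in>carrier \<Lambda>. c h \<in> borel_measurable M \<and>
     (\<forall>B\<in>sets M. (\<integral>\<^sup>+x. c h x * indicator B x \<partial>M) = emeasure M' (q -` B \<inter> {z. u z = h}))"
    by metis
  then show ?thesis using that[of c] by (simp add: fibre_dist_def)
qed

section \<open>The conditional distribution of \<open>u\<close> over the quotient\<close>

context
  fixes c assumes c: "fibre_dist c"
begin

lemma c_meas: "h \<in> carrier \<Lambda> \<Longrightarrow> c h \<in> borel_measurable M"
  and c_integral: "h \<in> carrier \<Lambda> \<Longrightarrow> B \<in> sets M \<Longrightarrow>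
    (\<integral>\<^sup>+x. c h x * indicator B x \<partial>M) = emeasure M' (q -` B \<inter> {z. u z = h})"
  using c by (auto simp: fibre_dist_def)

lemma c_sum_meas: "(\<lambda>x. \<integral>\<^sup>+h. c h x \<partial>count_space (carrier \<Lambda>)) \<in> borel_measurable M"
  by (rule borel_measurable_nn_integral_count_space) (use c_meas Y.countable_group in auto)

text \<open>The level sets of \<open>u\<close> partition the lift, so the densities add up to a
  density of the push-forward of the whole measure, which is \<open>M\<close>.\<close>

lemma c_sum: "AE x in M. (\<integral>\<^sup>+h. c h x \<partial>count_space (carrier \<Lambda>)) = 1"
proof (rule X.density_unique[OF c_sum_meas])
  show "density M (\<lambda>x. \<integral>\<^sup>+h. c h x \<partial>count_space (carrier \<Lambda>)) = density M (\<lambda>_. 1)"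
  proof (rule measure_eqI)
    fix B assume "B \<in> sets (density M (\<lambda>x. \<integral>\<^sup>+h. c h x \<partial>count_space (carrier \<Lambda>)))"
    then have B: "B \<in> sets M" by simp
    have qB: "q -` B \<in> sets M'" using measurable_sets[OF measurable_q B] by simp
    have "emeasure (density M (\<lambda>x. \<integral>\<^sup>+h. c h x \<partial>count_space (carrier \<Lambda>))) B =
        (\<integral>\<^sup>+x. (\<integral>\<^sup>+h. c h x * indicator B x \<partial>count_space (carrier \<Lambda>)) \<partial>M)"
      using B by (simp add: emeasure_density[OF c_sum_meas] nn_integral_multc)
    also have "\<dots> = (\<integral>\<^sup>+h. (\<integral>\<^sup>+x. c h x * indicator B x \<partial>M) \<partial>count_space (carrier \<Lambda>))"
      using c_meas B Y.countable_group by (intro nn_integral_count_space_nn_integral) auto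
    also have "\<dots> = (\<integral>\<^sup>+h. emeasure M' (q -` B \<inter> {z. u z = h}) \<partial>count_space (carrier \<Lambda>))"
      using B by (intro nn_integral_cong) (simp add: c_integral)
    also have "\<dots> = emeasure M' (\<Union>h\<in>carrier \<Lambda>. q -` B \<inter> {z. u z = h})"
      using qB sets_level Y.countable_group
      by (intro emeasure_UN_countable[symmetric]) (auto simp: disjoint_family_on_def)
    also have "(\<Union>h\<in>carrier \<Lambda>. q -` B \<inter> {z. u z = h}) = q -` B" by auto
    also have "emeasure M' (q -` B) = emeasure M B"
      using emeasure_distr[OF measurable_q B] by (simp add: distr_q)
    finally show "emeasure (density M (\<lambda>x. \<integral>\<^sup>+h. c h x \<partial>count_space (carrier \<Lambda>))) B =
        emeasure (density M (\<lambda>_. 1)) B"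
      using B by (simp add: emeasure_density)
  qed simp
qed simp

text \<open>Where \<open>k\<close> carries \<open>p x\<close> to \<open>p (\<sigma> g x)\<close>,
  the lifted action moves the level set of \<open>h\<close> over \<open>x\<close> to that of
  \<open>base_change k g h\<close> over \<open>\<sigma> g x\<close> and preserves measure.
  Uniqueness of densities turns this into an identity of conditional probabilities.\<close>

lemma c_act:
  assumes g: "g \<in> carrier \<Gamma>" and k: "k \<in> carrier \<Lambda>" and h: "h \<in> carrier \<Lambda>"
  shows "AE x in M. p (\<sigma> g x) = \<theta> k (p x) \<longrightarrow> c (base_change k g h) (\<sigma> g x) = c h x"
proof -
  \<comment> \<open>The element carrying \<open>p x\<close> to \<open>p (\<sigma> g x)\<close>
    depends on \<open>x\<close>, so both densities are cut down to the measurable set where it is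
    \<open>k\<close>.\<close>
  define B where "B = {x \<in> space M. p (\<sigma> g x) = \<theta> k (p x)}"
  define h' where "h' = base_change k g h"
  have h': "h' \<in> carrier \<Lambda>" unfolding h'_def using g k h by simp
  have B: "B \<in> sets M"
    unfolding B_def
  proof (rule measurable_equality_set)
    have "(\<lambda>x. p (\<sigma> g x)) \<in> measurable M N" "(\<lambda>x. \<theta> k (p x)) \<in> measurable M N"
      using measurable_compose[OF X.measurable_action[OF g] measurable_p]
        measurable_compose[OF measurable_p Y.measurable_action[OF k]] by auto
    then show "(\<lambda>x. p (\<sigma> g x)) \<in> borel_measurable M" "(\<lambda>x. \<theta> k (p x)) \<in> borel_measurable M"
      by (simp_all only: measurable_cong_sets[OF refl Y.sets_eq])
  qed
  have c'_meas: "(\<lambda>x. c h' (\<sigma> g x)) \<in> borel_measurable M"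
    by (rule measurable_compose[OF X.measurable_action[OF g] c_meas[OF h']])
  have "AE x in M. c h' (\<sigma> g x) * indicator B x = c h x * indicator B x"
  proof (rule X.density_unique)
    show m: "(\<lambda>x. c h' (\<sigma> g x) * indicator B x) \<in> borel_measurable M"
      "(\<lambda>x. c h x * indicator B x) \<in> borel_measurable M"
      using c'_meas c_meas[OF h] B by auto
    show "density M (\<lambda>x. c h' (\<sigma> g x) * indicator B x) = density M (\<lambda>x. c h x * indicator B x)"
    proof (rule measure_eqI)
      fix C assume "C \<in> sets (density M (\<lambda>x. c h' (\<sigma> g x) * indicator B x))"
      then have C: "C \<in> sets M" by simp
      define D where "D = B \<inter> C"
      have D: "D \<in> sets M" and gD: "\<sigma> g ` D \<in> sets M"
        unfolding D_def using B C g by (auto intro: X.sets_act_image)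
      define S where "S = q -` (\<sigma> g ` D) \<inter> {z. u z = h'}"
      have S: "S \<in> sets M'"
        unfolding S_def using measurable_sets[OF measurable_q gD] sets_level[OF h'] by auto
      have "emeasure (density M (\<lambda>x. c h' (\<sigma> g x) * indicator B x)) C =
          (\<integral>\<^sup>+x. c h' (\<sigma> g x) * indicator (\<sigma> g ` D) (\<sigma> g x) \<partial>M)"
        unfolding emeasure_density[OF m(1) C] using g
        by (intro nn_integral_cong) (auto simp: indicator_def D_def X.act_eq_iff)
      also have "\<dots> = (\<integral>\<^sup>+x. c h' x * indicator (\<sigma> g ` D) x \<partial>distr M M (\<sigma> g))"
        using c_meas[OF h'] gD by (intro nn_integral_distr[symmetric] X.measurable_action g) auto
      also have "\<dots> = emeasure M' S"
        unfolding X.distr_action[OF g] S_def by (rule c_integral[OF h' gD])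
      also have "\<dots> = emeasure M' (\<sigma>' g -` S)"
        using Z.emeasure_act_vimage[OF g S] by simp
      \<comment> \<open>By the transformation law of \<open>u\<close>, pulling \<open>S\<close> back
        by \<open>\<sigma>' g\<close> gives the level set of \<open>h\<close> over \<open>D\<close>
        up to a null set.\<close>
      also have "\<dots> = emeasure M' (q -` D \<inter> {z. u z = h})"
      proof (rule emeasure_eq_AE)
        show "AE z in M'. z \<in> \<sigma>' g -` S \<longleftrightarrow> z \<in> q -` D \<inter> {z. u z = h}"
          using AE_twist
        proof eventually_elim
          case (elim z)
          then have z: "q z \<in> X0" "q (\<sigma>' g z) = \<sigma> g (q z)"
            "\<theta> (inv\<^bsub>\<Lambda>\<^esub> (u (\<sigma>' g z))) (p (\<sigma> g (q z))) = \<theta> (\<delta> g) (\<theta> (inv\<^bsub>\<Lambda>\<^esub> (u z)) (p (q z)))"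
            using g by auto
          have "q (\<sigma>' g z) \<in> \<sigma> g ` D \<longleftrightarrow> q z \<in> D"
            using g z(2) by (auto simp: X.act_eq_iff)
          moreover have "u (\<sigma>' g z) = h' \<longleftrightarrow> u z = h" if "q z \<in> D"
          proof -
            have "u (\<sigma>' g z) = base_change k g (u z)"
              using that z g k by (intro u_act) (auto simp: D_def B_def)
            then show ?thesis
              using bij_betw_imp_inj_on[OF bij_base_change[OF k g]] h
              unfolding h'_def inj_on_def by (metis u_closed)
          qed
          ultimately show ?case unfolding S_def by blast
        qed
        show "\<sigma>' g -` S \<in> sets M'" using g S by (rule Z.sets_act_vimage)
        show "q -` D \<inter> {z. u z = h} \<in> sets M'"
          using measurable_sets[OF measurable_q D] sets_level[OF h] by auto
      qed
      also have "\<dots> = (\<integral>\<^sup>+x. c h x * indicator D x \<partial>M)"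
        by (rule c_integral[OF h D, symmetric])
      also have "\<dots> = emeasure (density M (\<lambda>x. c h x * indicator B x)) C"
        unfolding emeasure_density[OF m(2) C]
        by (intro nn_integral_cong) (auto simp: indicator_def D_def)
      finally show "emeasure (density M (\<lambda>x. c h' (\<sigma> g x) * indicator B x)) C =
          emeasure (density M (\<lambda>x. c h x * indicator B x)) C" .
    qed simp
  qed
  then show ?thesis by eventually_elim (auto simp: B_def h'_def indicator_def)
qed

lemma AE_c_act:
  "AE x in M. x \<in> X0 \<and> (\<forall>g\<in>carrier \<Gamma>. \<forall>k\<in>carrier \<Lambda>. \<forall>h\<in>carrier \<Lambda>.
     p (\<sigma> g x) = \<theta> k (p x) \<longrightarrow> c (base_change k g h) (\<sigma> g x) = c h x)"
proof -
  have "AE x in M. \<forall>g\<in>carrier \<Gamma>. \<forall>k\<in>carrier \<Lambda>. \<forall>h\<in>carrier \<Lambda>.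
     p (\<sigma> g x) = \<theta> k (p x) \<longrightarrow> c (base_change k g h) (\<sigma> g x) = c h x"
    unfolding AE_ball_countable[OF X.countable_group] AE_ball_countable[OF Y.countable_group]
    using c_act by blast
  with AE_X0 show ?thesis by eventually_elim simp
qed

text \<open>The probability that two independent samples of \<open>u\<close> over the same point differ by \<open>k\<close>. This
  is a probability distribution on the group that is invariant under conjugation by \<open>\<delta>\<close>, so it is
  carried by the elements with a finite conjugation orbit.\<close>

definition overlap :: "'h \<Rightarrow> 'x \<Rightarrow> ennreal" where
  "overlap k x = (\<integral>\<^sup>+h. c h x * c (h \<otimes>\<^bsub>\<Lambda>\<^esub> k) x \<partial>count_space (carrier \<Lambda>))"

lemma overlap_meas: "k \<in> carrier \<Lambda> \<Longrightarrow> overlap k \<in> borel_measurable M"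
  unfolding overlap_def[abs_def]
  by (rule borel_measurable_nn_integral_count_space) (use c_meas Y.countable_group in auto)

text \<open>Moving the point by \<open>g\<close> applies one base change to both samples. Its left
  factor cancels in their quotient and only conjugation by \<open>\<delta> g\<close>
  survives.\<close>

lemma overlap_conj:
  assumes g: "g \<in> carrier \<Gamma>" and k: "k \<in> carrier \<Lambda>"
  shows "(\<integral>\<^sup>+x. overlap (base_change (\<delta> g) g k) x \<partial>M) = (\<integral>\<^sup>+x. overlap k x \<partial>M)"
proof -
  let ?k = "base_change (\<delta> g) g k"
  have k': "?k \<in> carrier \<Lambda>" using g k by simp
  have "(\<integral>\<^sup>+x. overlap ?k x \<partial>M) = (\<integral>\<^sup>+x. overlap ?k x \<partial>distr M M (\<sigma> g))"
    by (simp add: X.distr_action[OF g])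
  also have "\<dots> = (\<integral>\<^sup>+x. overlap ?k (\<sigma> g x) \<partial>M)"
    using overlap_meas[OF k'] by (intro nn_integral_distr X.measurable_action g) auto
  also have "\<dots> = (\<integral>\<^sup>+x. overlap k x \<partial>M)"
  proof (rule nn_integral_cong_AE)
    show "AE x in M. overlap ?k (\<sigma> g x) = overlap k x"
      using AE_c_act
    proof eventually_elim
      case (elim x)
      \<comment> \<open>The element \<open>w\<close> varies with \<open>x\<close> but drops out of
        the conjugated index, which is why the integrals over all \<open>x\<close> can be
        compared.\<close>
      then obtain w where w: "w \<in> carrier \<Lambda>" "p (\<sigma> g x) = \<theta> w (p x)" using orbit_forth g by blast
      have cw: "c (base_change w g h) (\<sigma> g x) = c h x" if "h \<in> carrier \<Lambda>" for h
        using elim g w that by blast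
      have "overlap ?k (\<sigma> g x) = (\<integral>\<^sup>+h. c (base_change w g h) (\<sigma> g x) *
          c (base_change w g h \<otimes>\<^bsub>\<Lambda>\<^esub> ?k) (\<sigma> g x) \<partial>count_space (carrier \<Lambda>))"
        unfolding overlap_def
        by (rule nn_integral_bij_count_space[OF bij_base_change[OF w(1) g], symmetric])
      also have "\<dots> = overlap k x"
        unfolding overlap_def
      proof (rule nn_integral_cong)
        fix h assume "h \<in> space (count_space (carrier \<Lambda>))"
        then have h: "h \<in> carrier \<Lambda>" by simp
        have "base_change w g h \<otimes>\<^bsub>\<Lambda>\<^esub> ?k = base_change w g (h \<otimes>\<^bsub>\<Lambda>\<^esub> k)"
          using h w(1) g k
          by (simp add: Y.m_assoc) (simp flip: Y.m_assoc[of "inv\<^bsub>\<Lambda>\<^esub> (\<delta> g)" "\<delta> g"])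
        then show "c (base_change w g h) (\<sigma> g x) * c (base_change w g h \<otimes>\<^bsub>\<Lambda>\<^esub> ?k) (\<sigma> g x) =
            c h x * c (h \<otimes>\<^bsub>\<Lambda>\<^esub> k) x"
          using cw[OF h] cw[of "h \<otimes>\<^bsub>\<Lambda>\<^esub> k"] h k by simp
      qed
      finally show ?case .
    qed
  qed
  finally show ?thesis .
qed

text \<open>Sum and integral, and then the two sums, are exchanged. For fixed \<open>h\<close> the
  products \<open>h k\<close> run once through the group, so the inner sum of conditional
  probabilities is 1.\<close>

lemma overlap_total:
  "(\<integral>\<^sup>+k. (\<integral>\<^sup>+x. overlap k x \<partial>M) \<partial>count_space (carrier \<Lambda>)) = 1"
proof -
  have "(\<integral>\<^sup>+k. (\<integral>\<^sup>+x. overlap k x \<partial>M) \<partial>count_space (carrier \<Lambda>)) =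
      (\<integral>\<^sup>+x. (\<integral>\<^sup>+k. overlap k x \<partial>count_space (carrier \<Lambda>)) \<partial>M)"
    using overlap_meas Y.countable_group by (intro nn_integral_count_space_nn_integral[symmetric]) auto
  also have "\<dots> = (\<integral>\<^sup>+x. 1 \<partial>M)"
  proof (rule nn_integral_cong_AE)
    show "AE x in M. (\<integral>\<^sup>+k. overlap k x \<partial>count_space (carrier \<Lambda>)) = 1"
      using c_sum
    proof eventually_elim
      case (elim x)
      have "(\<integral>\<^sup>+k. overlap k x \<partial>count_space (carrier \<Lambda>)) =
          (\<integral>\<^sup>+h. (\<integral>\<^sup>+k. c h x * c (h \<otimes>\<^bsub>\<Lambda>\<^esub> k) x \<partial>count_space (carrier \<Lambda>)) \<partial>count_space (carrier \<Lambda>))"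
        unfolding overlap_def using Y.countable_group
        by (intro nn_integral_count_space_nn_integral) auto
      also have "\<dots> = (\<integral>\<^sup>+h. c h x \<partial>count_space (carrier \<Lambda>))"
      proof (rule nn_integral_cong)
        fix h assume "h \<in> space (count_space (carrier \<Lambda>))"
        then have h: "h \<in> carrier \<Lambda>" by simp
        have "bij_betw (\<lambda>k. h \<otimes>\<^bsub>\<Lambda>\<^esub> k) (carrier \<Lambda>) (carrier \<Lambda>)"
          by (rule bij_betwI[where g = "\<lambda>k. inv\<^bsub>\<Lambda>\<^esub> h \<otimes>\<^bsub>\<Lambda>\<^esub> k"])
            (use h in \<open>auto simp flip: Y.m_assoc\<close>)
        then have "(\<integral>\<^sup>+k. c (h \<otimes>\<^bsub>\<Lambda>\<^esub> k) x \<partial>count_space (carrier \<Lambda>)) = 1"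
          using nn_integral_bij_count_space[of "\<lambda>k. h \<otimes>\<^bsub>\<Lambda>\<^esub> k" "carrier \<Lambda>" "carrier \<Lambda>" "\<lambda>k. c k x"] elim
          by simp
        then show "(\<integral>\<^sup>+k. c h x * c (h \<otimes>\<^bsub>\<Lambda>\<^esub> k) x \<partial>count_space (carrier \<Lambda>)) = c h x"
          by (simp add: nn_integral_cmult)
      qed
      finally show ?case using elim by simp
    qed
  qed
  finally show ?thesis by (simp add: X.emeasure_space_1[simplified])
qed

text \<open>The mass is constant along the orbit, so an infinite orbit of positive mass would exceed
  the total mass 1.\<close>

lemma overlap_finite_orbit:
  assumes k: "k \<in> carrier \<Lambda>" and pos: "(\<integral>\<^sup>+x. overlap k x \<partial>M) \<noteq> 0"
  shows "finite {base_change (\<delta> g) g k | g. g \<in> carrier \<Gamma>}" (is "finite ?O")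
proof (rule ccontr)
  assume inf: "infinite ?O"
  let ?m = "\<lambda>k. \<integral>\<^sup>+x. overlap k x \<partial>M"
  have O: "?O \<subseteq> carrier \<Lambda>" using k by auto
  have "(\<integral>\<^sup>+k'. ?m k * indicator ?O k' \<partial>count_space (carrier \<Lambda>)) \<le>
      (\<integral>\<^sup>+k'. ?m k' \<partial>count_space (carrier \<Lambda>))"
    using overlap_conj[OF _ k] by (intro nn_integral_mono) (auto simp: indicator_def)
  also have "(\<integral>\<^sup>+k'. ?m k * indicator ?O k' \<partial>count_space (carrier \<Lambda>)) =
      ?m k * emeasure (count_space (carrier \<Lambda>)) ?O"
    using O by (intro nn_integral_cmult_indicator) auto
  finally show False
    using inf O pos by (simp add: overlap_total emeasure_count_space_infinite ennreal_mult_top top_unique)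
qed

text \<open>The orbit of \<open>\<delta> g\<close> is the image of the conjugacy class of
  \<open>g\<close>, infinite by the ICC property and injectivity. The overlap at
  \<open>\<delta> g\<close> therefore integrates to 0, and its nonnegative summands vanish almost
  everywhere.\<close>

lemma overlap_\<delta>:
  assumes icc: "icc_group \<Gamma>" and inj: "inj_on \<delta> (carrier \<Gamma>)"
    and g: "g \<in> carrier \<Gamma>" "g \<noteq> \<one>\<^bsub>\<Gamma>\<^esub>"
  shows "AE x in M. \<forall>h\<in>carrier \<Lambda>. c h x * c (h \<otimes>\<^bsub>\<Lambda>\<^esub> \<delta> g) x = 0"
proof -
  have \<delta>g: "\<delta> g \<in> carrier \<Lambda>" using g by simp
  let ?C = "{h \<otimes>\<^bsub>\<Gamma>\<^esub> g \<otimes>\<^bsub>\<Gamma>\<^esub> inv\<^bsub>\<Gamma>\<^esub> h | h. h \<in> carrier \<Gamma>}"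
  have "{base_change (\<delta> h) h (\<delta> g) | h. h \<in> carrier \<Gamma>} = \<delta> ` ?C"
    using g by (auto simp: image_iff) (metis \<delta>.hom_inv \<delta>.hom_mult X.inv_closed X.m_closed)+
  moreover have "infinite (\<delta> ` ?C)"
  proof
    assume "finite (\<delta> ` ?C)"
    moreover have "inj_on \<delta> ?C" using g by (intro inj_on_subset[OF inj]) auto
    ultimately have "finite ?C" by (rule finite_imageD)
    then show False using icc g by (auto simp: icc_group_def)
  qed
  ultimately have "(\<integral>\<^sup>+x. overlap (\<delta> g) x \<partial>M) = 0"
    using overlap_finite_orbit[OF \<delta>g] by auto
  then have "AE x in M. overlap (\<delta> g) x = 0"
    using overlap_meas[OF \<delta>g] by (simp add: nn_integral_0_iff_AE)
  then show ?thesis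
  proof eventually_elim
    case (elim x)
    then have "AE h in count_space (carrier \<Lambda>). c h x * c (h \<otimes>\<^bsub>\<Lambda>\<^esub> \<delta> g) x = 0"
      unfolding overlap_def by (subst (asm) nn_integral_0_iff_AE) auto
    then show ?case by (simp add: AE_count_space)
  qed
qed

text \<open>The sets \<open>A h\<close> where \<open>u = h\<close> has positive conditional probability cover the space, while the
  maps \<open>x \<mapsto> h\<inverse> p x\<close> on \<open>A h\<close> have disjoint images in a probability space. So the \<open>A h\<close> form a
  partition and \<open>u\<close> is constant over almost every point.\<close>

lemma fibre_dist_unique:
  assumes icc: "icc_group \<Gamma>" and inj: "inj_on \<delta> (carrier \<Gamma>)"
    and emb: "scaled_embedding 1 M N X1 p"
  shows "AE x in M. \<forall>h\<in>carrier \<Lambda>. \<forall>h'\<in>carrier \<Lambda>. c h x \<noteq> 0 \<longrightarrow> c h' x \<noteq> 0 \<longrightarrow> h = h'"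
proof -
  have "AE x in M. \<forall>g\<in>carrier \<Gamma>. g \<noteq> \<one>\<^bsub>\<Gamma>\<^esub> \<longrightarrow> (\<forall>h\<in>carrier \<Lambda>. c h x * c (h \<otimes>\<^bsub>\<Lambda>\<^esub> \<delta> g) x = 0)"
    unfolding AE_ball_countable[OF X.countable_group]
  proof
    fix g assume "g \<in> carrier \<Gamma>"
    then show "AE x in M. g \<noteq> \<one>\<^bsub>\<Gamma>\<^esub> \<longrightarrow> (\<forall>h\<in>carrier \<Lambda>. c h x * c (h \<otimes>\<^bsub>\<Lambda>\<^esub> \<delta> g) x = 0)"
      using overlap_\<delta>[OF icc inj, of g] by (cases "g = \<one>\<^bsub>\<Gamma>\<^esub>") auto
  qed
  moreover note AE_c_act
  ultimately have AE_good: "AE x in M. (x \<in> X0 \<and> (\<forall>g\<in>carrier \<Gamma>. \<forall>k\<in>carrier \<Lambda>. \<forall>h\<in>carrier \<Lambda>.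
       p (\<sigma> g x) = \<theta> k (p x) \<longrightarrow> c (base_change k g h) (\<sigma> g x) = c h x)) \<and>
     (\<forall>g\<in>carrier \<Gamma>. g \<noteq> \<one>\<^bsub>\<Gamma>\<^esub> \<longrightarrow> (\<forall>h\<in>carrier \<Lambda>. c h x * c (h \<otimes>\<^bsub>\<Lambda>\<^esub> \<delta> g) x = 0))" (is "AE x in M. ?good x")
    by eventually_elim simp
  \<comment> \<open>All almost everywhere facts are merged so that one conull set \<open>X3\<close>
    serves for every pair of points.\<close>
  define good where "good = ?good"
  have "AE x in M. good x" using AE_good by (simp add: good_def)
  then obtain X3 where X3: "X3 \<in> sets M" "AE x in M. x \<in> X3" and X3_good: "\<And>x. x \<in> X3 \<Longrightarrow> good x"
    by (rule X.AE_invariant_core) blast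
  have X3_X0: "x \<in> X0" if "x \<in> X3" for x
    using X3_good[OF that] by (simp add: good_def)
  have X3_act: "c (base_change k g h) (\<sigma> g x) = c h x"
    if "x \<in> X3" "g \<in> carrier \<Gamma>" "k \<in> carrier \<Lambda>" "h \<in> carrier \<Lambda>" "p (\<sigma> g x) = \<theta> k (p x)" for x g k h
    using X3_good[OF that(1)] that(2-) by (simp add: good_def)
  have X3_free: "c h x * c (h \<otimes>\<^bsub>\<Lambda>\<^esub> \<delta> g) x = 0"
    if "x \<in> X3" "g \<in> carrier \<Gamma>" "g \<noteq> \<one>\<^bsub>\<Gamma>\<^esub>" "h \<in> carrier \<Lambda>" for x g h
    using X3_good[OF that(1)] that(2-) unfolding good_def by blast
  define A where "A h = {x \<in> X3. c h x \<noteq> 0}" for h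
  have A: "A h \<in> sets M" if "h \<in> carrier \<Lambda>" for h
  proof -
    have "X3 \<inter> (c h -` (- {0}) \<inter> space M) \<in> sets M"
      using X3(1) by (intro sets.Int measurable_sets[OF c_meas[OF that]]) auto
    moreover have "A h = X3 \<inter> (c h -` (- {0}) \<inter> space M)" by (auto simp: A_def)
    ultimately show ?thesis by simp
  qed
  define f where "f h = (\<lambda>x. \<theta> (inv\<^bsub>\<Lambda>\<^esub> h) (p x))" for h
  have embf: "scaled_embedding 1 M N (A h) (f h)" if "h \<in> carrier \<Lambda>" for h
    unfolding f_def using X3_X0 X0D(1) that
    by (intro Y.scaled_embedding_act scaled_embedding_subset[OF emb]) (auto simp: A_def)
  \<comment> \<open>Equal images give \<open>x' = \<sigma> g x\<close>, and undoing the base change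
    shows that \<open>h\<close> and \<open>h\<close> times \<open>\<delta> g\<close> are both
    charged over \<open>x\<close>. The vanishing overlap forces \<open>g\<close> to be the unit, and
    freeness then gives \<open>h = h'\<close>.\<close>
  have key: "h = h'" if h: "h \<in> carrier \<Lambda>" "h' \<in> carrier \<Lambda>" and x: "x \<in> A h" "x' \<in> A h'" and eq: "f h x = f h' x'" for h h' x x'
  proof -
    have x0: "x \<in> X3" "x' \<in> X3" "x \<in> X0" "x' \<in> X0" "c h x \<noteq> 0" "c h' x' \<noteq> 0"
      using x X3_X0 by (auto simp: A_def)
    define k where "k = h' \<otimes>\<^bsub>\<Lambda>\<^esub> inv\<^bsub>\<Lambda>\<^esub> h"
    have k: "k \<in> carrier \<Lambda>" using h by (simp add: k_def)
    have "\<theta> h' (f h x) = p x'" using h by (simp add: eq) (simp add: f_def)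
    then have pk: "p x' = \<theta> k (p x)" using h by (simp add: k_def f_def Y.act_mult)
    obtain g where g: "g \<in> carrier \<Gamma>" "x' = \<sigma> g x"
      using orbit_back[OF x0(3,4) k pk] by blast
    have "c (base_change k g (h \<otimes>\<^bsub>\<Lambda>\<^esub> \<delta> g)) (\<sigma> g x) = c (h \<otimes>\<^bsub>\<Lambda>\<^esub> \<delta> g) x"
      using g h k x0 pk by (intro X3_act) auto
    also have "base_change k g (h \<otimes>\<^bsub>\<Lambda>\<^esub> \<delta> g) = h'"
      using g h by (simp add: k_def Y.m_assoc)
    finally have "c h x * c (h \<otimes>\<^bsub>\<Lambda>\<^esub> \<delta> g) x \<noteq> 0" using x0(5,6) g(2) by simp
    then have "g = \<one>\<^bsub>\<Gamma>\<^esub>" using X3_free[OF x0(1) g(1) _ h(1)] by blast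
    then have "x' = x" using g by simp
    then have "inv\<^bsub>\<Lambda>\<^esub> h = inv\<^bsub>\<Lambda>\<^esub> h'"
      using eq h X0D(3)[OF x0(3)] by (intro Y.free_part_inj[of "p x"]) (auto simp: f_def)
    then show "h = h'" using h by (metis Y.inv_inv)
  qed
  \<comment> \<open>The integral of the number of sets \<open>A h\<close> containing
    \<open>x\<close> equals the measure of a disjoint union in the probability space
    \<open>N\<close>.\<close>
  have "(\<integral>\<^sup>+x. (\<integral>\<^sup>+h. indicator (A h) x \<partial>count_space (carrier \<Lambda>)) \<partial>M) =
      (\<integral>\<^sup>+h. (\<integral>\<^sup>+x. indicator (A h) x \<partial>M) \<partial>count_space (carrier \<Lambda>))"
    using A Y.countable_group by (intro nn_integral_count_space_nn_integral) auto
  also have "\<dots> = (\<integral>\<^sup>+h. emeasure N (f h ` A h) \<partial>count_space (carrier \<Lambda>))"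
    using A scaled_embeddingD(3)[OF embf] by (intro nn_integral_cong) simp
  also have "\<dots> = emeasure N (\<Union>h\<in>carrier \<Lambda>. f h ` A h)"
    using A scaled_embeddingD(2)[OF embf] Y.countable_group key
    by (intro emeasure_UN_countable[symmetric]) (auto simp: disjoint_family_on_def)
  also have "\<dots> \<le> 1" by (rule Y.emeasure_le_1)
  finally have total: "(\<integral>\<^sup>+x. (\<integral>\<^sup>+h. indicator (A h) x \<partial>count_space (carrier \<Lambda>)) \<partial>M) \<le> 1" .
  have covered: "AE x in M. \<exists>h\<in>carrier \<Lambda>. x \<in> A h"
    using c_sum X3(2)
  proof eventually_elim
    case (elim x)
    show ?case
    proof (rule ccontr)
      assume "\<not> ?thesis"
      then have "(\<integral>\<^sup>+h. c h x \<partial>count_space (carrier \<Lambda>)) = (\<integral>\<^sup>+h. 0 \<partial>count_space (carrier \<Lambda>))"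
        using elim by (intro nn_integral_cong) (auto simp: A_def)
      then show False using elim by simp
    qed
  qed
  have pair: "AE x in M. \<not> (x \<in> A h \<and> x \<in> A h')"
    if h: "h \<in> carrier \<Lambda>" "h' \<in> carrier \<Lambda>" "h \<noteq> h'" for h h'
  proof -
    let ?I = "A h \<inter> A h'"
    have I: "?I \<in> sets M" using A h by auto
    \<comment> \<open>This number is almost everywhere at least 1, and at least 2 on the
      intersection, while its integral is at most 1.\<close>
    have "1 + emeasure M ?I = (\<integral>\<^sup>+x. 1 + indicator ?I x \<partial>M)"
      using I X.emeasure_space_1 by (subst nn_integral_add) auto
    also have "\<dots> \<le> (\<integral>\<^sup>+x. (\<integral>\<^sup>+h. indicator (A h) x \<partial>count_space (carrier \<Lambda>)) \<partial>M)"
    proof (rule nn_integral_mono_AE)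
      show "AE x in M. 1 + indicator ?I x \<le> (\<integral>\<^sup>+h. indicator (A h) x \<partial>count_space (carrier \<Lambda>))"
        using covered
      proof eventually_elim
        case (elim x)
        then obtain h0 where h0: "h0 \<in> carrier \<Lambda>" "x \<in> A h0" by blast
        define F where "F = (if x \<in> ?I then {h, h'} else {h0})"
        have F: "F \<subseteq> carrier \<Lambda>" "finite F" "\<And>k. k \<in> F \<Longrightarrow> x \<in> A k"
          using h h0 by (auto simp: F_def split: if_splits)
        have "1 + indicator ?I x = (of_nat (card F) :: ennreal)"
          using h by (auto simp: F_def)
        also have "\<dots> = (\<integral>\<^sup>+k. indicator F k \<partial>count_space (carrier \<Lambda>))"
          using F by (simp add: Int_absorb2)
        also have "\<dots> \<le> (\<integral>\<^sup>+h. indicator (A h) x \<partial>count_space (carrier \<Lambda>))"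
          using F by (intro nn_integral_mono) (auto simp: indicator_def)
        finally show ?case .
      qed
    qed
    also have "\<dots> \<le> 1" by (rule total)
    finally have "emeasure M ?I = 0"
      by (simp add: X.emeasure_eq_measure measure_le_0_iff flip: ennreal_1 ennreal_plus)
    then have "AE x in M. x \<notin> ?I" using I by (intro AE_not_in) auto
    then show ?thesis by eventually_elim simp
  qed
  have "AE x in M. \<forall>h\<in>carrier \<Lambda>. \<forall>h'\<in>carrier \<Lambda>. h \<noteq> h' \<longrightarrow> \<not> (x \<in> A h \<and> x \<in> A h')"
    unfolding AE_ball_countable[OF Y.countable_group]
  proof (intro ballI)
    fix h h' assume "h \<in> carrier \<Lambda>" "h' \<in> carrier \<Lambda>"
    then show "AE x in M. h \<noteq> h' \<longrightarrow> \<not> (x \<in> A h \<and> x \<in> A h')"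
      using pair[of h h'] by (cases "h = h'") auto
  qed
  with X3(2) show ?thesis by eventually_elim (auto simp: A_def)
qed

end

text \<open>\<open>u0 x\<close> is the first element, in an enumeration, with nonzero conditional
  probability over \<open>x\<close>. It is almost everywhere the only one, and \<open>u z\<close> is
  almost surely such an element over \<open>q z\<close>.\<close>

lemma u_descends:
  assumes icc: "icc_group \<Gamma>" and inj: "inj_on \<delta> (carrier \<Gamma>)"
    and emb: "scaled_embedding 1 M N X1 p"
  obtains u0 where "u0 \<in> measurable M (count_space (carrier \<Lambda>))" "AE z in M'. u z = u0 (q z)"
proof -
  obtain c where c: "fibre_dist c" by (rule fibre_dist_exists)
  define e where "e = from_nat_into (carrier \<Lambda>)"
  have e: "e n \<in> carrier \<Lambda>" for n
    unfolding e_def by (rule from_nat_into) (use Y.one_closed in blast)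
  have e_surj: "\<exists>n. e n = h" if "h \<in> carrier \<Lambda>" for h
    unfolding e_def using from_nat_into_surj[OF Y.countable_group that] .
  define n0 where "n0 x = (LEAST n. c (e n) x \<noteq> 0)" for x
  have "Measurable.pred M (\<lambda>x. c (e n) x \<noteq> 0)" for n
    using measurable_sets[OF c_meas[OF c e[of n]], of "- {0}"]
    by (auto simp: pred_def vimage_def Compl_eq)
  then have n0: "n0 \<in> measurable M (count_space UNIV)"
    unfolding n0_def[abs_def] by (rule measurable_Least)
  \<comment> \<open>Over the zero set of \<open>c h\<close> the level set of \<open>h\<close> has
    measure 0, by the integral formula that defines \<open>c h\<close>.\<close>
  have pos: "AE z in M'. \<forall>h\<in>carrier \<Lambda>. u z = h \<longrightarrow> c h (q z) \<noteq> 0"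
    unfolding AE_ball_countable[OF Y.countable_group]
  proof
    fix h assume h: "h \<in> carrier \<Lambda>"
    define B where "B = c h -` {0} \<inter> space M"
    have B: "B \<in> sets M" unfolding B_def by (rule measurable_sets[OF c_meas[OF c h]]) simp
    have S: "q -` B \<inter> {z. u z = h} \<in> sets M'"
      using measurable_sets[OF measurable_q B] sets_level[OF h] by auto
    have "emeasure M' (q -` B \<inter> {z. u z = h}) = (\<integral>\<^sup>+x. c h x * indicator B x \<partial>M)"
      by (rule c_integral[OF c h B, symmetric])
    also have "\<dots> = (\<integral>\<^sup>+x. 0 \<partial>M)"
      by (intro nn_integral_cong) (auto simp: B_def indicator_def)
    finally have "AE z in M'. z \<notin> q -` B \<inter> {z. u z = h}" using S by (intro AE_not_in) auto
    then show "AE z in M'. u z = h \<longrightarrow> c h (q z) \<noteq> 0" by eventually_elim (auto simp: B_def)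
  qed
  show ?thesis
  proof (rule that[of "\<lambda>x. e (n0 x)"])
    show "(\<lambda>x. e (n0 x)) \<in> measurable M (count_space (carrier \<Lambda>))"
      by (rule measurable_compose[OF n0]) (auto simp: e)
    show "AE z in M'. u z = e (n0 (q z))"
      using pos AE_q[OF fibre_dist_unique[OF c icc inj emb]]
    proof eventually_elim
      case (elim z)
      then have uz: "c (u z) (q z) \<noteq> 0" by simp
      obtain n where "e n = u z" using e_surj[OF u_closed[of z]] by blast
      with uz have "c (e n) (q z) \<noteq> 0" by simp
      then have "c (e (n0 (q z))) (q z) \<noteq> 0" unfolding n0_def by (rule LeastI)
      from elim(2)[rule_format, OF u_closed e uz this] show ?case .
    qed
  qed
qed

end

section \<open>Orbit equivalences as orbit maps\<close>

text \<open>The same \<open>g\<close> serves as inverse of \<open>f'\<close>: since it preserves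
  measure, the null set where \<open>f\<close> and \<open>f'\<close> differ pulls back to a null
  set.\<close>

lemma prob_iso_AE_cong:
  assumes f: "prob_iso M N f" and f': "f' \<in> measurable M N" and eq: "AE x in M. f' x = f x"
  shows "prob_iso M N f'"
proof -
  from f obtain g where fm: "f \<in> measurable M N" and df: "distr M N f = N"
    and g: "g \<in> measurable N M" "distr N M g = M"
    and gf: "AE x in M. g (f x) = x" and fg: "AE y in N. f (g y) = y"
    unfolding prob_iso_def by blast
  have "distr M N f' = distr M N f"
    using eq f' fm by (intro distr_cong_AE) auto
  moreover have "AE x in M. g (f' x) = x" using eq gf by eventually_elim simp
  moreover have "AE y in N. f' (g y) = f (g y)"
    using AE_distrD[OF g(1), of "\<lambda>x. f' x = f x"] eq by (simp only: g(2))
  with fg have "AE y in N. f' (g y) = y" by eventually_elim simp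
  ultimately show ?thesis using f' df g unfolding prob_iso_def by auto
qed

text \<open>Without amplification there is a single level and the factor is 1, hence the one-point
  index set.\<close>

lemma orbit_map_of_orbit_equivalence:
  fixes M :: "'x::polish_space measure" and N :: "'y::polish_space measure"
  assumes X: "standard_prob_space M" "mp_action \<Gamma> M \<sigma>" "free_action \<Gamma> M \<sigma>"
    and Y: "standard_prob_space N" "mp_action \<Lambda> N \<theta>" "free_action \<Lambda> N \<theta>"
    and oe: "orbit_equivalence M (orbit_rel \<Gamma> M \<sigma>) N (orbit_rel \<Lambda> N \<theta>) \<Delta>"
  obtains X1 where "orbit_map \<Gamma> M \<sigma> \<Lambda> N \<theta> \<Delta> 1 {()} (\<lambda>_. ()) X1" "scaled_embedding 1 M N X1 \<Delta>"
proof -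
  interpret X: mp_system \<Gamma> M \<sigma> using X by unfold_locales
  interpret Y: mp_system \<Lambda> N \<theta> using Y by unfold_locales
  from oe obtain Z where iso: "prob_iso M N \<Delta>" and Z: "Z \<in> null_sets M"
    and rel: "\<And>x x'. x \<notin> Z \<Longrightarrow> x' \<notin> Z \<Longrightarrow> (x, x') \<in> orbit_rel \<Gamma> M \<sigma> \<longleftrightarrow> (\<Delta> x, \<Delta> x') \<in> orbit_rel \<Lambda> N \<theta>"
    by (auto simp: orbit_equivalence_def)
  obtain A where A: "A \<in> sets M" "AE x in M. x \<in> A" "scaled_embedding 1 M N A \<Delta>"
    using scaled_embedding_if_prob_iso[OF iso] .
  have emb: "scaled_embedding 1 M N (A - Z) \<Delta>" using A(3) by (rule scaled_embedding_subset) auto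
  have "orbit_map \<Gamma> M \<sigma> \<Lambda> N \<theta> \<Delta> 1 {()} (\<lambda>_. ()) (A - Z)"
  proof unfold_locales
    show "\<Delta> \<in> measurable M N" using iso by (simp add: prob_iso_def)
    show "A - Z \<in> sets M" using A(1) Z by auto
    show "AE x in M. x \<in> A - Z" using A(2) AE_not_in[OF Z] by eventually_elim simp
    show "scaled_embedding 1 M N {x \<in> A - Z. () = j} \<Delta>" for j
      using emb by (rule scaled_embedding_subset) auto
    show "(\<exists>g\<in>carrier \<Gamma>. x' = \<sigma> g x) \<longleftrightarrow> (\<exists>h\<in>carrier \<Lambda>. \<Delta> x' = \<theta> h (\<Delta> x))"
      if "x \<in> A - Z" "x' \<in> A - Z" for x x'
      using rel[of x x'] that by (simp add: orbit_rel_def X.mem_orbit_iff Y.mem_orbit_iff)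
  qed (use X Y in auto)
  then show ?thesis using that emb by blast
qed

section \<open>Amplified orbit relations\<close>

text \<open>The cyclic factor acts transitively on the second coordinate, through the difference
  \<open>i' - i\<close>, so only the first coordinate restricts the orbit.\<close>

lemma mem_orbit_amp_action:
  assumes "m > 0" "i' \<in> carrier (integer_mod_group m)"
  shows "(y', i') \<in> orbit (H \<times>\<times> integer_mod_group m) (amp_action \<theta> m) (y, i) \<longleftrightarrow> (\<exists>h\<in>carrier H. y' = \<theta> h y)"
proof
  assume "(y', i') \<in> orbit (H \<times>\<times> integer_mod_group m) (amp_action \<theta> m) (y, i)"
  then show "\<exists>h\<in>carrier H. y' = \<theta> h y"
    by (auto simp: orbit_def amp_action_def)
next
  assume "\<exists>h\<in>carrier H. y' = \<theta> h y"
  then obtain h where h: "h \<in> carrier H" "y' = \<theta> h y" by blast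
  let ?k = "(i' - i) mod int m"
  have k: "?k \<in> carrier (integer_mod_group m)" using assms(1) by (simp add: integer_mod_group_def)
  have "?k \<otimes>\<^bsub>integer_mod_group m\<^esub> i = ((i' - i) mod int m + i) mod int m"
    using assms(1) by (simp add: integer_mod_group_def)
  also have "\<dots> = i'"
    using assms by (simp add: mod_add_left_eq integer_mod_group_def)
  finally show "(y', i') \<in> orbit (H \<times>\<times> integer_mod_group m) (amp_action \<theta> m) (y, i)"
    unfolding orbit_def amp_action_def using h k by (auto intro!: exI[of _ h] exI[of _ ?k])
qed

text \<open>The levels of the amplification serve as pieces. Each level carries weight
  \<open>1 / m\<close> and the domain is normalized by \<open>t / m\<close>, so projecting a level
  to \<open>N\<close> multiplies measures by \<open>t\<close>.\<close>

lemma orbit_map_of_amplified_orbit_equivalence: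
  fixes M :: "'x::polish_space measure" and N :: "'y::polish_space measure" and t :: real
  assumes X: "standard_prob_space M" "mp_action \<Gamma> M \<sigma>" "free_action \<Gamma> M \<sigma>"
    and Y: "standard_prob_space N" "mp_action \<Lambda> N \<theta>" "free_action \<Lambda> N \<theta>"
    and t: "t > 0" and E: "amp_domain N t m E"
    and oe: "orbit_equivalence M (orbit_rel \<Gamma> M \<sigma>) (uniform_measure (amp_space N m) E) (amp_rel \<Lambda> N \<theta> m E) \<Delta>"
  obtains X1 where
    "orbit_map \<Gamma> M \<sigma> \<Lambda> N \<theta> (fst \<circ> \<Delta>) (ennreal t) (carrier (integer_mod_group m)) (snd \<circ> \<Delta>) X1"
proof -
  interpret X: mp_system \<Gamma> M \<sigma> using X by unfold_locales
  interpret Y: mp_system \<Lambda> N \<theta> using Y by unfold_locales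
  let ?I = "carrier (integer_mod_group m)"
  let ?P = "uniform_measure (amp_space N m) E"
  have m: "m > 0" using t E by (cases m) (auto simp: amp_domain_def)
  have I: "finite ?I" "?I \<noteq> {}" "card ?I = m" using m by (auto simp: carrier_integer_mod_group)
  interpret U: prob_space "uniform_count_measure ?I"
    using I by (intro prob_space_uniform_count_measure)
  interpret A: pair_prob_space N "uniform_count_measure ?I" ..
  have amp: "amp_space N m = N \<Otimes>\<^sub>M uniform_count_measure ?I" by (simp add: amp_space_def)
  have E_sets: "E \<in> sets (N \<Otimes>\<^sub>M uniform_count_measure ?I)"
    and E_meas: "measure (N \<Otimes>\<^sub>M uniform_count_measure ?I) E = t / real m"
    using E by (auto simp: amp_domain_def amp)
  have E_emeas: "emeasure (N \<Otimes>\<^sub>M uniform_count_measure ?I) E = ennreal (t / real m)"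
    using E_meas by (simp add: A.emeasure_eq_measure)
  have E_pos: "emeasure (N \<Otimes>\<^sub>M uniform_count_measure ?I) E \<noteq> 0"
    "emeasure (N \<Otimes>\<^sub>M uniform_count_measure ?I) E \<noteq> \<infinity>"
    using t m by (auto simp: E_emeas)
  from oe obtain Z where iso: "prob_iso M ?P \<Delta>" and Z: "Z \<in> null_sets M"
    and rel: "\<And>x x'. x \<notin> Z \<Longrightarrow> x' \<notin> Z \<Longrightarrow> (x, x') \<in> orbit_rel \<Gamma> M \<sigma> \<longleftrightarrow> (\<Delta> x, \<Delta> x') \<in> amp_rel \<Lambda> N \<theta> m E"
    by (auto simp: orbit_equivalence_def)
  obtain A where A: "A \<in> sets M" "AE x in M. x \<in> A" "scaled_embedding 1 M ?P A \<Delta>"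
    using scaled_embedding_if_prob_iso[OF iso] .
  have \<Delta>_P: "\<Delta> \<in> measurable M ?P" using iso by (simp add: prob_iso_def)
  have \<Delta>: "\<Delta> \<in> measurable M (N \<Otimes>\<^sub>M uniform_count_measure ?I)" and distr_\<Delta>: "distr M ?P \<Delta> = ?P"
    using iso by (auto simp: prob_iso_def amp measurable_cong_sets[OF refl sets_uniform_measure])
  \<comment> \<open>The normalized measure is concentrated on \<open>E\<close>, so almost every
    point is sent into \<open>E\<close>, as membership in \<open>amp_rel\<close> demands.\<close>
  have "AE y in ?P. y \<in> E"
    by (rule AE_uniform_measureI) (use E_sets amp in auto)
  then have AE_E: "AE x in M. \<Delta> x \<in> E"
    using AE_distrD[OF \<Delta>_P, of "\<lambda>y. y \<in> E"] by (simp only: distr_\<Delta>)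
  define X1 where "X1 = (A - Z) \<inter> \<Delta> -` E"
  have X1: "X1 \<in> sets M"
  proof -
    have "\<Delta> -` E \<inter> space M \<in> sets M" using \<Delta> E_sets by (rule measurable_sets)
    then show ?thesis unfolding X1_def using A(1) Z by auto
  qed
  have emb: "scaled_embedding 1 M ?P X1 \<Delta>"
    using A(3) by (rule scaled_embedding_subset) (auto simp: X1_def)
  have snd_I: "snd (\<Delta> x) \<in> ?I" for x
    using measurable_space[OF \<Delta>, of x] by (auto simp: space_pair_measure space_uniform_count_measure)
  have "orbit_map \<Gamma> M \<sigma> \<Lambda> N \<theta> (fst \<circ> \<Delta>) (ennreal t) ?I (snd \<circ> \<Delta>) X1"
  proof unfold_locales
    show "fst \<circ> \<Delta> \<in> measurable M N" using \<Delta> by (rule measurable_comp) simp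
    show "ennreal t \<noteq> 0" using t by simp
    show "countable ?I" using I(1) by (rule countable_finite)
    have "snd \<circ> \<Delta> \<in> measurable M (uniform_count_measure ?I)" using \<Delta> by (rule measurable_comp) simp
    then show "snd \<circ> \<Delta> \<in> measurable M (count_space ?I)"
      by (simp add: measurable_cong_sets[OF refl sets_uniform_count_measure_count_space])
    show "X1 \<in> sets M" by (rule X1)
    show "AE x in M. x \<in> X1"
      using A(2) AE_not_in[OF Z] AE_E by eventually_elim (simp add: X1_def)
    show "(\<exists>g\<in>carrier \<Gamma>. x' = \<sigma> g x) \<longleftrightarrow> (\<exists>h\<in>carrier \<Lambda>. (fst \<circ> \<Delta>) x' = \<theta> h ((fst \<circ> \<Delta>) x))"
      if x: "x \<in> X1" "x' \<in> X1" for x x'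
    proof -
      have "(\<exists>g\<in>carrier \<Gamma>. x' = \<sigma> g x) \<longleftrightarrow> (\<Delta> x, \<Delta> x') \<in> amp_rel \<Lambda> N \<theta> m E"
        using rel[of x x'] x by (simp add: X1_def orbit_rel_def X.mem_orbit_iff)
      also have "\<dots> \<longleftrightarrow> \<Delta> x' \<in> orbit (\<Lambda> \<times>\<times> integer_mod_group m) (amp_action \<theta> m) (\<Delta> x)"
        using x sets.sets_into_space[OF E_sets] by (auto simp: amp_rel_def orbit_rel_def amp X1_def)
      also have "\<dots> \<longleftrightarrow> (\<exists>h\<in>carrier \<Lambda>. fst (\<Delta> x') = \<theta> h (fst (\<Delta> x)))"
        using mem_orbit_amp_action[OF m snd_I[of x'], of "fst (\<Delta> x')" \<Lambda> \<theta> "fst (\<Delta> x)" "snd (\<Delta> x)"] by simp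
      finally show ?thesis by simp
    qed
    show "scaled_embedding (ennreal t) M N {x \<in> X1. (snd \<circ> \<Delta>) x = j} (fst \<circ> \<Delta>)" if j: "j \<in> ?I" for j
      unfolding scaled_embedding_def
    proof (intro conjI ballI impI)
      show "inj_on (fst \<circ> \<Delta>) {x \<in> X1. (snd \<circ> \<Delta>) x = j}"
        using scaled_embeddingD(1)[OF emb] by (auto simp: inj_on_def prod_eq_iff)
      fix C assume C: "C \<in> sets M" "C \<subseteq> {x \<in> X1. (snd \<circ> \<Delta>) x = j}"
      \<comment> \<open>The second coordinate is constantly \<open>j\<close> on \<open>C\<close>, so
        the image of \<open>C\<close> is the copy of \<open>T\<close> at level \<open>j\<close>, and
        \<open>T\<close> is measurable as a section of it.\<close>
      define T where "T = (fst \<circ> \<Delta>) ` C"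
      have "\<Delta> ` C = (\<lambda>x. ((fst \<circ> \<Delta>) x, j)) ` C"
        using C(2) by (intro image_cong) (auto simp: prod_eq_iff)
      then have \<Delta>C: "\<Delta> ` C = T \<times> {j}" by (auto simp: T_def)
      have \<Delta>C_E: "\<Delta> ` C \<subseteq> E" using C(2) by (auto simp: X1_def)
      have sets_\<Delta>C: "\<Delta> ` C \<in> sets (N \<Otimes>\<^sub>M uniform_count_measure ?I)"
        using scaled_embeddingD(2)[OF emb C(1)] C(2) by (auto simp: amp)
      have "(\<lambda>y. (y, j)) -` (\<Delta> ` C) \<in> sets N" using sets_\<Delta>C by (rule sets_Pair2)
      then have T: "T \<in> sets N" by (simp add: \<Delta>C vimage_def)
      have "emeasure ?P (\<Delta> ` C) = emeasure M C"
        using scaled_embeddingD(3)[OF emb C(1)] C(2) by auto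
      then have "measure ?P (\<Delta> ` C) = measure M C" by (simp add: measure_def)
      moreover have "measure ?P (\<Delta> ` C) = measure (N \<Otimes>\<^sub>M uniform_count_measure ?I) (\<Delta> ` C) / (t / real m)"
        using measure_uniform_measure[OF E_pos sets_\<Delta>C] \<Delta>C_E by (simp add: amp E_meas Int_absorb1)
      moreover have "measure (N \<Otimes>\<^sub>M uniform_count_measure ?I) (\<Delta> ` C) = measure N T / real m"
      proof -
        have "measure (N \<Otimes>\<^sub>M uniform_count_measure ?I) (T \<times> {j}) =
            measure N T * measure (uniform_count_measure ?I) {j}"
          using T j by (simp add: measure_def U.emeasure_pair_measure_Times enn2real_mult
              sets_uniform_count_measure)
        also have "measure (uniform_count_measure ?I) {j} = 1 / real m"
          using I j by (subst measure_uniform_count_measure) auto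
        finally show ?thesis by (simp add: \<Delta>C)
      qed
      ultimately have "measure N T = t * measure M C"
        using t m by (simp add: field_simps)
      then have "emeasure N T = ennreal t * emeasure M C"
        using t by (simp add: X.emeasure_eq_measure Y.emeasure_eq_measure ennreal_mult)
      with T show "(fst \<circ> \<Delta>) ` C \<in> sets N" "emeasure N ((fst \<circ> \<Delta>) ` C) = ennreal t * emeasure M C"
        by (simp_all add: T_def)
    qed
  qed (use X Y in auto)
  then show ?thesis by (rule that)
qed

section \<open>Superrigidity\<close>

text \<open>With \<open>q\<close> the identity, \<open>u\<close> already lives on the given space.
  As \<open>Y0\<close> has measure \<open>t\<close>, it follows that \<open>t \<le> 1\<close>; the
  realization then has one level, \<open>p\<close> is injective on \<open>X1\<close>, and the
  extension to the full group is available.\<close>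

lemma superrigid_amplified_orbit_equivalence:
  fixes M :: "'x::polish_space measure" and N :: "'y::polish_space measure" and t :: real
  assumes X: "standard_prob_space M" "mp_action \<Gamma> M \<sigma>" "free_action \<Gamma> M \<sigma>"
    and Y: "standard_prob_space N" "mp_action \<Lambda> N \<theta>" "free_action \<Lambda> N \<theta>" "ergodic_action \<Lambda> N \<theta>"
    and nfn: "no_finite_normal_subgroups \<Gamma>" and sr: "cocycle_superrigid \<Gamma> M \<sigma>"
    and t: "t > 0" and E: "amp_domain N t m E"
    and oe: "orbit_equivalence M (orbit_rel \<Gamma> M \<sigma>) (uniform_measure (amp_space N m) E) (amp_rel \<Lambda> N \<theta> m E) \<Delta>"
  shows "\<exists>n::nat. real n = 1 / t \<and>
    (\<exists>\<Lambda>0 Y0 \<alpha> \<delta>. subgroup \<Lambda>0 \<Lambda> \<and> card (rcosets\<^bsub>\<Lambda>\<^esub> \<Lambda>0) = n \<and>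
       Y0 \<in> sets N \<and> measure N Y0 = 1 / real n \<and> (\<forall>h\<in>\<Lambda>0. \<theta> h ` Y0 = Y0) \<and>
       \<alpha> \<in> full_group \<Lambda> N \<theta> \<and> \<delta> \<in> iso \<Gamma> (\<Lambda>\<lparr>carrier := \<Lambda>0\<rparr>) \<and>
       prob_iso M (uniform_measure N Y0) (\<alpha> \<circ> (fst \<circ> \<Delta>)) \<and>
       conjugates \<Gamma> M (\<alpha> \<circ> (fst \<circ> \<Delta>)) \<sigma> (\<lambda>g. restrict (\<theta> (\<delta> g)) Y0))"
proof -
  define p where "p = fst \<circ> \<Delta>"
  obtain X1 where "orbit_map \<Gamma> M \<sigma> \<Lambda> N \<theta> p (ennreal t) (carrier (integer_mod_group m)) (snd \<circ> \<Delta>) X1"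
    unfolding p_def using orbit_map_of_amplified_orbit_equivalence[OF X Y(1-3) t E oe] .
  then interpret orbit_map \<Gamma> M \<sigma> \<Lambda> N \<theta> p "ennreal t" "carrier (integer_mod_group m)" "snd \<circ> \<Delta>" X1 .
  interpret L: lifted_orbit_map \<Gamma> M \<sigma> \<Lambda> N \<theta> p "ennreal t" "carrier (integer_mod_group m)" "snd \<circ> \<Delta>" X1 M \<sigma> id
    by unfold_locales (simp add: action_quotient_map_def conjugates_def id_def)
  obtain \<delta> u where \<delta>: "\<delta> \<in> hom \<Gamma> \<Lambda>" and u: "u \<in> measurable M (count_space (carrier \<Lambda>))"
    and twist: "\<And>g. g \<in> carrier \<Gamma> \<Longrightarrow> AE x in M.
      \<theta> (inv\<^bsub>\<Lambda>\<^esub> (u (\<sigma> g x))) (p (id (\<sigma> g x))) = \<theta> (\<delta> g) (\<theta> (inv\<^bsub>\<Lambda>\<^esub> (u x)) (p (id x)))"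
    using L.untwist[OF sr] by blast
  interpret T: untwisted_lift \<Gamma> M \<sigma> \<Lambda> N \<theta> p "ennreal t" "carrier (integer_mod_group m)" "snd \<circ> \<Delta>" X1 M \<sigma> id \<delta> u
    using \<delta> u twist by unfold_locales
  have inj: "inj_on \<delta> (carrier \<Gamma>)" using nfn by (rule T.inj_\<delta>)
  define \<Phi> where "\<Phi> x = \<theta> (inv\<^bsub>\<Lambda>\<^esub> (u x)) (p x)" for x
  have equiv: "AE x in M. \<Phi> (\<sigma> g x) = \<theta> (\<delta> g) (\<Phi> x)" if "g \<in> carrier \<Gamma>" for g
    using twist[OF that] by (simp add: \<Phi>_def)
  then have equiv': "conjugates \<Gamma> M \<Phi> \<sigma> (\<lambda>g. \<theta> (\<delta> g))" by (simp add: conjugates_def)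
  let ?\<Lambda>0 = "\<delta> ` carrier \<Gamma>"
  obtain Y0 where Y0: "Y0 \<in> sets N" "emeasure N Y0 = ennreal t"
    and Y0_inv: "\<And>h. h \<in> ?\<Lambda>0 \<Longrightarrow> \<theta> h ` Y0 = Y0"
    and index: "ennreal t * of_nat (card (rcosets\<^bsub>\<Lambda>\<^esub> ?\<Lambda>0)) = 1"
    and iso: "prob_iso M (uniform_measure N Y0) \<Phi>" and \<Phi>Y0: "AE x in M. \<Phi> x \<in> Y0"
    and ext: "scaled_embedding (ennreal t) M N X1 p \<Longrightarrow> \<exists>\<alpha>\<in>full_group \<Lambda> N \<theta>. AE x in M. \<alpha> (p x) = \<Phi> x"
    using untwisted_conjugacy[OF Y(4) \<delta> inj u \<Phi>_def equiv'] by auto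
  have measure_Y0: "measure N Y0 = t" using Y0(2) t by (simp add: measure_def)
  then have "t \<le> 1" using Y.prob_le_1[of Y0] by simp
  then have m: "m = 1" using E by (simp add: amp_domain_def)
  \<comment> \<open>The integers modulo 1 consist of 0 alone, so this piece is all of
    \<open>X1\<close>.\<close>
  have "scaled_embedding (ennreal t) M N {x\<in>X1. (snd \<circ> \<Delta>) x = 0} p"
    by (rule pieces) (simp add: m carrier_integer_mod_group)
  moreover have "(snd \<circ> \<Delta>) x = 0" for x
    using idx_in_J[of x] by (auto simp: m carrier_integer_mod_group)
  ultimately obtain \<alpha> where \<alpha>: "\<alpha> \<in> full_group \<Lambda> N \<theta>" and \<alpha>p: "AE x in M. \<alpha> (p x) = \<Phi> x"
    using ext by auto
  define n where "n = card (rcosets\<^bsub>\<Lambda>\<^esub> ?\<Lambda>0)"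
  have "ennreal (t * real n) = ennreal 1"
    using index t by (simp add: n_def ennreal_mult ennreal_of_nat_eq_real_of_nat)
  then have n: "t * real n = 1" using t by (subst (asm) ennreal_inj) auto
  then have n': "real n = 1 / t" using t by (simp add: field_simps)
  have \<alpha>_meas: "\<alpha> \<in> measurable N N" using \<alpha> by (simp add: full_group_def prob_iso_def)
  have "\<alpha> \<circ> p \<in> measurable M (uniform_measure N Y0)"
    using measurable_comp[OF measurable_p \<alpha>_meas]
    by (simp add: measurable_cong_sets[OF refl sets_uniform_measure])
  with iso have "prob_iso M (uniform_measure N Y0) (\<alpha> \<circ> p)"
    by (rule prob_iso_AE_cong) (use \<alpha>p in simp)
  moreover have "conjugates \<Gamma> M (\<alpha> \<circ> p) \<sigma> (\<lambda>g. restrict (\<theta> (\<delta> g)) Y0)"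
    unfolding conjugates_def
  proof
    fix g assume g: "g \<in> carrier \<Gamma>"
    show "AE x in M. (\<alpha> \<circ> p) (\<sigma> g x) = restrict (\<theta> (\<delta> g)) Y0 ((\<alpha> \<circ> p) x)"
      using X.AE_act[OF g \<alpha>p] \<alpha>p equiv[OF g] \<Phi>Y0 by eventually_elim simp
  qed
  moreover have "\<delta> \<in> iso \<Gamma> (\<Lambda>\<lparr>carrier := ?\<Lambda>0\<rparr>)"
    using \<delta> inj by (auto simp: iso_def hom_def bij_betw_def)
  moreover have "measure N Y0 = 1 / real n" using measure_Y0 by (simp add: n')
  ultimately show ?thesis
    using n' T.\<delta>.img_is_subgroup Y0(1) Y0_inv \<alpha> unfolding n_def p_def by blast
qed

text \<open>Once \<open>u\<close> descends, equivariance passes from the lift to the quotient. The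
  factor is 1, so the image of \<open>\<delta>\<close> has index 1 and \<open>\<delta>\<close> is
  onto.\<close>

lemma superrigid_quotient_orbit_equivalence:
  fixes M :: "'x::polish_space measure" and N :: "'y::polish_space measure"
    and M' :: "'z::polish_space measure"
  assumes X: "standard_prob_space M" "mp_action \<Gamma> M \<sigma>" "free_action \<Gamma> M \<sigma>"
    and Y: "standard_prob_space N" "mp_action \<Lambda> N \<theta>" "free_action \<Lambda> N \<theta>" "ergodic_action \<Lambda> N \<theta>"
    and icc: "icc_group \<Gamma>"
    and Z: "standard_prob_space M'" "mp_action \<Gamma> M' \<sigma>'" and sr: "cocycle_superrigid \<Gamma> M' \<sigma>'"
    and q: "action_quotient_map \<Gamma> M' \<sigma>' M \<sigma> q"
    and oe: "orbit_equivalence M (orbit_rel \<Gamma> M \<sigma>) N (orbit_rel \<Lambda> N \<theta>) \<Delta>"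
  shows "\<exists>\<alpha> \<delta>. \<alpha> \<in> full_group \<Lambda> N \<theta> \<and> \<delta> \<in> iso \<Gamma> \<Lambda> \<and>
    conjugates \<Gamma> M (\<alpha> \<circ> \<Delta>) \<sigma> (\<lambda>g. \<theta> (\<delta> g))"
proof -
  obtain X1 where "orbit_map \<Gamma> M \<sigma> \<Lambda> N \<theta> \<Delta> 1 {()} (\<lambda>_. ()) X1" and emb: "scaled_embedding 1 M N X1 \<Delta>"
    using orbit_map_of_orbit_equivalence[OF X Y(1-3) oe] .
  then interpret orbit_map \<Gamma> M \<sigma> \<Lambda> N \<theta> \<Delta> 1 "{()}" "\<lambda>_. ()" X1 by simp
  interpret L: lifted_orbit_map \<Gamma> M \<sigma> \<Lambda> N \<theta> \<Delta> 1 "{()}" "\<lambda>_. ()" X1 M' \<sigma>' q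
    using Z q by unfold_locales
  obtain \<delta> u where \<delta>: "\<delta> \<in> hom \<Gamma> \<Lambda>" and u: "u \<in> measurable M' (count_space (carrier \<Lambda>))"
    and twist: "\<And>g. g \<in> carrier \<Gamma> \<Longrightarrow> AE z in M'.
      \<theta> (inv\<^bsub>\<Lambda>\<^esub> (u (\<sigma>' g z))) (\<Delta> (q (\<sigma>' g z))) = \<theta> (\<delta> g) (\<theta> (inv\<^bsub>\<Lambda>\<^esub> (u z)) (\<Delta> (q z)))"
    using L.untwist[OF sr] by blast
  interpret T: untwisted_lift \<Gamma> M \<sigma> \<Lambda> N \<theta> \<Delta> 1 "{()}" "\<lambda>_. ()" X1 M' \<sigma>' q \<delta> u
    using \<delta> u twist by unfold_locales
  have inj: "inj_on \<delta> (carrier \<Gamma>)"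
    using icc_no_finite_normal_subgroups[OF icc] by (rule T.inj_\<delta>)
  obtain u0 where u0: "u0 \<in> measurable M (count_space (carrier \<Lambda>))" and u_u0: "AE z in M'. u z = u0 (q z)"
    using T.u_descends[OF icc inj emb] .
  define \<Phi> where "\<Phi> x = \<theta> (inv\<^bsub>\<Lambda>\<^esub> (u0 x)) (\<Delta> x)" for x
  have "(\<lambda>x. inv\<^bsub>\<Lambda>\<^esub> (u0 x)) \<in> measurable M (count_space (carrier \<Lambda>))"
    using u0 by (rule measurable_compose) auto
  then have \<Phi>_meas: "\<Phi> \<in> measurable M N"
    unfolding \<Phi>_def[abs_def] using measurable_p by (rule Y.measurable_piecewise_act)
  have equiv: "AE x in M. \<Phi> (\<sigma> g x) = \<theta> (\<delta> g) (\<Phi> x)" if g: "g \<in> carrier \<Gamma>" for g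
  proof -
    have "(\<lambda>x. \<Phi> (\<sigma> g x)) \<in> measurable M N" "(\<lambda>x. \<theta> (\<delta> g) (\<Phi> x)) \<in> measurable M N"
      using measurable_compose[OF X.measurable_action[OF g] \<Phi>_meas]
        measurable_compose[OF \<Phi>_meas Y.measurable_action] g by auto
    \<comment> \<open>Measurability of the set where the identity holds allows it to be checked
      after pulling back along \<open>q\<close>.\<close>
    then have "{x \<in> space M. \<Phi> (\<sigma> g x) = \<theta> (\<delta> g) (\<Phi> x)} \<in> sets M"
      by (intro measurable_equality_set) (simp_all only: measurable_cong_sets[OF refl Y.sets_eq])
    moreover have "AE z in M'. \<Phi> (\<sigma> g (q z)) = \<theta> (\<delta> g) (\<Phi> (q z))"
      using twist[OF g] L.q_act[OF g] u_u0 L.Z.AE_act[OF g u_u0] by eventually_elim (simp add: \<Phi>_def)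
    ultimately have "AE x in distr M' M q. \<Phi> (\<sigma> g x) = \<theta> (\<delta> g) (\<Phi> x)"
      by (subst AE_distr_iff[OF L.measurable_q])
    then show ?thesis by (simp only: L.distr_q)
  qed
  then have equiv': "conjugates \<Gamma> M \<Phi> \<sigma> (\<lambda>g. \<theta> (\<delta> g))" by (simp add: conjugates_def)
  let ?\<Lambda>0 = "\<delta> ` carrier \<Gamma>"
  obtain \<alpha> where \<alpha>: "\<alpha> \<in> full_group \<Lambda> N \<theta>" and \<alpha>p: "AE x in M. \<alpha> (\<Delta> x) = \<Phi> x"
    and index: "1 * of_nat (card (rcosets\<^bsub>\<Lambda>\<^esub> ?\<Lambda>0)) = (1 :: ennreal)"
    using untwisted_conjugacy[OF Y(4) \<delta> inj u0 \<Phi>_def equiv'] emb by blast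
  have "card (rcosets\<^bsub>\<Lambda>\<^esub> ?\<Lambda>0) = 1"
    using index by (metis mult_1 of_nat_1 of_nat_eq_iff)
  then obtain C where C: "rcosets\<^bsub>\<Lambda>\<^esub> ?\<Lambda>0 = {C}" by (auto simp: card_1_singleton_iff)
  have sub: "subgroup ?\<Lambda>0 \<Lambda>" by (rule T.\<delta>.img_is_subgroup)
  have "carrier \<Lambda> \<subseteq> ?\<Lambda>0"
  proof
    fix h assume h: "h \<in> carrier \<Lambda>"
    have "?\<Lambda>0 #>\<^bsub>\<Lambda>\<^esub> h \<in> rcosets\<^bsub>\<Lambda>\<^esub> ?\<Lambda>0" "?\<Lambda>0 #>\<^bsub>\<Lambda>\<^esub> \<one>\<^bsub>\<Lambda>\<^esub> \<in> rcosets\<^bsub>\<Lambda>\<^esub> ?\<Lambda>0"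
      using h by (auto simp: RCOSETS_def)
    then have "?\<Lambda>0 #>\<^bsub>\<Lambda>\<^esub> h = ?\<Lambda>0 #>\<^bsub>\<Lambda>\<^esub> \<one>\<^bsub>\<Lambda>\<^esub>" unfolding C by simp
    also have "\<dots> = ?\<Lambda>0" using sub subgroup.subset by (intro Y.coset_mult_one) blast
    finally show "h \<in> ?\<Lambda>0" using Y.rcos_self[OF h sub] by simp
  qed
  then have "\<delta> \<in> iso \<Gamma> \<Lambda>"
    using \<delta> inj by (auto simp: iso_def bij_betw_def hom_def)
  moreover have "conjugates \<Gamma> M (\<alpha> \<circ> \<Delta>) \<sigma> (\<lambda>g. \<theta> (\<delta> g))"
    unfolding conjugates_def
  proof
    fix g assume g: "g \<in> carrier \<Gamma>"
    show "AE x in M. (\<alpha> \<circ> \<Delta>) (\<sigma> g x) = \<theta> (\<delta> g) ((\<alpha> \<circ> \<Delta>) x)"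
      using X.AE_act[OF g \<alpha>p] \<alpha>p equiv[OF g] by eventually_elim simp
  qed
  ultimately show ?thesis using \<alpha> by blast
qed

theorem theorem5p6:
  fixes \<Gamma> :: "'g monoid" and M :: "'x::polish_space measure" and \<sigma> :: "'g \<Rightarrow> 'x \<Rightarrow> 'x"
    and \<Lambda> :: "'h monoid" and N :: "'y::polish_space measure" and \<theta> :: "'h \<Rightarrow> 'y \<Rightarrow> 'y"
  assumes "standard_prob_space M" and "mp_action \<Gamma> M \<sigma>" and "free_action \<Gamma> M \<sigma>"
    and "standard_prob_space N" and "mp_action \<Lambda> N \<theta>" and "free_action \<Lambda> N \<theta>"
    and "ergodic_action \<Lambda> N \<theta>"
  shows
    "(no_finite_normal_subgroups \<Gamma> \<and> weakly_mixing_action \<Gamma> M \<sigma> \<and> cocycle_superrigid \<Gamma> M \<sigma> \<longrightarrow>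
       (\<forall>t m E \<Delta>. t > 0 \<and> amp_domain N t m E \<and>
          orbit_equivalence M (orbit_rel \<Gamma> M \<sigma>)
            (uniform_measure (amp_space N m) E) (amp_rel \<Lambda> N \<theta> m E) \<Delta> \<longrightarrow>
          (\<exists>n::nat. real n = 1 / t \<and>
            (\<exists>\<Lambda>0 Y0 \<alpha> \<delta>. subgroup \<Lambda>0 \<Lambda> \<and> card (rcosets\<^bsub>\<Lambda>\<^esub> \<Lambda>0) = n \<and>
               Y0 \<in> sets N \<and> measure N Y0 = 1 / real n \<and> (\<forall>h\<in>\<Lambda>0. \<theta> h ` Y0 = Y0) \<and>
               \<alpha> \<in> full_group \<Lambda> N \<theta> \<and> \<delta> \<in> iso \<Gamma> (\<Lambda>\<lparr>carrier := \<Lambda>0\<rparr>) \<and>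
               prob_iso M (uniform_measure N Y0) (\<alpha> \<circ> (fst \<circ> \<Delta>)) \<and>
               conjugates \<Gamma> M (\<alpha> \<circ> (fst \<circ> \<Delta>)) \<sigma> (\<lambda>g. restrict (\<theta> (\<delta> g)) Y0)))))
     \<and>
     (icc_group \<Gamma> \<and>
       (\<exists>(M' :: 'z::polish_space measure) \<sigma>' q. standard_prob_space M' \<and> mp_action \<Gamma> M' \<sigma>' \<and>
          weakly_mixing_action \<Gamma> M' \<sigma>' \<and> cocycle_superrigid \<Gamma> M' \<sigma>' \<and>
          action_quotient_map \<Gamma> M' \<sigma>' M \<sigma> q) \<longrightarrow>
       (\<forall>\<Delta>. orbit_equivalence M (orbit_rel \<Gamma> M \<sigma>) N (orbit_rel \<Lambda> N \<theta>) \<Delta> \<longrightarrow>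
          (\<exists>\<alpha> \<delta>. \<alpha> \<in> full_group \<Lambda> N \<theta> \<and> \<delta> \<in> iso \<Gamma> \<Lambda> \<and>
             conjugates \<Gamma> M (\<alpha> \<circ> \<Delta>) \<sigma> (\<lambda>g. \<theta> (\<delta> g)))))"
proof (intro conjI impI allI)
  fix t m E \<Delta>
  assume "no_finite_normal_subgroups \<Gamma> \<and> weakly_mixing_action \<Gamma> M \<sigma> \<and> cocycle_superrigid \<Gamma> M \<sigma>"
    and "t > 0 \<and> amp_domain N t m E \<and> orbit_equivalence M (orbit_rel \<Gamma> M \<sigma>)
      (uniform_measure (amp_space N m) E) (amp_rel \<Lambda> N \<theta> m E) \<Delta>"
  then show "\<exists>n::nat. real n = 1 / t \<and>
    (\<exists>\<Lambda>0 Y0 \<alpha> \<delta>. subgroup \<Lambda>0 \<Lambda> \<and> card (rcosets\<^bsub>\<Lambda>\<^esub> \<Lambda>0) = n \<and>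
       Y0 \<in> sets N \<and> measure N Y0 = 1 / real n \<and> (\<forall>h\<in>\<Lambda>0. \<theta> h ` Y0 = Y0) \<and>
       \<alpha> \<in> full_group \<Lambda> N \<theta> \<and> \<delta> \<in> iso \<Gamma> (\<Lambda>\<lparr>carrier := \<Lambda>0\<rparr>) \<and>
       prob_iso M (uniform_measure N Y0) (\<alpha> \<circ> (fst \<circ> \<Delta>)) \<and>
       conjugates \<Gamma> M (\<alpha> \<circ> (fst \<circ> \<Delta>)) \<sigma> (\<lambda>g. restrict (\<theta> (\<delta> g)) Y0))"
    by (elim conjE) (rule superrigid_amplified_orbit_equivalence[OF assms])
next
  fix \<Delta>
  assume "icc_group \<Gamma> \<and> (\<exists>(M' :: 'z measure) \<sigma>' q. standard_prob_space M' \<and> mp_action \<Gamma> M' \<sigma>' \<and>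
      weakly_mixing_action \<Gamma> M' \<sigma>' \<and> cocycle_superrigid \<Gamma> M' \<sigma>' \<and> action_quotient_map \<Gamma> M' \<sigma>' M \<sigma> q)"
    and "orbit_equivalence M (orbit_rel \<Gamma> M \<sigma>) N (orbit_rel \<Lambda> N \<theta>) \<Delta>"
  then show "\<exists>\<alpha> \<delta>. \<alpha> \<in> full_group \<Lambda> N \<theta> \<and> \<delta> \<in> iso \<Gamma> \<Lambda> \<and>
      conjugates \<Gamma> M (\<alpha> \<circ> \<Delta>) \<sigma> (\<lambda>g. \<theta> (\<delta> g))"
    by (elim conjE exE) (rule superrigid_quotient_orbit_equivalence[OF assms])
qed

end
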